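(* Let $R_5=\mathbb Z[a,b,c,d,e,e^{-1}]$ and let $H_5$ be the quotient of the group algebra $R_5B_3$ of the braid group $B_3=\langle s_1,s_2\mid s_1s_2s_1=s_2s_1s_2\rangle$ by the relations $s_i^5=as_i^4+bs_i^3+cs_i^2+ds_i+e$, $i=1,2$. Then $H_5$ is a free $R_5$-module of rank $600$. Therefore the BMR freeness conjecture holds for the exceptional group $G_{16}$, i.e. the generic Hecke algebra of $G_{16}$ is a free module of rank $|G_{16}|=600$ over its ring of definition.
   Context: $G_{16}=B_3/\langle s_1^5,s_2^5\rangle$ has order $600$. Its generic Hecke algebra is the quotient of the group algebra of $B_3$ over the ring $\tilde R_5=\mathbb Z[u_1^{\pm1},\dots,u_5^{\pm1}]$ by the relations $\prod_{j=1}^5(s_i-u_j)=0$, $i=1,2$. *)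

theory Defs
  imports "HOL.Modules" "HOL-Library.Poly_Mapping" "HOL-Library.Product_Plus"
begin

text \<open>
  Groups are written additively (class \<^class>\<open>group_add\<close>, which is not assumed commutative), because the
  convolution product on \<open>'g \<Rightarrow>\<^sub>0 'r\<close> is taken with respect to addition on the exponents. So
  \<open>'g \<Rightarrow>\<^sub>0 'r\<close> is the group (or monoid) algebra of \<open>'g\<close> over \<open>'r\<close>.
\<close>

datatype braid_gen = S1 | S2

text \<open>A letter \<open>(g, False)\<close> stands for the generator \<open>g\<close>, and \<open>(g, True)\<close> for its inverse.\<close>

type_synonym braid_word = "(braid_gen \<times> bool) list"

inductive braid_eq :: "braid_word \<Rightarrow> braid_word \<Rightarrow> bool" where
  refl: "braid_eq v v"
| sym: "braid_eq v w \<Longrightarrow> braid_eq w v"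
| trans: "braid_eq u v \<Longrightarrow> braid_eq v w \<Longrightarrow> braid_eq u w"
| append: "braid_eq v v' \<Longrightarrow> braid_eq w w' \<Longrightarrow> braid_eq (v @ w) (v' @ w')"
| cancel: "braid_eq [(g, b), (g, \<not> b)] []"
| braid: "braid_eq [(S1, False), (S2, False), (S1, False)] [(S2, False), (S1, False), (S2, False)]"

definition inverse_word :: "braid_word \<Rightarrow> braid_word" where
  "inverse_word w = rev (map (\<lambda>(g, b). (g, \<not> b)) w)"

lemma inverse_word_append: "inverse_word (v @ w) = inverse_word w @ inverse_word v"
  by (simp add: inverse_word_def)

lemma braid_eq_left_inverse: "braid_eq (inverse_word w @ w) []"
proof (induction w)
  case Nil
  show ?case by (simp add: inverse_word_def braid_eq.refl)
next
  case (Cons l w)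
  obtain g b where l: "l = (g, b)" by fastforce
  have "braid_eq ([(g, \<not> b), (g, \<not> \<not> b)] @ w) ([] @ w)"
    by (intro braid_eq.append braid_eq.cancel braid_eq.refl)
  then have "braid_eq (inverse_word w @ ([(g, \<not> b), (g, b)] @ w)) (inverse_word w @ w)"
    by (intro braid_eq.append braid_eq.refl) simp
  then show ?case
    using Cons.IH by (auto simp: l inverse_word_def intro: braid_eq.trans)
qed

lemma inverse_word_inverse_word [simp]: "inverse_word (inverse_word w) = w"
  by (simp add: inverse_word_def rev_map case_prod_beta comp_def)

lemma braid_eq_inverse_word:
  assumes "braid_eq v w"
  shows "braid_eq (inverse_word v) (inverse_word w)"
proof -
  have "braid_eq (inverse_word v @ []) (inverse_word v @ (w @ inverse_word w))"
    using braid_eq_left_inverse[of "inverse_word w"]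
    by (intro braid_eq.append braid_eq.refl) (simp add: braid_eq.sym)
  moreover have "braid_eq (inverse_word v @ (w @ inverse_word w)) (inverse_word v @ (v @ inverse_word w))"
    by (intro braid_eq.append braid_eq.refl braid_eq.sym[OF assms])
  moreover have "braid_eq ((inverse_word v @ v) @ inverse_word w) ([] @ inverse_word w)"
    by (intro braid_eq.append braid_eq.refl braid_eq_left_inverse)
  ultimately show ?thesis
    by (auto intro: braid_eq.trans)
qed

quotient_type braid3 = braid_word / braid_eq
  by (intro equivpI reflpI sympI transpI) (blast intro: braid_eq.intros)+

instantiation braid3 :: group_add
begin

lift_definition zero_braid3 :: braid3 is "[]" .
lift_definition plus_braid3 :: "braid3 \<Rightarrow> braid3 \<Rightarrow> braid3" is "(@)"
  by (rule braid_eq.append)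
lift_definition uminus_braid3 :: "braid3 \<Rightarrow> braid3" is inverse_word
  by (rule braid_eq_inverse_word)
definition minus_braid3 :: "braid3 \<Rightarrow> braid3 \<Rightarrow> braid3" where
  "minus_braid3 x y = x + - y"

instance
proof
  fix x y z :: braid3
  show "x + y + z = x + (y + z)" by transfer (simp add: braid_eq.refl)
  show "0 + x = x" by transfer (simp add: braid_eq.refl)
  show "x + 0 = x" by transfer (simp add: braid_eq.refl)
  show "- x + x = 0" by transfer (rule braid_eq_left_inverse)
  show "x + - y = x - y" by (simp add: minus_braid3_def)
qed

end

lift_definition s1 :: braid3 is "[(S1, False)]" .
lift_definition s2 :: braid3 is "[(S2, False)]" .

lemma braid_relation: "s1 + s2 + s1 = s2 + s1 + s2"
  by transfer (use braid_eq.braid in simp)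

inductive_set normal_closure :: "'g::group_add set \<Rightarrow> 'g set" for S where
  base: "x \<in> S \<Longrightarrow> x \<in> normal_closure S"
| zero: "0 \<in> normal_closure S"
| add: "x \<in> normal_closure S \<Longrightarrow> y \<in> normal_closure S \<Longrightarrow> x + y \<in> normal_closure S"
| uminus: "x \<in> normal_closure S \<Longrightarrow> - x \<in> normal_closure S"
| conj: "x \<in> normal_closure S \<Longrightarrow> g + x + - g \<in> normal_closure S"

lemma equivp_normal_closure: "equivp (\<lambda>x y. x - y \<in> normal_closure S)"
proof (intro equivpI reflpI sympI transpI)
  fix x y z
  show "x - x \<in> normal_closure S" by (simp add: normal_closure.zero)
  show "y - x \<in> normal_closure S" if "x - y \<in> normal_closure S"
    using normal_closure.uminus[OF that] by simp
  show "x - z \<in> normal_closure S" if "x - y \<in> normal_closure S" "y - z \<in> normal_closure S"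
    using normal_closure.add[OF that] by (simp add: add_diff_eq)
qed

definition g16_relators :: "braid3 set" where
  "g16_relators = {s1 + s1 + s1 + s1 + s1, s2 + s2 + s2 + s2 + s2}"

quotient_type g16 = braid3 / "\<lambda>x y. x - y \<in> normal_closure g16_relators"
  by (rule equivp_normal_closure)

instantiation g16 :: group_add
begin

lift_definition zero_g16 :: g16 is 0 .
lift_definition plus_g16 :: "g16 \<Rightarrow> g16 \<Rightarrow> g16" is "(+)"
proof -
  fix x x' y y' :: braid3
  assume "x - x' \<in> normal_closure g16_relators" "y - y' \<in> normal_closure g16_relators"
  then have "(x + (y - y') + - x) + (x - x') \<in> normal_closure g16_relators"
    by (intro normal_closure.add normal_closure.conj)
  also have "(x + (y - y') + - x) + (x - x') = (x + y) - (x' + y')"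
    by (simp only: diff_conv_add_uminus minus_add add.assoc minus_add_cancel add_minus_cancel minus_minus left_minus right_minus add_0_left add_0_right)
  finally show "(x + y) - (x' + y') \<in> normal_closure g16_relators" .
qed
lift_definition uminus_g16 :: "g16 \<Rightarrow> g16" is uminus
proof -
  fix x y :: braid3
  assume "x - y \<in> normal_closure g16_relators"
  then have "- y + - (x - y) + - (- y) \<in> normal_closure g16_relators"
    by (intro normal_closure.conj normal_closure.uminus)
  also have "- y + - (x - y) + - (- y) = - x - - y"
    by (simp only: diff_conv_add_uminus minus_add add.assoc minus_add_cancel add_minus_cancel minus_minus left_minus right_minus add_0_left add_0_right)
  finally show "- x - - y \<in> normal_closure g16_relators" .
qed
definition minus_g16 :: "g16 \<Rightarrow> g16 \<Rightarrow> g16" where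
  "minus_g16 x y = x + - y"

instance
proof
  fix x y z :: g16
  show "x + y + z = x + (y + z)" by transfer (simp add: add.assoc normal_closure.zero)
  show "0 + x = x" by transfer (simp add: normal_closure.zero)
  show "x + 0 = x" by transfer (simp add: normal_closure.zero)
  show "- x + x = 0" by transfer (simp add: normal_closure.zero)
  show "x + - y = x - y" by (simp add: minus_g16_def)
qed

end

inductive_set two_sided_ideal :: "'a::ring_1 set \<Rightarrow> 'a set" for S where
  base: "x \<in> S \<Longrightarrow> x \<in> two_sided_ideal S"
| zero: "0 \<in> two_sided_ideal S"
| add: "x \<in> two_sided_ideal S \<Longrightarrow> y \<in> two_sided_ideal S \<Longrightarrow> x + y \<in> two_sided_ideal S"
| mult_left: "x \<in> two_sided_ideal S \<Longrightarrow> r * x \<in> two_sided_ideal S"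
| mult_right: "x \<in> two_sided_ideal S \<Longrightarrow> x * r \<in> two_sided_ideal S"

lemma two_sided_ideal_uminus: "x \<in> two_sided_ideal S \<Longrightarrow> - x \<in> two_sided_ideal S"
  using two_sided_ideal.mult_left[of x S "- 1"] by simp

lemma equivp_two_sided_ideal: "equivp (\<lambda>x y. x - y \<in> two_sided_ideal S)"
proof (intro equivpI reflpI sympI transpI)
  fix x y z
  show "x - x \<in> two_sided_ideal S" by (simp add: two_sided_ideal.zero)
  show "y - x \<in> two_sided_ideal S" if "x - y \<in> two_sided_ideal S"
    using two_sided_ideal_uminus[OF that] by simp
  show "x - z \<in> two_sided_ideal S" if "x - y \<in> two_sided_ideal S" "y - z \<in> two_sided_ideal S"
    using two_sided_ideal.add[OF that] by simp
qed

lemma two_sided_ideal_cong_add: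
  assumes "x - x' \<in> two_sided_ideal S" "y - y' \<in> two_sided_ideal S"
  shows "(x + y) - (x' + y') \<in> two_sided_ideal S"
  using two_sided_ideal.add[OF assms] by (simp add: algebra_simps)

lemma two_sided_ideal_cong_uminus:
  assumes "x - y \<in> two_sided_ideal S"
  shows "(- x) - (- y) \<in> two_sided_ideal S"
  using two_sided_ideal_uminus[OF assms] by simp

lemma two_sided_ideal_cong_minus:
  assumes "x - x' \<in> two_sided_ideal S" "y - y' \<in> two_sided_ideal S"
  shows "(x - y) - (x' - y') \<in> two_sided_ideal S"
  using two_sided_ideal_cong_add[OF assms(1) two_sided_ideal_cong_uminus[OF assms(2)]] by simp

lemma two_sided_ideal_cong_mult:
  assumes "x - x' \<in> two_sided_ideal S" "y - y' \<in> two_sided_ideal S"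
  shows "x * y - x' * y' \<in> two_sided_ideal S"
proof -
  have "(x - x') * y + x' * (y - y') \<in> two_sided_ideal S"
    using assms by (intro two_sided_ideal.add two_sided_ideal.mult_left two_sided_ideal.mult_right)
  then show ?thesis by (simp add: algebra_simps)
qed

text \<open>
  Finiteness of \<open>B\<close> is required explicitly because \<^const>\<open>card\<close> is 0 on infinite sets.
\<close>

definition free_of_rank :: "('r::comm_ring_1 \<Rightarrow> 'm::ab_group_add \<Rightarrow> 'm) \<Rightarrow> nat \<Rightarrow> bool" where
  "free_of_rank scale n \<longleftrightarrow> module scale \<and>
     (\<exists>B. finite B \<and> card B = n \<and> \<not> module.dependent scale B \<and> module.span scale B = UNIV)"

abbreviation scalar :: "'r \<Rightarrow> ('g::monoid_add \<Rightarrow>\<^sub>0 'r::comm_ring_1)" where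
  "scalar r \<equiv> Poly_Mapping.single 0 r"

abbreviation group_elem :: "'g::monoid_add \<Rightarrow> ('g \<Rightarrow>\<^sub>0 'r::comm_ring_1)" where
  "group_elem g \<equiv> Poly_Mapping.single g 1"

text \<open>
  The ring \<open>\<int>[a,b,c,d,e,e\<inverse>]\<close>: the key \<open>(i, j, k, l, m)\<close> is the exponent of the monomial
  \<open>a\<^sup>i b\<^sup>j c\<^sup>k d\<^sup>l e\<^sup>m\<close>, and only \<open>m\<close> may be negative.
\<close>

type_synonym r5 = "(nat \<times> nat \<times> nat \<times> nat \<times> int) \<Rightarrow>\<^sub>0 int"

definition r5_a :: r5 where "r5_a = Poly_Mapping.single (1, 0, 0, 0, 0) 1"
definition r5_b :: r5 where "r5_b = Poly_Mapping.single (0, 1, 0, 0, 0) 1"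
definition r5_c :: r5 where "r5_c = Poly_Mapping.single (0, 0, 1, 0, 0) 1"
definition r5_d :: r5 where "r5_d = Poly_Mapping.single (0, 0, 0, 1, 0) 1"
definition r5_e :: r5 where "r5_e = Poly_Mapping.single (0, 0, 0, 0, 1) 1"

definition h5_relator :: "braid3 \<Rightarrow> (braid3 \<Rightarrow>\<^sub>0 r5)" where
  "h5_relator s = group_elem s ^ 5 -
     (scalar r5_a * group_elem s ^ 4 + scalar r5_b * group_elem s ^ 3 +
      scalar r5_c * group_elem s ^ 2 + scalar r5_d * group_elem s + scalar r5_e)"

text \<open>
  Only \<^class>\<open>ring\<close> and \<^class>\<open>monoid_mult\<close> are instantiated for the quotients, since \<^class>\<open>ring_1\<close> would
  include the claim that the quotient is non-trivial.
\<close>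

quotient_type h5 = "braid3 \<Rightarrow>\<^sub>0 r5" /
    "\<lambda>x y. x - y \<in> two_sided_ideal {h5_relator s1, h5_relator s2}"
  by (rule equivp_two_sided_ideal)

instantiation h5 :: "{ring, monoid_mult}"
begin

lift_definition zero_h5 :: h5 is 0 .
lift_definition one_h5 :: h5 is 1 .
lift_definition plus_h5 :: "h5 \<Rightarrow> h5 \<Rightarrow> h5" is "(+)" by (rule two_sided_ideal_cong_add)
lift_definition uminus_h5 :: "h5 \<Rightarrow> h5" is uminus by (rule two_sided_ideal_cong_uminus)
lift_definition minus_h5 :: "h5 \<Rightarrow> h5 \<Rightarrow> h5" is "(-)" by (rule two_sided_ideal_cong_minus)
lift_definition times_h5 :: "h5 \<Rightarrow> h5 \<Rightarrow> h5" is "(*)" by (rule two_sided_ideal_cong_mult)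

instance
  by intro_classes (transfer; simp add: algebra_simps two_sided_ideal.zero)+

end

definition scale_h5 :: "r5 \<Rightarrow> h5 \<Rightarrow> h5" where
  "scale_h5 r x = abs_h5 (scalar r) * x"

interpretation h5: module scale_h5
  by unfold_locales
    (simp_all add: scale_h5_def distrib_left distrib_right single_add mult_single mult.assoc
      flip: plus_h5.abs_eq times_h5.abs_eq one_h5.abs_eq,
     simp_all add: mult_single times_h5.abs_eq flip: mult.assoc)

text \<open>The Laurent polynomial ring in \<open>u1\<close>, ..., \<open>u5\<close> over the integers, again by exponents.\<close>

type_synonym laurent5 = "(int \<times> int \<times> int \<times> int \<times> int) \<Rightarrow>\<^sub>0 int"

definition u1 :: laurent5 where "u1 = Poly_Mapping.single (1, 0, 0, 0, 0) 1"
definition u2 :: laurent5 where "u2 = Poly_Mapping.single (0, 1, 0, 0, 0) 1"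
definition u3 :: laurent5 where "u3 = Poly_Mapping.single (0, 0, 1, 0, 0) 1"
definition u4 :: laurent5 where "u4 = Poly_Mapping.single (0, 0, 0, 1, 0) 1"
definition u5 :: laurent5 where "u5 = Poly_Mapping.single (0, 0, 0, 0, 1) 1"

definition hecke_g16_relator :: "braid3 \<Rightarrow> (braid3 \<Rightarrow>\<^sub>0 laurent5)" where
  "hecke_g16_relator s = (\<Prod>u\<leftarrow>[u1, u2, u3, u4, u5]. group_elem s - scalar u)"

quotient_type hecke_g16 = "braid3 \<Rightarrow>\<^sub>0 laurent5" /
    "\<lambda>x y. x - y \<in> two_sided_ideal {hecke_g16_relator s1, hecke_g16_relator s2}"
  by (rule equivp_two_sided_ideal)

instantiation hecke_g16 :: "{ring, monoid_mult}"
begin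

lift_definition zero_hecke_g16 :: hecke_g16 is 0 .
lift_definition one_hecke_g16 :: hecke_g16 is 1 .
lift_definition plus_hecke_g16 :: "hecke_g16 \<Rightarrow> hecke_g16 \<Rightarrow> hecke_g16" is "(+)"
  by (rule two_sided_ideal_cong_add)
lift_definition uminus_hecke_g16 :: "hecke_g16 \<Rightarrow> hecke_g16" is uminus
  by (rule two_sided_ideal_cong_uminus)
lift_definition minus_hecke_g16 :: "hecke_g16 \<Rightarrow> hecke_g16 \<Rightarrow> hecke_g16" is "(-)"
  by (rule two_sided_ideal_cong_minus)
lift_definition times_hecke_g16 :: "hecke_g16 \<Rightarrow> hecke_g16 \<Rightarrow> hecke_g16" is "(*)"
  by (rule two_sided_ideal_cong_mult)

instance
  by intro_classes (transfer; simp add: algebra_simps two_sided_ideal.zero)+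

end

definition scale_hecke_g16 :: "laurent5 \<Rightarrow> hecke_g16 \<Rightarrow> hecke_g16" where
  "scale_hecke_g16 r x = abs_hecke_g16 (scalar r) * x"

interpretation hecke_g16: module scale_hecke_g16
  by unfold_locales
    (simp_all add: scale_hecke_g16_def distrib_left distrib_right single_add mult_single mult.assoc
      flip: plus_hecke_g16.abs_eq times_hecke_g16.abs_eq one_hecke_g16.abs_eq,
     simp_all add: mult_single times_hecke_g16.abs_eq flip: mult.assoc)

end

theory Submission
  imports Defs "HOL-Computational_Algebra.Formal_Power_Series"
begin

text \<open>
  Put \<open>s = s\<^sub>1\<close>, \<open>t = s\<^sub>1 s\<^sub>2 s\<^sub>1\<close> and \<open>z = t\<^sup>2\<close>, which is central. The \<open>600\<close> candidate basis elements are
  \<open>z\<^sup>k s\<^sup>i w\<close> with \<open>0 \<le> i \<le> 4\<close>, where \<open>w\<close> is one of the twelve elements \<open>1\<close>, \<open>t s\<^sup>j\<close>, \<open>t s\<^sup>2 t s\<^sup>j\<close>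
  (\<open>-2 \<le> j \<le> 2\<close>) and a correction of \<open>t s\<^sup>2 t s\<^sup>-\<^sup>2 t\<close>, and \<open>k\<close> runs through a window of ten consecutive integers
  that depends on \<open>w\<close>. Their span contains \<open>1\<close> and is stable under right multiplication by \<open>s\<close> and \<open>t\<close>.

  For independence, adjoin to the coefficients a root \<open>l\<close> of the quintic and an invertible variable \<open>z\<close>. The braid
  group acts on the free module with basis the twelve elements \<open>w\<close>, with \<open>s\<close> acting by \<open>l\<close> on the first of them, and the
  quintic polynomial in \<open>s\<close> maps this module onto the multiples of a single vector \<open>q\<close>. The submodule \<open>N\<close> generated
  by \<open>q\<close> is spanned by twelve vectors, so \<open>H\<^sub>5\<close> acts modulo \<open>N\<close>. If \<open>a = b = c = d = 0\<close>, then these vectors are unit multiples of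
  \<open>z\<^sup>1\<^sup>0 - l\<^sup>6\<^sup>0\<close> times the basis vectors in another order. Comparing terms of lowest degree in \<open>a, b, c, d\<close>, no nonzero
  vector whose coordinates have \<open>z\<close>-exponents in windows of length ten lies in \<open>N\<close>.

  The matrices of right multiplication on the basis of \<open>H\<^sub>5\<close> carry the result to the other coefficient rings: to the
  Laurent polynomials, and with \<open>a = b = c = d = 0\<close>, \<open>e = 1\<close> to \<open>\<int>[G\<^sub>1\<^sub>6]\<close>, where the basis consists of group elements.
\<close>

subsection \<open>A spanning set\<close>

text \<open>Modulo \<open>z\<close> and \<open>s^5\<close> the braid group becomes A5, acting on the
  twelve vertices of an icosahedron. If s fixes a vertex, its orbits have sizes 1, 5, 5, 1: these
  are the four types in \<open>Idx\<close>. Ten is the order of z in G16. The last word belongs to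
  the vertex opposite to the fixed one, so it conjugates s to its inverse up to the centre: passing
  s through it gives \<open>e^-2 z^2 s^-1\<close> and shorter terms. Each such step costs two powers
  of z and the quintic closes after five steps; hence windows of length ten and the factor
  \<open>z^10 - l^60\<close>.

  The obstacle to spanning is the ends of the windows. Multiplication by t leads to
  \<open>z^-6 t s^3 t\<close>, \<open>z^4 t s^-3 t\<close>, \<open>z^5 t\<close>,
  \<open>z^4 t s^2 t\<close> and \<open>z^5 t s^-3 t\<close>, which direct expansion does not place
  in the span. The first three are recovered by comparing the quintic relation with the iterated
  step on the last word, multiplying by t or by \<open>t s^2 t\<close>, and solving for the boundary
  element; the other two then follow.\<close>

type_synonym idx = "int \<times> int \<times> int \<times> int"

definition Idx :: "idx set" where
  "Idx = {0} \<times> {-4..5} \<times> {0..4} \<times> {0} \<union> {1} \<times> {-5..4} \<times> {0..4} \<times> {-2..2}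
     \<union> {2} \<times> {-6..3} \<times> {0..4} \<times> {-2..2} \<union> {3} \<times> {-6..3} \<times> {0..4} \<times> {0}"

lemma finite_Idx [simp]: "finite Idx"
  by (simp add: Idx_def)

lemma card_Idx: "card Idx = 600"
  unfolding Idx_def by (simp add: card_Un_disjoint Int_Un_distrib2 Times_Int_Times card_cartesian_product)

text \<open>Stated for bare operations so that one formula covers both the lifts in the group
  algebra and their images in each quotient. The parameter \<open>f\<close> stands for d/e.\<close>

definition gen :: "('r \<Rightarrow> 'h \<Rightarrow> 'h) \<Rightarrow> 'r \<Rightarrow> 'r \<Rightarrow> (int \<Rightarrow> 'h) \<Rightarrow> (int \<Rightarrow> 'h) \<Rightarrow> 'h \<Rightarrow> idx \<Rightarrow> 'h::ring" where
  "gen scale a f s z t = (\<lambda>(n, k, i, j). z k * (s i *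
     (if n = 0 then s 0
      else if n = 1 then t * s j
      else if n = 2 then t * (s 2 * (t * s j))
      else t * (s 2 * (t * (s (- 2) * t))) - scale a (z 1 * (s (- 1) * (t * (s (- 3) * t))))
        + scale f (t * (s 3 * t) * s 1))))"

text \<open>\<open>t_s_t\<close> is the braid relation rewritten for t = s1 s2 s1, and
  \<open>quintic\<close> is the defining relation multiplied by s^-2, which makes the five exponents
  -2, ..., 2 symmetric. The algebra H5, the Hecke algebra and the integral group ring all become
  instances.\<close>

locale hecke5 = module scale
  for scale :: "'r::comm_ring_1 \<Rightarrow> 'h::{ring,monoid_mult} \<Rightarrow> 'h" (infixr "\<cdot>" 75) +
  fixes a b c d e e' :: 'r and s z :: "int \<Rightarrow> 'h" and t :: 'h
  assumes scale_mult_left [simp]: "(r \<cdot> u) * v = r \<cdot> (u * v)"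
    and scale_mult_right [simp]: "u * (r \<cdot> v) = r \<cdot> (u * v)"
    and unit_e: "e * e' = 1"
    and s_add [simp]: "s i * s j = s (i + j)" and s_0 [simp]: "s 0 = 1"
    and z_add [simp]: "z i * z j = z (i + j)" and z_0 [simp]: "z 0 = 1"
    and s_z [simp]: "s j * z i = z i * s j" and t_z [simp]: "t * z i = z i * t"
    and t_t [simp]: "t * t = z 1" and t_s_t: "t * s (- 1) * t = s 1 * t * s 1"
    and quintic: "s 3 = a \<cdot> s 2 + b \<cdot> s 1 + c \<cdot> s 0 + d \<cdot> s (- 1) + e \<cdot> s (- 2)"
begin

section \<open>Rewriting words in t, s and z\<close>

lemma assoc_simps [simp]:
  "s i * (s j * w) = s (i + j) * w" "z i * (z j * w) = z (i + j) * w"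
  "s j * (z i * w) = z i * (s j * w)" "t * (z i * w) = z i * (t * w)"
  "t * (t * w) = z 1 * w"
  by (simp_all flip: mult.assoc)

lemma mult_cong_assoc: "u * (v * w) = x \<Longrightarrow> u * (v * (w * y)) = x * (y::'h)"
  by (simp flip: mult.assoc)

lemma t_sm1_t: "t * (s (- 1) * t) = s 1 * (t * s 1)"
  using t_s_t by (simp only: mult.assoc)

lemma t_s1_t: "t * (s 1 * t) = z 1 * (s (- 1) * (t * s (- 1)))"
proof -
  have "t * (t * (s (-1) * t)) * s (-1) = t * (s 1 * (t * s 1)) * s (-1)"
    by (simp only: t_sm1_t)
  then show ?thesis
    by (simp add: mult.assoc)
qed

lemmas t_s_t_simps [simp] = t_sm1_t t_s1_t
  mult_cong_assoc[OF t_sm1_t, simplified mult.assoc] mult_cong_assoc[OF t_s1_t, simplified mult.assoc]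

text \<open>Comes from \<open>t s^-1 t = s t s\<close>, multiplied on the right by t: an exponent is
  raised by one at the price of a longer word and a factor z^-1.\<close>

lemma t_s_minus: "t * (s (i - 1) * w) = z (- 1) * (s 1 * (t * (s 1 * (t * (s i * w)))))"
proof -
  have "t * (s (- 1) * (t * (t * (s i * w)))) = s 1 * (t * (s 1 * (t * (s i * w))))"
    by (simp only: mult_cong_assoc[OF t_sm1_t] mult.assoc)
  then have "z (- 1) * (z 1 * (t * (s (i - 1) * w))) = z (- 1) * (s 1 * (t * (s 1 * (t * (s i * w)))))"
    by simp
  then show ?thesis by (simp only: assoc_simps) simp
qed

text \<open>Interior exponents \<open>\<le> - 2\<close> are eliminated in favour of exponents \<open>\<ge> 2\<close>; then
  the words \<open>z\<^sup>k s\<^sup>i t s\<^sup>j t \<dots>\<close> with interior exponents \<open>\<ge> 2\<close> are normal forms.\<close>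

lemma t_sneg_t:
  "t * (s (- 2) * t) = z (- 1) * (s 1 * (t * (s 2 * (t * s 1))))"
  "t * (s (- 3) * t) = z (- 2) * (s 1 * (t * (s 2 * (t * (s 2 * (t * s 1))))))"
  "t * (s (- 4) * t) = z (- 3) * (s 1 * (t * (s 2 * (t * (s 2 * (t * (s 2 * (t * s 1))))))))"
  "t * (s (- 5) * t) = z (- 4) * (s 1 * (t * (s 2 * (t * (s 2 * (t * (s 2 * (t * (s 2 * (t * s 1))))))))))"
  using t_s_minus[of "-1" t] t_s_minus[of "-2" t] t_s_minus[of "-3" t] t_s_minus[of "-4" t]
  by simp_all

lemmas t_sneg_t_simps [simp] = t_sneg_t t_sneg_t[THEN mult_cong_assoc, simplified mult.assoc]

lemma quintic_up: "s (i + 3) = a \<cdot> s (i + 2) + b \<cdot> s (i + 1) + c \<cdot> s i + d \<cdot> s (i - 1) + e \<cdot> s (i - 2)"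
  using arg_cong[OF quintic, of "\<lambda>u. u * s i"] by (simp add: distrib_right add.commute)

lemma unit_e_simps [simp]: "e * e' = 1" "e' * e = 1" "e * (e' * r) = r" "e' * (e * r) = r"
  using unit_e by (simp_all add: mult.commute flip: mult.assoc)

definition D :: "int \<Rightarrow> 'h" where "D i = t * (s i * t)"
definition W :: 'h where "W = t * (s 2 * (t * (s (- 2) * t)))"
text \<open>Expanding \<open>W * s 1\<close> by the quintic produces two extreme terms:
  \<open>- d e'\<close> times \<open>D 3 * s 2\<close> at the low end, and \<open>- a e' e'\<close>
  times \<open>z 3 * (s (- 2) * D (- 3))\<close> at the high end. The d-correction absorbs the first
  on the left of \<open>Wh_s\<close>, and the a-correction absorbs the second inside the
  \<open>Wh\<close> on its right. What remains is \<open>L\<close>, whose windows are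
  narrow.\<close>

definition Wh :: 'h where
  "Wh = W - a \<cdot> (z 1 * (s (- 1) * D (- 3))) + (d * e') \<cdot> (D 3 * s 1)"
definition L :: 'h where
  "L = - ((e' * e') \<cdot> (b \<cdot> (z 3 * (s (- 3) * t)) + c \<cdot> (z 2 * (s 1 * (t * s 1))) + d \<cdot> (z 1 * (D 3 * s 1))))
     - e' \<cdot> (a \<cdot> (z 2 * (s (- 1) * D (- 3))) + b \<cdot> (z 2 * (s (- 1) * (t * s (- 1)))) + c \<cdot> (z 1 * (t * s 3)))
     - a \<cdot> (z 1 * (s (- 1) * (D (- 3) * s 1))) - (d * e' * e' * e') \<cdot> (z 2 * (s (- 1) * (D 3 * s 1)))"

lemma Wh_t: "Wh * t = z 1 * (t * (s 2 * (t * s (- 2)))) - a \<cdot> (z 2 * (s (- 1) * (t * s (- 3))))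
    + (d * e') \<cdot> (z 1 * (t * (s 2 * (t * s (- 1)))))"
  by (simp add: Wh_def W_def D_def algebra_simps)

lemma expand_up: "u * (s (i + 3) * w) = a \<cdot> (u * (s (i + 2) * w)) + b \<cdot> (u * (s (i + 1) * w))
    + c \<cdot> (u * (s i * w)) + d \<cdot> (u * (s (i - 1) * w)) + e \<cdot> (u * (s (i - 2) * w))"
  by (simp add: quintic_up distrib_left distrib_right)

lemma expand_down: "u * (s (i - 2) * w) = e' \<cdot> (u * (s (i + 3) * w) - a \<cdot> (u * (s (i + 2) * w))
    - b \<cdot> (u * (s (i + 1) * w)) - c \<cdot> (u * (s i * w)) - d \<cdot> (u * (s (i - 1) * w)))"
  by (simp add: expand_up algebra_simps)

text \<open>This identity and the next are later read backwards: they express \<open>D 3\<close> and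
  \<open>D (- 3)\<close> at the ends of the windows through \<open>Wh\<close>.\<close>

lemma Wh_sm1_t: "Wh * s (- 1) * t = D 3 * s 2 - a \<cdot> (D 2 * s 2) + (d * e') \<cdot> (z 1 * (t * s 3))"
  by (simp add: Wh_def W_def D_def algebra_simps)

lemma Wh_s_t: "Wh * s 1 * t =
   e' \<cdot> (z 3 * (s (- 1) * (D (- 3) * s (- 2)))) - (a * e') \<cdot> (z 3 * (s (- 1) * (t * s (- 3))))
   - (b * e') \<cdot> (z 2 * (t * s 1)) - (c * e') \<cdot> (z 1 * D 3) - a \<cdot> (z 2 * (s (- 1) * (D (- 4) * s (- 1))))"
  using expand_down[of "z 1 * D 2" "-1" "t * s (- 1)"]
  by (simp add: Wh_def W_def D_def algebra_simps)

text \<open>The quintic is used twice: on the exponent -3 in \<open>t s^2 t s^-3 t s^-1 t\<close>,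
  which equals \<open>W * s 1\<close>, and on the exponent -3 in its leading term
  \<open>z^2 s^-1 t s^-3 t s^-2 t\<close>. The leading term of the second expansion is
  \<open>z^2 s^-1 W\<close>.\<close>

lemma Wh_s: "Wh * s 1 = (e' * e') \<cdot> (z 2 * (s (- 1) * Wh)) + L"
  using arg_cong2[where f = "(+)", OF expand_down[of "D 2" "-1" "t * (s (-1) * t)"]
      arg_cong[where f = "scale e'", OF expand_down[of "z 2 * (s (-1) * t)" "-1" "t * (s (-2) * t)"]]]
  by (simp add: Wh_def W_def L_def D_def algebra_simps)

section \<open>Windowed submodules and stability under powers of s\<close>

definition bimod :: "'h set \<Rightarrow> bool" where
  "bimod S \<longleftrightarrow> subspace S \<and> (\<forall>i. \<forall>x\<in>S. s i * x \<in> S \<and> x * s i \<in> S)"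

lemma bimodD:
  assumes "bimod S"
  shows "0 \<in> S" "x \<in> S \<Longrightarrow> y \<in> S \<Longrightarrow> x + y \<in> S" "x \<in> S \<Longrightarrow> y \<in> S \<Longrightarrow> x - y \<in> S"
    "x \<in> S \<Longrightarrow> r \<cdot> x \<in> S" "x \<in> S \<Longrightarrow> - x \<in> S"
    "z k * x \<in> S \<Longrightarrow> z k * (s i * x) \<in> S" "z k * x \<in> S \<Longrightarrow> z k * (x * s j) \<in> S"
    "z k * x \<in> S \<Longrightarrow> z k * (s i * (x * s j)) \<in> S"
    "z k \<in> S \<Longrightarrow> z k * s i \<in> S"
    "x \<in> S \<Longrightarrow> s i * x \<in> S" "x \<in> S \<Longrightarrow> x * s i \<in> S"
proof -
  have *: "s i * x \<in> S" "x * s i \<in> S" if "x \<in> S" for i x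
    using assms that by (auto simp: bimod_def)
  show "z k * x \<in> S \<Longrightarrow> z k * (s i * x) \<in> S" "z k * x \<in> S \<Longrightarrow> z k * (x * s j) \<in> S"
    using *(1)[of "z k * x" i] *(2)[of "z k * x" j] by (simp_all add: mult.assoc)
  show "z k * x \<in> S \<Longrightarrow> z k * (s i * (x * s j)) \<in> S"
    using *(1)[of "z k * x" i, THEN *(2)[of _ j]] by (simp add: mult.assoc)
qed (use assms in \<open>auto simp: bimod_def subspace_0 subspace_add subspace_diff subspace_scale subspace_neg\<close>)

text \<open>As e is a unit, the recurrence of order five given by the quintic runs in both
  directions from any five consecutive exponents.\<close>

lemma subspace_s_powers:
  assumes S: "subspace S" and base: "\<And>j. j0 \<le> j \<Longrightarrow> j \<le> j0 + 4 \<Longrightarrow> u * (s j * v) \<in> S"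
  shows "u * (s i * v) \<in> S"
proof -
  have up: "u * (s (i + 5) * v) \<in> S" if "\<And>j. i \<le> j \<Longrightarrow> j \<le> i + 4 \<Longrightarrow> u * (s j * v) \<in> S" for i
    using expand_up[of u "i + 2" v] that[of i] that[of "i+1"] that[of "i+2"] that[of "i+3"] that[of "i+4"]
    by (simp add: add.assoc add.commute[of 1 i] subspace_add[OF S] subspace_scale[OF S])
  have down: "u * (s (i - 1) * v) \<in> S" if "\<And>j. i \<le> j \<Longrightarrow> j \<le> i + 4 \<Longrightarrow> u * (s j * v) \<in> S" for i
    using expand_down[of u "i + 1" v] that[of i] that[of "i+1"] that[of "i+2"] that[of "i+3"] that[of "i+4"]
    by (simp add: add.assoc subspace_diff[OF S] subspace_scale[OF S])
  have "\<forall>j. i \<le> j \<and> j \<le> i + 4 \<longrightarrow> u * (s j * v) \<in> S"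
  proof (induction i rule: int_induct[of _ j0])
    case base then show ?case using assms(2) by blast
  next
    case (step1 i)
    show ?case
    proof (intro allI impI)
      fix j assume "i + 1 \<le> j \<and> j \<le> i + 1 + 4"
      then show "u * (s j * v) \<in> S"
        using step1 up[of i] by (cases "j = i + 5") auto
    qed
  next
    case (step2 i)
    show ?case
    proof (intro allI impI)
      fix j assume "i - 1 \<le> j \<and> j \<le> i - 1 + 4"
      then show "u * (s j * v) \<in> S"
        using step2 down[of i] by (cases "j = i - 1") auto
    qed
  qed
  then show ?thesis by auto
qed

text \<open>Only the exponent of z is confined, separately for each family, so stability under s on
  both sides is immediate. The six bounds are parameters because the later steps must record how
  much room is left inside \<open>V0\<close>.\<close>

inductive_set V :: "int \<Rightarrow> int \<Rightarrow> int \<Rightarrow> int \<Rightarrow> int \<Rightarrow> int \<Rightarrow> 'h set" for a0 a1 b0 b1 c0 c1 where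
  zero: "0 \<in> V a0 a1 b0 b1 c0 c1"
| add: "x \<in> V a0 a1 b0 b1 c0 c1 \<Longrightarrow> y \<in> V a0 a1 b0 b1 c0 c1 \<Longrightarrow> x + y \<in> V a0 a1 b0 b1 c0 c1"
| scale: "x \<in> V a0 a1 b0 b1 c0 c1 \<Longrightarrow> r \<cdot> x \<in> V a0 a1 b0 b1 c0 c1"
| A: "a0 \<le> k \<Longrightarrow> k \<le> a1 \<Longrightarrow> z k * s i \<in> V a0 a1 b0 b1 c0 c1"
| B: "b0 \<le> k \<Longrightarrow> k \<le> b1 \<Longrightarrow> z k * (s i * (t * s j)) \<in> V a0 a1 b0 b1 c0 c1"
| C: "c0 \<le> k \<Longrightarrow> k \<le> c1 \<Longrightarrow> z k * (s i * (t * (s 2 * (t * s j)))) \<in> V a0 a1 b0 b1 c0 c1"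

lemma subspace_V: "subspace (V a0 a1 b0 b1 c0 c1)"
  by (auto simp: subspace_def intro: V.intros)

lemma bimod_V: "bimod (V a0 a1 b0 b1 c0 c1)"
proof -
  have "s l * x \<in> V a0 a1 b0 b1 c0 c1 \<and> x * s l \<in> V a0 a1 b0 b1 c0 c1" if "x \<in> V a0 a1 b0 b1 c0 c1" for x l
    using that by induction (auto simp: distrib_left distrib_right mult.assoc intro: V.intros)
  then show ?thesis by (simp add: bimod_def subspace_V)
qed

lemma V_mono:
  assumes "x \<in> V a0 a1 b0 b1 c0 c1" "a0' \<le> a0" "a1 \<le> a1'" "b0' \<le> b0" "b1 \<le> b1'" "c0' \<le> c0" "c1 \<le> c1'"
  shows "x \<in> V a0' a1' b0' b1' c0' c1'"
  using assms(1) by induction (use assms(2-) in \<open>auto intro: V.intros\<close>)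

lemma V_gens:
  "a0 \<le> k \<Longrightarrow> k \<le> a1 \<Longrightarrow> z k \<in> V a0 a1 b0 b1 c0 c1"
  "b0 \<le> k \<Longrightarrow> k \<le> b1 \<Longrightarrow> z k * t \<in> V a0 a1 b0 b1 c0 c1"
  "c0 \<le> k \<Longrightarrow> k \<le> c1 \<Longrightarrow> z k * D 2 \<in> V a0 a1 b0 b1 c0 c1"
  using V.A[of a0 k a1 0] V.B[of b0 k b1 0 0] V.C[of c0 k c1 0 0] by (simp_all add: D_def)

lemma V_mult:
  assumes x: "x \<in> V a0 a1 b0 b1 c0 c1" and S: "subspace S" and left: "\<And>i x. x \<in> S \<Longrightarrow> s i * x \<in> S"
    and A: "\<And>k. a0 \<le> k \<Longrightarrow> k \<le> a1 \<Longrightarrow> z k * m \<in> S"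
    and B: "\<And>k j. b0 \<le> k \<Longrightarrow> k \<le> b1 \<Longrightarrow> - 2 \<le> j \<Longrightarrow> j \<le> 2 \<Longrightarrow> z k * (t * (s j * m)) \<in> S"
    and C: "\<And>k j. c0 \<le> k \<Longrightarrow> k \<le> c1 \<Longrightarrow> - 2 \<le> j \<Longrightarrow> j \<le> 2 \<Longrightarrow> z k * (t * (s 2 * (t * (s j * m)))) \<in> S"
  shows "x * m \<in> S"
  using x
proof induction
  case (A k i)
  show ?case using left[OF assms(4)[OF A], of i] by (simp add: mult.assoc)
next
  case (B k i j)
  have "(z k * t) * (s j * m) \<in> S"
    by (rule subspace_s_powers[OF S, of "-2"]) (use assms(5)[OF B] in \<open>simp add: mult.assoc\<close>)
  from left[OF this, of i] show ?case by (simp add: mult.assoc)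
next
  case (C k i j)
  have "(z k * (t * (s 2 * t))) * (s j * m) \<in> S"
    by (rule subspace_s_powers[OF S, of "-2"]) (use assms(6)[OF C] in \<open>simp add: mult.assoc\<close>)
  from left[OF this, of i] show ?case by (simp add: mult.assoc)
qed (auto simp: distrib_right subspace_0[OF S] subspace_add[OF S] subspace_scale[OF S])

lemma D_small: "D 0 = z 1" "D 1 = z 1 * (s (- 1) * (t * s (- 1)))" "D (- 1) = s 1 * (t * s 1)"
  "D (- 2) = z (- 1) * (s 1 * (D 2 * s 1))"
  by (simp_all add: D_def mult.assoc)

lemma D_up: "D (i + 3) = a \<cdot> D (i + 2) + b \<cdot> D (i + 1) + c \<cdot> D i + d \<cdot> D (i - 1) + e \<cdot> D (i - 2)"
  unfolding D_def by (rule expand_up)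

lemma D_down: "D (i - 2) = e' \<cdot> (D (i + 3) - a \<cdot> D (i + 2) - b \<cdot> D (i + 1) - c \<cdot> D i - d \<cdot> D (i - 1))"
  unfolding D_def by (rule expand_down)

context
  fixes S assumes S: "bimod S"
begin

lemma D_small_in:
  "z (k + 1) \<in> S \<Longrightarrow> z k * D 0 \<in> S" "z (k + 1) * t \<in> S \<Longrightarrow> z k * D 1 \<in> S" "z k * t \<in> S \<Longrightarrow> z k * D (- 1) \<in> S"
  "z (k - 1) * D 2 \<in> S \<Longrightarrow> z k * D (- 2) \<in> S"
  using bimodD(8)[OF S, of "k + 1" t "- 1" "- 1"] bimodD(8)[OF S, of k t 1 1] bimodD(8)[OF S, of "k - 1" "D 2" 1 1]
  by (simp_all add: D_small)

lemma D3_in: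
  assumes "z k * D 2 \<in> S" "z (k - 1) * D 2 \<in> S" "z (k + 1) * t \<in> S" "z k * t \<in> S" "z (k + 1) \<in> S"
  shows "z k * D 3 \<in> S"
  using D_up[of 0] assms by (auto simp: distrib_left intro!: bimodD(1-5)[OF S] D_small_in)

lemma Dm3_in:
  assumes "z k * D 2 \<in> S" "z (k - 1) * D 2 \<in> S" "z (k + 1) * t \<in> S" "z k * t \<in> S" "z (k + 1) \<in> S"
  shows "z k * D (- 3) \<in> S"
  using D_down[of "-1"] assms by (auto simp: right_diff_distrib intro!: bimodD(1-5)[OF S] D_small_in)

lemma D4_in:
  assumes "z k * D 3 \<in> S" "z k * D 2 \<in> S" "z (k + 1) * t \<in> S" "z k * t \<in> S" "z (k + 1) \<in> S"
  shows "z k * D 4 \<in> S"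
  using D_up[of 1] assms by (auto simp: distrib_left intro!: bimodD(1-5)[OF S] D_small_in)

lemma Dm4_in:
  assumes "z k * D (- 3) \<in> S" "z (k - 1) * D 2 \<in> S" "z (k + 1) * t \<in> S" "z k * t \<in> S" "z (k + 1) \<in> S"
  shows "z k * D (- 4) \<in> S"
  using D_down[of "-2"] assms by (auto simp: right_diff_distrib intro!: bimodD(1-5)[OF S] D_small_in)

end

text \<open>The bound \<open>k - 1\<close> is caused by \<open>D (- 2)\<close>, which is
  \<open>z (- 1) * (s 1 * (D 2 * s 1))\<close>, and the bounds \<open>k + 1\<close> by
  \<open>D 0\<close> and \<open>D 1\<close>. For \<open>V0\<close> this leaves k = -5, ..., 3, so
  \<open>z (- 6) * D 3\<close> and \<open>z 4 * D (- 3)\<close> need arguments of their own.\<close>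

lemma D_in_V:
  assumes "a0 \<le> k + 1" "k + 1 \<le> a1" "b0 \<le> k" "k + 1 \<le> b1" "c0 \<le> k - 1" "k \<le> c1"
  shows "z k * D 3 \<in> V a0 a1 b0 b1 c0 c1" "z k * D (- 3) \<in> V a0 a1 b0 b1 c0 c1"
    "z k * D 4 \<in> V a0 a1 b0 b1 c0 c1" "z k * D (- 4) \<in> V a0 a1 b0 b1 c0 c1"
proof -
  show 3: "z k * D 3 \<in> V a0 a1 b0 b1 c0 c1" "z k * D (- 3) \<in> V a0 a1 b0 b1 c0 c1"
    using assms by (auto intro!: D3_in Dm3_in bimod_V V_gens)
  then show "z k * D 4 \<in> V a0 a1 b0 b1 c0 c1" "z k * D (- 4) \<in> V a0 a1 b0 b1 c0 c1"
    using assms by (auto intro!: D4_in Dm4_in bimod_V V_gens)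
qed

lemma L_in_V: "z k * L \<in> V (k + 2) (k + 3) (k + 1) (k + 3) k (k + 2)"
  unfolding L_def
  by (auto simp: distrib_left right_diff_distrib D_in_V V_gens intro!: bimodD(1-5)[OF bimod_V] V.B
      bimodD(6-8)[OF bimod_V] V.A
      V.B[of _ _ _ _ 0, simplified] V.B[of _ _ _ 0, simplified])

abbreviation "V0 \<equiv> V (- 4) 5 (- 5) 4 (- 6) 3"

inductive_set U :: "'h set" where
  V: "x \<in> V0 \<Longrightarrow> x \<in> U"
| add: "x \<in> U \<Longrightarrow> y \<in> U \<Longrightarrow> x + y \<in> U"
| scale: "x \<in> U \<Longrightarrow> r \<cdot> x \<in> U"
| W: "- 6 \<le> k \<Longrightarrow> k \<le> 3 \<Longrightarrow> z k * (s i * Wh) \<in> U"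

lemma subspace_U: "subspace U"
  by (auto simp: subspace_def intro: U.intros V.zero)

lemma U_left: "x \<in> U \<Longrightarrow> s i * x \<in> U"
  by (induction rule: U.induct) (auto simp: distrib_left intro: U.intros bimodD(10)[OF bimod_V])

lemma V_U:
  assumes "x \<in> V a0 a1 b0 b1 c0 c1" "- 4 \<le> a0" "a1 \<le> 5" "- 5 \<le> b0" "b1 \<le> 4" "- 6 \<le> c0" "c1 \<le> 3"
  shows "x \<in> U"
  using V_mono[OF assms] by (rule U.V)

text \<open>The quintic relation makes the chain \<open>Wh, Wh s, \<dots>, Wh s\<^sup>4\<close> stable under right multiplication by
  \<open>s\<close>, while each step of it raises the \<open>z\<close>-degree by two up to elements of \<open>V0\<close>.\<close>

lemma Wh_chain:
  assumes "- 6 \<le> k" "k + 2 * int n \<le> 3"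
  shows "z k * (Wh * s (int n)) - (e' * e') ^ n \<cdot> (z (k + 2 * int n) * (s (- int n) * Wh)) \<in> V0"
  using assms
proof (induction n)
  case 0
  show ?case by (simp add: V.zero)
next
  case (Suc n)
  have "(z k * (Wh * s (int n)) - (e' * e') ^ n \<cdot> (z (k + 2 * int n) * (s (- int n) * Wh))) * s 1 \<in> V0"
    using Suc by (intro bimodD(11)[OF bimod_V]) simp
  moreover have "z (k + 2 * int n) * L \<in> V0"
    by (rule V_mono[OF L_in_V]) (use Suc.prems in auto)
  then have "(e' * e') ^ n \<cdot> (z (k + 2 * int n) * (s (- int n) * L)) \<in> V0"
    by (intro bimodD(4,6)[OF bimod_V])
  ultimately have "(z k * (Wh * s (int n)) - (e' * e') ^ n \<cdot> (z (k + 2 * int n) * (s (- int n) * Wh))) * s 1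
     + (e' * e') ^ n \<cdot> (z (k + 2 * int n) * (s (- int n) * L)) \<in> V0"
    by (rule V.add)
  also have "(z k * (Wh * s (int n)) - (e' * e') ^ n \<cdot> (z (k + 2 * int n) * (s (- int n) * Wh))) * s 1
     + (e' * e') ^ n \<cdot> (z (k + 2 * int n) * (s (- int n) * L)) =
     z k * (Wh * s (int (Suc n))) - (e' * e') ^ Suc n \<cdot> (z (k + 2 * int (Suc n)) * (s (- int (Suc n)) * Wh))"
    by (simp add: left_diff_distrib mult.assoc Wh_s distrib_left scale_right_distrib power_commutes algebra_simps)
  finally show ?case .
qed

text \<open>From the two lowest exponents the chain can climb four steps of two, to 2 or 3, without
  leaving the window. That gives five consecutive powers of s, hence all.\<close>

lemma Wh_s_bottom_in_U:
  assumes "k = - 6 \<or> k = - 5"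
  shows "z k * (Wh * s i) \<in> U"
proof (rule subspace_s_powers[OF subspace_U, of 0, folded mult.assoc, unfolded mult.assoc, of "z k * Wh" 1 i,
    simplified mult_1_right mult.assoc])
  fix j :: int assume j: "0 \<le> j" "j \<le> 0 + 4"
  define n where "n = nat j"
  have n: "j = int n" "n \<le> 4" using j by (auto simp: n_def)
  have "z k * (Wh * s (int n)) - (e' * e') ^ n \<cdot> (z (k + 2 * int n) * (s (- int n) * Wh)) \<in> U"
    by (intro U.V Wh_chain) (use assms n in auto)
  moreover have "(e' * e') ^ n \<cdot> (z (k + 2 * int n) * (s (- int n) * Wh)) \<in> U"
    by (intro U.scale U.W) (use assms n in auto)
  ultimately show "z k * (Wh * s j) \<in> U"
    using subspace_add[OF subspace_U] n by fastforce
qed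

lemma unit_power: "e ^ n * (e' ^ n * r) = r" "e ^ n * e' ^ n = 1"
  by (simp_all flip: mult.assoc power_mult_distrib)

lemma Wh_s_in_U:
  assumes "- 6 \<le> k" "k \<le> 3"
  shows "z k * (Wh * s i) \<in> U"
proof -
  obtain k0 n where k: "k = k0 + 2 * int n" "k0 = - 6 \<or> k0 = - 5"
  proof
    have "(k + 6) div 2 \<ge> 0" "(k + 6) mod 2 = k mod 2" using assms by presburger+
    then show "k = (- 6 + k mod 2) + 2 * int (nat ((k + 6) div 2))"
      using div_mult_mod_eq[of "k + 6" 2] by simp
    show "- 6 + k mod 2 = - 6 \<or> - 6 + k mod 2 = - 5" by presburger
  qed
  \<comment> \<open>The chain read backwards: modulo \<open>V0\<close>, \<open>z k * Wh\<close> is a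
    unit multiple of \<open>s (int n) * (z k0 * (Wh * s (int n)))\<close> with k0 at the bottom,
    where every further power of s is already under control.\<close>
  have "(e * e) ^ n \<cdot> (s (int n) * ((z k0 * (Wh * s (int n)) - (e' * e') ^ n \<cdot> (z (k0 + 2 * int n) * (s (- int
      n) * Wh))) * s i)) \<in> U"
    by (intro U.V bimodD(4,10,11)[OF bimod_V] Wh_chain) (use assms k in auto)
  moreover have "(e * e) ^ n \<cdot> (s (int n) * (z k0 * (Wh * s (int n + i)))) \<in> U"
    by (intro U.scale U_left Wh_s_bottom_in_U k)
  ultimately have "(e * e) ^ n \<cdot> (s (int n) * (z k0 * (Wh * s (int n + i)))) -
     (e * e) ^ n \<cdot> (s (int n) * ((z k0 * (Wh * s (int n)) - (e' * e') ^ n \<cdot> (z (k0 + 2 * int n) * (s (- int n) *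
         Wh))) * s i)) \<in> U"
    by (intro subspace_diff[OF subspace_U])
  then show ?thesis
    by (simp add: k left_diff_distrib right_diff_distrib mult.assoc scale_right_diff_distrib power_mult_distrib
        unit_power)
qed

lemma bimod_U: "bimod U"
proof -
  have "x * s i \<in> U" if "x \<in> U" for x i
    using that
  proof induction
    case (W k j)
    then show ?case using U_left[OF Wh_s_in_U, of k j i] by (simp add: mult.assoc)
  qed (auto simp: distrib_right intro: U.intros bimodD(11)[OF bimod_V])
  then show ?thesis by (simp add: bimod_def subspace_U U_left)
qed

section \<open>The quintic relation on \<open>Wh\<close> and the ends of the windows\<close>

abbreviation "K \<equiv> e' * e'"

lemma Wh_s_powers:
  "Wh * s 2 = K ^ 2 \<cdot> (z 4 * (s (- 2) * Wh)) + K \<cdot> (z 2 * (s (- 1) * L)) + L * s 1"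
  "Wh * s 3 = K ^ 3 \<cdot> (z 6 * (s (- 3) * Wh)) + K ^ 2 \<cdot> (z 4 * (s (- 2) * L)) + K \<cdot> (z 2 * (s (- 1) * (L * s 1)))
     + L * s 2"
  "Wh * s 4 = K ^ 4 \<cdot> (z 8 * (s (- 4) * Wh)) + K ^ 3 \<cdot> (z 6 * (s (- 3) * L)) + K ^ 2 \<cdot> (z 4 * (s (- 2) * (L * s 1)))
     + K \<cdot> (z 2 * (s (- 1) * (L * s 2))) + L * s 3"
  "Wh * s 5 = K ^ 4 \<cdot> (z 8 * (s (- 4) * (Wh * s 1))) + K ^ 3 \<cdot> (z 6 * (s (- 3) * (L * s 1)))
     + K ^ 2 \<cdot> (z 4 * (s (- 2) * (L * s 2))) + K \<cdot> (z 2 * (s (- 1) * (L * s 3))) + L * s 4"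
proof -
  have step: "Wh * s (i + 1) = K \<cdot> (z 2 * (s (- 1) * (Wh * s i))) + L * s i" for i
    using arg_cong[OF Wh_s, of "\<lambda>x. x * s i"] by (simp add: distrib_right mult.assoc add.commute)
  show 2: "Wh * s 2 = K ^ 2 \<cdot> (z 4 * (s (- 2) * Wh)) + K \<cdot> (z 2 * (s (- 1) * L)) + L * s 1"
    using step[of 1] by (simp add: Wh_s power2_eq_square algebra_simps)
  show 3: "Wh * s 3 = K ^ 3 \<cdot> (z 6 * (s (- 3) * Wh)) + K ^ 2 \<cdot> (z 4 * (s (- 2) * L)) + K \<cdot> (z 2 * (s (- 1) * (L
      * s 1)))
     + L * s 2"
    using step[of 2] by (simp add: 2 power2_eq_square power3_eq_cube algebra_simps)
  show 4: "Wh * s 4 = K ^ 4 \<cdot> (z 8 * (s (- 4) * Wh)) + K ^ 3 \<cdot> (z 6 * (s (- 3) * L)) + K ^ 2 \<cdot> (z 4 * (s (- 2) *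
      (L * s 1)))
     + K \<cdot> (z 2 * (s (- 1) * (L * s 2))) + L * s 3"
    using step[of 3] by (simp add: 3 power2_eq_square power3_eq_cube power4_eq_xxxx algebra_simps)
  show "Wh * s 5 = K ^ 4 \<cdot> (z 8 * (s (- 4) * (Wh * s 1))) + K ^ 3 \<cdot> (z 6 * (s (- 3) * (L * s 1)))
     + K ^ 2 \<cdot> (z 4 * (s (- 2) * (L * s 2))) + K \<cdot> (z 2 * (s (- 1) * (L * s 3))) + L * s 4"
    using arg_cong[OF 4, of "\<lambda>x. x * s 1"] by (simp add: algebra_simps)
qed

text \<open>\<open>Wh * s 5\<close> computed in two ways, by iterating \<open>Wh_s\<close> and by
  the quintic. On the left the last factor \<open>Wh * s 1\<close> is kept unexpanded, so that the
  z-degree stays at 8 instead of reaching 10.\<close>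

lemma Wh_quintic:
  "K ^ 4 \<cdot> (z 8 * (s (- 4) * (Wh * s 1))) =
     e \<cdot> Wh + (d * K) \<cdot> (z 2 * (s (- 1) * Wh)) + (c * K ^ 2) \<cdot> (z 4 * (s (- 2) * Wh))
     + (b * K ^ 3) \<cdot> (z 6 * (s (- 3) * Wh)) + (a * K ^ 4) \<cdot> (z 8 * (s (- 4) * Wh))
     - e \<cdot> (L * s (- 1)) - K \<cdot> (z 2 * (s (- 1) * (L * s 3 - a \<cdot> (L * s 2) - b \<cdot> (L * s 1) - c \<cdot> L)))
     - K ^ 2 \<cdot> (z 4 * (s (- 2) * (L * s 2 - a \<cdot> (L * s 1) - b \<cdot> L)))
     - K ^ 3 \<cdot> (z 6 * (s (- 3) * (L * s 1 - a \<cdot> L)))"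
  using expand_up[of Wh 2 1] expand_up[of L 1 1]
  by (simp add: Wh_s_powers Wh_s algebra_simps)

text \<open>The same comparison for \<open>Wh * s 4\<close>, solved for the term with s^-1.\<close>

lemma Wh_quintic_down:
  "e \<cdot> (Wh * s (- 1)) =
     K ^ 4 \<cdot> (z 8 * (s (- 4) * Wh)) - (a * K ^ 3) \<cdot> (z 6 * (s (- 3) * Wh)) - (b * K ^ 2) \<cdot> (z 4 * (s (- 2) * Wh))
     - (c * K) \<cdot> (z 2 * (s (- 1) * Wh)) - d \<cdot> Wh
     + d \<cdot> (L * s (- 1)) + e \<cdot> (L * s (- 2)) + K \<cdot> (z 2 * (s (- 1) * (L * s 2 - a \<cdot> (L * s 1) - b \<cdot> L)))
     + K ^ 2 \<cdot> (z 4 * (s (- 2) * (L * s 1 - a \<cdot> L))) + K ^ 3 \<cdot> (z 6 * (s (- 3) * L))"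
  using expand_up[of Wh 1 1] expand_up[of L 0 1]
  by (simp add: Wh_s_powers Wh_s algebra_simps)

text \<open>\<open>Wh_quintic\<close> multiplied by \<open>z k0\<close> on the left and
  \<open>m\<close> on the right. The vector \<open>x\<close> allows for an error: in
  \<open>L3\<close> it may compensate a part of the remainder at \<open>k0 + 6\<close> that is not
  known to lie in S. It is 0 when \<open>m\<close> is t and nonzero when \<open>m\<close> is
  \<open>D 2\<close>.\<close>

lemma quintic_times:
  assumes S: "subspace S" and left: "\<And>i x. x \<in> S \<Longrightarrow> s i * x \<in> S"
    and W: "\<And>k. k0 \<le> k \<Longrightarrow> k \<le> k0 + 8 \<Longrightarrow> z k * (Wh * m) \<in> S"
    and L0: "z k0 * (L * (s (- 1) * m)) \<in> S"
    and L1: "\<And>i. 0 \<le> i \<Longrightarrow> i \<le> 3 \<Longrightarrow> z (k0 + 2) * (L * (s i * m)) \<in> S"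
    and L2: "\<And>i. 0 \<le> i \<Longrightarrow> i \<le> 2 \<Longrightarrow> z (k0 + 4) * (L * (s i * m)) \<in> S"
    and L3: "K ^ 4 \<cdot> (z (k0 + 8) * (s (- 4) * x)) + K ^ 3 \<cdot> (z (k0 + 6) * (s (- 3) * ((L * s 1 - a \<cdot> L) * m))) \<in> S"
  shows "K ^ 4 \<cdot> (z (k0 + 8) * (s (- 4) * (Wh * s 1 * m - x))) \<in> S"
proof -
  note mem = subspace_add[OF S] subspace_diff[OF S] subspace_scale[OF S]
  have l: "z k * u \<in> S \<Longrightarrow> z k * (s i * u) \<in> S" for i k u
    using left[of "z k * u" i] by simp
  have "z k0 * (K ^ 4 \<cdot> (z 8 * (s (- 4) * (Wh * s 1))) * m) =
     z k0 * ((e \<cdot> Wh + (d * K) \<cdot> (z 2 * (s (- 1) * Wh)) + (c * K ^ 2) \<cdot> (z 4 * (s (- 2) * Wh))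
     + (b * K ^ 3) \<cdot> (z 6 * (s (- 3) * Wh)) + (a * K ^ 4) \<cdot> (z 8 * (s (- 4) * Wh))
     - e \<cdot> (L * s (- 1)) - K \<cdot> (z 2 * (s (- 1) * (L * s 3 - a \<cdot> (L * s 2) - b \<cdot> (L * s 1) - c \<cdot> L)))
     - K ^ 2 \<cdot> (z 4 * (s (- 2) * (L * s 2 - a \<cdot> (L * s 1) - b \<cdot> L)))
     - K ^ 3 \<cdot> (z 6 * (s (- 3) * (L * s 1 - a \<cdot> L)))) * m)"
    by (simp only: Wh_quintic)
  then have "K ^ 4 \<cdot> (z (k0 + 8) * (s (- 4) * (Wh * s 1 * m - x))) =
     e \<cdot> (z k0 * (Wh * m)) + (d * K) \<cdot> (z (k0 + 2) * (s (- 1) * (Wh * m)))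
     + (c * K ^ 2) \<cdot> (z (k0 + 4) * (s (- 2) * (Wh * m)))
     + (b * K ^ 3) \<cdot> (z (k0 + 6) * (s (- 3) * (Wh * m))) + (a * K ^ 4) \<cdot> (z (k0 + 8) * (s (- 4) * (Wh * m)))
     - e \<cdot> (z k0 * (L * (s (- 1) * m)))
     - K \<cdot> (z (k0 + 2) * (s (- 1) * (L * (s 3 * m)))) + (K * a) \<cdot> (z (k0 + 2) * (s (- 1) * (L * (s 2 * m))))
     + (K * b) \<cdot> (z (k0 + 2) * (s (- 1) * (L * (s 1 * m)))) + (K * c) \<cdot> (z (k0 + 2) * (s (- 1) * (L * (s 0 * m))))
     - K ^ 2 \<cdot> (z (k0 + 4) * (s (- 2) * (L * (s 2 * m)))) + (K ^ 2 * a) \<cdot> (z (k0 + 4) * (s (- 2) * (L * (s 1 * m))))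
     + (K ^ 2 * b) \<cdot> (z (k0 + 4) * (s (- 2) * (L * (s 0 * m))))
     - (K ^ 4 \<cdot> (z (k0 + 8) * (s (- 4) * x)) + K ^ 3 \<cdot> (z (k0 + 6) * (s (- 3) * ((L * s 1 - a \<cdot> L) * m))))"
    by (simp add: algebra_simps)
  also have "\<dots> \<in> S"
    by (intro mem l W L0 L1 L2 L3) auto
  finally show ?thesis .
qed

text \<open>Multiplication by t raises the z-degree of \<open>Wh\<close> by at least one, so k may
  start at -7, one below the window of \<open>Wh\<close> itself. This is what permits
  \<open>k0 = - 7\<close> in \<open>quintic_times\<close>.\<close>

lemma Wh_t_in_U:
  assumes "- 7 \<le> k" "k \<le> 2"
  shows "z k * (Wh * t) \<in> U"
proof -
  have "z (k + 1) * (t * (s 2 * (t * s (- 2)))) - a \<cdot> (z (k + 2) * (s (- 1) * (t * s (- 3))))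
    + (d * e') \<cdot> (z (k + 1) * (t * (s 2 * (t * s (- 1))))) \<in> V0"
    using V.C[of _ "k+1" _ 0 "-2"] V.C[of _ "k+1" _ 0 "-1"] assms
    by (intro bimodD(2-4)[OF bimod_V] V.B) auto
  then show ?thesis
    by (simp add: Wh_t distrib_left right_diff_distrib U.V)
qed

text \<open>Computed term by term, because the windows have to be sharp: for k = -7 they sit exactly
  at the lower ends of \<open>V0\<close>.\<close>

lemma L_sm1_t_in_V: "z k * (L * (s (- 1) * t)) \<in> V (k + 3) (k + 3) (k + 2) (k + 3) (k + 1) (k + 1)"
  using V.C[of _ "k+1" _ 1 0] V.C[of _ "k+1" _ 0 0] V.C[of _ "k+1" _ 0 2] V.C[of _ "k+1" _ 0 1]
  unfolding L_def D_def
  by (auto simp: algebra_simps intro!: bimodD(1-5)[OF bimod_V] V.A V.B[of _ _ _ 0, simplified] V.B)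

lemma X_s2_t: "t * (s 2 * (t * (s 2 * t))) = z 2 * (s (- 1) * (D (- 3) * s (- 1)))"
  by (simp add: D_def mult.assoc)

lemma W_in_U:
  assumes "- 6 \<le> k" "k \<le> 3" "z k * D 3 \<in> U" "z (k + 1) * D (- 3) \<in> U"
  shows "z k * W \<in> U"
proof -
  have "z k * W = z k * Wh + a \<cdot> (z (k + 1) * (s (- 1) * D (- 3))) - (d * e') \<cdot> (z k * (D 3 * s 1))"
    by (simp add: Wh_def algebra_simps)
  also have "\<dots> \<in> U"
    using U.W[OF assms(1,2), of 0] assms(3,4) by (intro bimodD(2-4,6,7)[OF bimod_U]) auto
  finally show ?thesis .
qed

text \<open>The two boundary facts are hypotheses so that the lemma can be used before they hold in
  the full range: first with c0 = -5 and c1 = 1, where \<open>D_in_V\<close> supplies both, then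
  with wider windows as \<open>Dm3_top\<close> and \<open>D3_bottom\<close> become
  available.\<close>

lemma V_t_in_U:
  assumes x: "x \<in> V (- 4) 4 (- 5) 3 c0 c1" and c: "- 6 \<le> c0" "c1 \<le> 2"
    and D3: "z c0 * D 3 \<in> U" and Dm3: "z (c1 + 2) * D (- 3) \<in> U"
  shows "x * t \<in> U"
  using x
proof (rule V_mult[OF _ subspace_U U_left])
  fix k :: int assume k: "- 4 \<le> k" "k \<le> 4"
  then show "z k * t \<in> U" by (intro V_U[OF V_gens(2)]) auto
next
  fix k j :: int assume k: "- 5 \<le> k" "k \<le> 3" and j: "- 2 \<le> j" "j \<le> 2"
  consider "j = - 2" | "j = - 1" | "j = 0" | "j = 1" | "j = 2" using j by linarith
  then show "z k * (t * (s j * t)) \<in> U"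
    using k V.A[of _ "k + 1" _ 0] V.B[of _ k _ 1 1] V.B[of _ "k + 1" _ "- 1" "- 1"] V.C[of _ k _ 0 0]
      V.C[of _ "k - 1" _ 1 1]
    by cases (auto intro!: U.V)
next
  fix k j :: int assume k: "c0 \<le> k" "k \<le> c1" and j: "- 2 \<le> j" "j \<le> 2"
  have d3: "z k * D 3 \<in> U"
    using k c D3 by (cases "k = c0") (auto intro!: V_U[OF D_in_V(1)[of "-4" _ 5 "-5" 4 "-6" 3]])
  have dm3: "z (k + 2) * D (- 3) \<in> U"
    using k c Dm3 by (cases "k = c1") (auto intro!: V_U[OF D_in_V(2)[of "-4" _ 5 "-5" 4 "-6" 3]])
  have dm3': "z (k + 1) * D (- 3) \<in> U"
    using k c by (auto intro!: V_U[OF D_in_V(2)[of "-4" _ 5 "-5" 4 "-6" 3]])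
  consider "j = - 2" | "j = - 1" | "j = 0" | "j = 1" | "j = 2" using j by linarith
  then show "z k * (t * (s 2 * (t * (s j * t)))) \<in> U"
  proof cases
    case 1
    then show ?thesis using W_in_U[OF _ _ d3 dm3'] k c by (simp add: W_def)
  next
    case 2
    then show ?thesis using bimodD(7)[OF bimod_U d3, of 1] by (simp add: D_def mult.assoc)
  next
    case 5
    then show ?thesis using bimodD(8)[OF bimod_U dm3, of "- 1" "- 1"] by (simp add: X_s2_t)
  qed (use k c V.B[of _ "k + 1" _ 0 2] V.B[of _ "k + 2" _ "-1" "-2"] in \<open>auto intro!: U.V\<close>)
qed

lemma L_s_t_in_U:
  assumes "- 5 \<le> k" "k \<le> - 1"
  shows "z k * (L * (s i * t)) \<in> U"
proof -
  have "z k * (L * s i) * t \<in> U"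
    by (rule V_t_in_U[of _ "- 5" 1])
      (use assms in \<open>auto intro!: V_mono[OF bimodD(7)[OF bimod_V L_in_V]] V_U[OF D_in_V(1)[of "-4" _ 5 "-5" 4
          "-6" 3]] V_U[OF D_in_V(2)[of "-4" _ 5 "-5" 4 "-6" 3]]\<close>)
  then show ?thesis by (simp add: mult.assoc)
qed

lemma cancel_left:
  assumes "bimod S" "(e' ^ n) \<cdot> (z k * (s i * x)) \<in> S"
  shows "z k * x \<in> S"
proof -
  have "e ^ n \<cdot> (s (- i) * (e' ^ n \<cdot> (z k * (s i * x)))) \<in> S"
    by (rule bimodD(4)[OF assms(1) bimodD(10)[OF assms]])
  then show ?thesis by (simp add: unit_power)
qed

lemma K_power: "K ^ n = e' ^ (2 * n)"
  by (simp add: power_mult power2_eq_square)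

lemma Wh_s_t_top_in_U: "z 1 * (Wh * s 1 * t) \<in> U"
proof -
  have "K ^ 4 \<cdot> (z (- 7 + 8) * (s (- 4) * (Wh * s 1 * t - 0))) \<in> U"
  proof (rule quintic_times[OF subspace_U U_left])
    show "z (- 7) * (L * (s (- 1) * t)) \<in> U"
      by (rule V_U[OF L_sm1_t_in_V]) auto
    have "z (- 1) * (L * (s 1 * t)) - a \<cdot> (z (- 1) * (L * (s 0 * t))) \<in> U"
      by (intro bimodD(3,4)[OF bimod_U] L_s_t_in_U) auto
    then have "K ^ 3 \<cdot> (s (- 3) * (z (- 1) * (L * (s 1 * t)) - a \<cdot> (z (- 1) * (L * (s 0 * t))))) \<in> U"
      by (intro bimodD(4,10)[OF bimod_U])
    then show "K ^ 4 \<cdot> (z (- 7 + 8) * (s (- 4) * 0)) + K ^ 3 \<cdot> (z (- 7 + 6) * (s (- 3) * ((L * s 1 - a \<cdot> L) *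
        t))) \<in> U"
      by (simp add: right_diff_distrib left_diff_distrib mult.assoc)
  qed (use Wh_t_in_U L_s_t_in_U in auto)
  then show ?thesis
    using cancel_left[OF bimod_U] by (simp add: K_power)
qed

text \<open>\<open>Wh_s_t\<close> multiplied by z has the leading term
  \<open>e' z^4 s^-1 D(-3) s^-2\<close>. All other terms are known to be in \<open>U\<close>, and
  the outer factors are invertible.\<close>

lemma Dm3_top: "z 4 * D (- 3) \<in> U"
proof -
  have 4: "z 3 * (s (- 1) * (D (- 4) * s (- 1))) \<in> U"
    by (intro bimodD(8)[OF bimod_U] V_U[OF D_in_V(4)[of "-4" _ 5 "-5" 4 "-6" 3]]) auto
  have "z 1 * (Wh * s 1 * t) + ((a * e') \<cdot> (z 4 * (s (- 1) * (t * s (- 3))))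
   + (b * e') \<cdot> (z 3 * (s 0 * (t * s 1))) + (c * e') \<cdot> (z 2 * D 3)) + a \<cdot> (z 3 * (s (- 1) * (D (- 4) * s (- 1)))) \<in> U"
    by (intro bimodD(2,4)[OF bimod_U] Wh_s_t_top_in_U 4 U.V V.B D_in_V) auto
  then have "e' ^ 1 \<cdot> (z 4 * (s (- 1) * (D (- 3) * s (- 2)))) \<in> U"
    by (simp add: Wh_s_t[unfolded mult.assoc] algebra_simps)
  then have "z 4 * (D (- 3) * s (- 2)) \<in> U"
    by (rule cancel_left[OF bimod_U])
  from bimodD(11)[OF bimod_U this, of 2] show ?thesis
    by (simp add: mult.assoc)
qed

lemma L_s_t_in_U':
  assumes "- 6 \<le> k" "k \<le> 0" "z k * D 3 \<in> U"
  shows "z k * (L * (s i * t)) \<in> U"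
proof -
  have "z k * (L * s i) * t \<in> U"
    by (rule V_t_in_U[of _ k 2])
      (use assms Dm3_top in \<open>auto intro!: V_mono[OF bimodD(7)[OF bimod_V L_in_V]]\<close>)
  then show ?thesis by (simp add: mult.assoc)
qed

lemmas D_in_U = D_in_V[of "-4" _ 5 "-5" 4 "-6" 3, THEN U.V]
lemma V_gens_in_U:
  "- 4 \<le> k \<Longrightarrow> k \<le> 5 \<Longrightarrow> z k \<in> U" "- 5 \<le> k \<Longrightarrow> k \<le> 4 \<Longrightarrow> z k * t \<in> U"
  "- 6 \<le> k \<Longrightarrow> k \<le> 3 \<Longrightarrow> z k * D 2 \<in> U"
  by (auto intro: U.V V_gens)
lemmas V_A_U = V.A[of "-4" _ 5 _ "-5" 4 "-6" 3, THEN U.V]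
lemmas V_B_U = V.B[of "-5" _ 4 _ _ "-4" 5 "-6" 3, THEN U.V]
lemmas V_C_U = V.C[of "-6" _ 3 _ _ "-4" 5 "-5" 4, THEN U.V]
lemmas memU = bimodD(2-8)[OF bimod_U]

text \<open>By \<open>Wh_sm1_t\<close> it suffices to place \<open>z^-6 Wh s^-1 t\<close> in
  \<open>U\<close>, and \<open>Wh_quintic_down\<close> does this. The delicate remainder is
  \<open>z^-6 L s^-2 t\<close>; its worst term is \<open>bot\<close>, which a further use of the
  quintic reduces to \<open>W\<close>.\<close>

lemma D3_bottom: "z (- 6) * D 3 \<in> U"
proof -
  have "z (- 4) * (D (- 3) * (s (- 2) * t)) =
      e' \<cdot> (z (- 4) * W - a \<cdot> (z (- 3) * (s (- 1) * D (- 3))) - b \<cdot> (z (- 3) * (s (- 2) * t))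
      - c \<cdot> (z (- 4) * (s 2 * (t * s 1))) - d \<cdot> (z (- 5) * (s 1 * (D 3 * s 1))))"
    using arg_cong[OF D_down[of "-1"], of "\<lambda>x. z (- 4) * x * (s (- 2) * t)"]
    by (simp add: D_def W_def algebra_simps)
  also have "\<dots> \<in> U"
    by (intro memU W_in_U D_in_U V_B_U V_gens_in_U) auto
  finally have bot: "z (- 4) * (D (- 3) * (s (- 2) * t)) \<in> U" .
  have "z (- 6) * (L * (s (- 2) * t)) =
     - (K \<cdot> (b \<cdot> (z (- 4) * (s (- 2) * (D 2 * s 1))) + c \<cdot> (z (- 4) * (s 2 * (t * s 1))) + d \<cdot> (z (- 5) * (D 4 *
         s 1))))
     - e' \<cdot> (a \<cdot> (z (- 4) * (s (- 1) * (D (- 3) * (s (- 2) * t)))) + b \<cdot> (z (- 4) * (s (- 1) * D (- 3)))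
             + c \<cdot> (z (- 4) * (s (- 1) * (t * s (- 1)))))
     - a \<cdot> (z (- 6) * (D 2 * s 2)) - (d * e' * e' * e') \<cdot> (z (- 4) * (s (- 1) * (D 4 * s 1)))"
    by (simp add: L_def D_def algebra_simps)
  also have "\<dots> \<in> U"
    by (intro memU bot D_in_U V_gens_in_U V_B_U) auto
  finally have L2: "z (- 6) * (L * (s (- 2) * t)) \<in> U" .
  have L1: "z (- 6) * (L * (s (- 1) * t)) \<in> U"
    by (rule V_U[OF L_sm1_t_in_V]) auto
  have L0: "z 0 * (L * (s i * t)) \<in> U" for i
    by (intro L_s_t_in_U' D_in_U) auto
  have "z (- 6) * ((e \<cdot> (Wh * s (- 1))) * t) =
     K ^ 4 \<cdot> (z 2 * (s (- 4) * (Wh * t))) - (a * K ^ 3) \<cdot> (z 0 * (s (- 3) * (Wh * t)))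
     - (b * K ^ 2) \<cdot> (z (- 2) * (s (- 2) * (Wh * t))) - (c * K) \<cdot> (z (- 4) * (s (- 1) * (Wh * t)))
     - d \<cdot> (z (- 6) * (Wh * t)) + d \<cdot> (z (- 6) * (L * (s (- 1) * t))) + e \<cdot> (z (- 6) * (L * (s (- 2) * t)))
     + K \<cdot> (z (- 4) * (s (- 1) * (L * (s 2 * t)))) - (K * a) \<cdot> (z (- 4) * (s (- 1) * (L * (s 1 * t))))
     - (K * b) \<cdot> (z (- 4) * (s (- 1) * (L * (s 0 * t))))
     + K ^ 2 \<cdot> (z (- 2) * (s (- 2) * (L * (s 1 * t)))) - (K ^ 2 * a) \<cdot> (z (- 2) * (s (- 2) * (L * (s 0 * t))))
     + K ^ 3 \<cdot> (z 0 * (s (- 3) * (L * (s 0 * t))))"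
    unfolding Wh_quintic_down by (simp add: algebra_simps)
  also have "\<dots> \<in> U"
    by (intro memU Wh_t_in_U L0 L1 L2 L_s_t_in_U) auto
  finally have "e' \<cdot> (z (- 6) * ((e \<cdot> (Wh * s (- 1))) * t)) + a \<cdot> (z (- 6) * (D 2 * s 2)) - (d * e') \<cdot> (z (- 5)
      * (s 0 * (t * s 3))) \<in> U"
    by (intro memU V_B_U V_gens_in_U) auto
  then have "z (- 6) * (D 3 * s 2) \<in> U"
    by (simp add: Wh_sm1_t[unfolded mult.assoc] mult.assoc algebra_simps)
  then have "z (- 6) * (D 3 * s 2) * s (- 2) \<in> U"
    by (rule bimodD(11)[OF bimod_U])
  then show ?thesis by (simp add: mult.assoc)
qed

lemma D3_in_U: "- 6 \<le> k \<Longrightarrow> k \<le> 3 \<Longrightarrow> z k * D 3 \<in> U"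
  using D3_bottom by (cases "k = - 6") (auto intro!: D_in_U)

lemma Dm3_in_U: "- 5 \<le> k \<Longrightarrow> k \<le> 4 \<Longrightarrow> z k * D (- 3) \<in> U"
  using Dm3_top by (cases "k = 4") (auto intro!: D_in_U)

lemma V_t_in_U':
  assumes "x \<in> V (- 4) 4 (- 5) 3 (- 6) 2"
  shows "x * t \<in> U"
  using assms by (rule V_t_in_U) (auto intro!: D3_in_U Dm3_in_U)

lemma L_s_t_in_U'': "- 6 \<le> k \<Longrightarrow> k \<le> 0 \<Longrightarrow> z k * (L * (s i * t)) \<in> U"
  by (intro L_s_t_in_U' D3_in_U) auto

text \<open>At k = 2 the quintic is used with k0 = -6, which relies on both boundary facts through
  \<open>L_s_t_in_U''\<close>; k = 1 was done before, and below that \<open>Wh_s\<close> is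
  enough.\<close>

lemma Wh_s_t_in_U:
  assumes "- 6 \<le> k" "k \<le> 2"
  shows "z k * (Wh * s 1 * t) \<in> U"
proof (cases "k = 2")
  case True
  have "K ^ 4 \<cdot> (z (- 6 + 8) * (s (- 4) * (Wh * s 1 * t - 0))) \<in> U"
  proof (rule quintic_times[OF subspace_U U_left])
    show "z (- 6) * (L * (s (- 1) * t)) \<in> U"
      by (rule V_U[OF L_sm1_t_in_V]) auto
    have "K ^ 3 \<cdot> (s (- 3) * (z 0 * (L * (s 1 * t)) - a \<cdot> (z 0 * (L * (s 0 * t))))) \<in> U"
      by (intro bimodD(3,4,10)[OF bimod_U] L_s_t_in_U'') auto
    then show "K ^ 4 \<cdot> (z (- 6 + 8) * (s (- 4) * 0)) + K ^ 3 \<cdot> (z (- 6 + 6) * (s (- 3) * ((L * s 1 - a \<cdot> L) *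
        t))) \<in> U"
      by (simp add: right_diff_distrib left_diff_distrib mult.assoc)
  qed (use Wh_t_in_U L_s_t_in_U'' in auto)
  then show ?thesis
    using cancel_left[OF bimod_U] by (simp add: K_power True)
next
  case False
  have "z k * (Wh * s 1 * t) = z k * (K \<cdot> (z 2 * (s (- 1) * Wh)) + L) * t"
    by (simp add: Wh_s mult.assoc)
  also have "\<dots> = K \<cdot> (z (k + 2) * (s (- 1) * (Wh * t))) + z k * (L * (s 0 * t))"
    by (simp add: algebra_simps)
  also have "\<dots> \<in> U"
  proof (cases "k = 1")
    case True
    then show ?thesis
      using Wh_s_t_top_in_U Wh_s
      by (simp add: Wh_s algebra_simps)
  qed (use False assms L_s_t_in_U''[of k 0] in \<open>auto intro!: memU Wh_t_in_U\<close>)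
  finally show ?thesis .
qed

section \<open>Multiplication by \<open>D 2\<close> and the element \<open>z 5 * t\<close>\<close>

lemma V_s2_t_in_U:
  assumes "x \<in> V (- 4) 4 (- 5) 3 (- 6) 2"
  shows "x * (s 2 * t) \<in> U"
  using V_t_in_U'[OF bimodD(11)[OF bimod_V assms, of 2]] by (simp add: mult.assoc)

lemma Wh_s2_t_in_U:
  assumes "- 6 \<le> k" "k \<le> 0"
  shows "z k * (Wh * (s 2 * t)) \<in> U"
proof -
  have "(Wh * s 1) * (s 1 * t) = (K \<cdot> (z 2 * (s (- 1) * Wh)) + L) * (s 1 * t)"
    by (simp only: Wh_s)
  then have "Wh * (s 2 * t) = K \<cdot> (z 2 * (s (- 1) * (Wh * (s 1 * t)))) + L * (s 1 * t)"
    by (simp add: distrib_right mult.assoc)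
  then have "z k * (Wh * (s 2 * t)) = K \<cdot> (z (k + 2) * (s (- 1) * (Wh * s 1 * t))) + z k * (L * (s 1 * t))"
    by (simp add: distrib_left mult.assoc)
  also have "\<dots> \<in> U"
    using assms by (intro memU Wh_s_t_in_U L_s_t_in_U'') auto
  finally show ?thesis .
qed

lemma W_s2_t_in_U:
  assumes "- 5 \<le> k" "k \<le> - 1"
  shows "z k * (W * (s 2 * t)) \<in> U"
proof -
  have "(a \<cdot> (z (k + 1) * (s (- 1) * D (- 3))) - (d * e') \<cdot> (z k * (D 3 * s 1))) * (s 2 * t) \<in> U"
    by (intro V_s2_t_in_U bimodD(3,4,6,7)[OF bimod_V] D_in_V) (use assms in auto)
  moreover have "z k * (Wh * (s 2 * t)) \<in> U"
    using assms by (intro Wh_s2_t_in_U) auto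
  ultimately have "z k * (Wh * (s 2 * t)) + (a \<cdot> (z (k + 1) * (s (- 1) * D (- 3))) - (d * e') \<cdot> (z k * (D 3 * s
      1))) * (s 2 * t) \<in> U"
    by (intro memU)
  then show ?thesis by (simp add: Wh_def algebra_simps)
qed

text \<open>\<open>D 2\<close> is split as t followed by \<open>s 2 * t\<close>. The first factor
  leads into the windows of \<open>V_s2_t_in_U\<close>, except that j = -2 in the third family
  produces \<open>W\<close>, which has its own lemma.\<close>

lemma V_X_in_U:
  assumes "x \<in> V (- 3) 0 (- 4) 0 (- 5) (- 1)"
  shows "x * D 2 \<in> U"
proof -
  have S: "subspace {u. u * (s 2 * t) \<in> U}"
    by (auto simp: subspace_def distrib_right intro: U.add U.scale subspace_0[OF subspace_U])
  have "x * t \<in> {u. u * (s 2 * t) \<in> U}"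
    using assms
  proof (rule V_mult[OF _ S])
    show "s i * u \<in> {u. u * (s 2 * t) \<in> U}" if "u \<in> {u. u * (s 2 * t) \<in> U}" for i u
      using that U_left[of "u * (s 2 * t)" i] by (simp add: mult.assoc)
  next
    fix k :: int assume k: "- 3 \<le> k" "k \<le> 0"
    then show "z k * t \<in> {u. u * (s 2 * t) \<in> U}"
      using V_s2_t_in_U[OF V_gens(2), of k] by (simp add: mult.assoc)
  next
    fix k j :: int assume k: "- 4 \<le> k" "k \<le> 0" and j: "- 2 \<le> j" "j \<le> 2"
    consider "j = - 2" | "j = - 1" | "j = 0" | "j = 1" | "j = 2" using j by linarith
    then have "z k * (t * (s j * t)) \<in> V (- 4) 4 (- 5) 3 (- 6) 2"
      using k V.A[of _ "k + 1" _ 0] V.B[of _ k _ 1 1] V.B[of _ "k + 1" _ "- 1" "- 1"] V.C[of _ k _ 0 0]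
        V.C[of _ "k - 1" _ 1 1]
      by cases auto
    then show "z k * (t * (s j * t)) \<in> {u. u * (s 2 * t) \<in> U}"
      using V_s2_t_in_U by blast
  next
    fix k j :: int assume k: "- 5 \<le> k" "k \<le> - 1" and j: "- 2 \<le> j" "j \<le> 2"
    show "z k * (t * (s 2 * (t * (s j * t)))) \<in> {u. u * (s 2 * t) \<in> U}"
    proof (cases "j = - 2")
      case True
      then show ?thesis using W_s2_t_in_U[OF k] by (simp add: W_def mult.assoc)
    next
      case False
      have dm3: "z (k + 2) * D (- 3) \<in> V (- 4) 4 (- 5) 3 (- 6) 2" and d3: "z k * D 3 \<in> V (- 4) 4 (- 5) 3 (- 6) 2"
        using k by (auto intro!: D_in_V)
      consider "j = - 1" | "j = 0" | "j = 1" | "j = 2" using j False by linarith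
      then have "z k * (t * (s 2 * (t * (s j * t)))) \<in> V (- 4) 4 (- 5) 3 (- 6) 2"
      proof cases
        case 1
        then show ?thesis using bimodD(7)[OF bimod_V d3, of 1] by (simp add: D_def mult.assoc)
      next
        case 4
        then show ?thesis using bimodD(8)[OF bimod_V dm3, of "- 1" "- 1"] by (simp add: X_s2_t)
      qed (use k V.B[of _ "k + 1" _ 0 2] V.B[of _ "k + 2" _ "-1" "-2"] in auto)
      then show ?thesis using V_s2_t_in_U by blast
    qed
  qed
  then show ?thesis by (simp add: D_def mult.assoc)
qed

lemma L_s_X_in_U:
  assumes "- 5 \<le> k" "k \<le> - 3"
  shows "z k * (L * (s i * D 2)) \<in> U"
proof -
  have "z k * (L * s i) * D 2 \<in> U"
    by (rule V_X_in_U[OF V_mono[OF bimodD(7)[OF bimod_V L_in_V]]]) (use assms in auto)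
  then show ?thesis by (simp add: mult.assoc)
qed

lemma Dm3_s2_t:
  "D (- 3) * (s 2 * t) =
     e' \<cdot> (z 2 * (s (- 1) * (D (- 3) * s (- 1))) - a \<cdot> (z 2 * (s (- 2) * (t * s (- 1)))) - b \<cdot> (z 1 * (s 2 * t))
         - c \<cdot> (s 1 * D 3)
       - d \<cdot> (z (- 1) * (s 1 * (a \<cdot> (z 2 * (s (- 1) * (D (- 3) * s (- 1)))) + b \<cdot> (z 2 * (s (- 1) * (t * s (- 2))))
           + c \<cdot> (z 1 * (t * s 2)) + d \<cdot> (D 3 * s 1) + e \<cdot> W))))"
  using arg_cong[OF D_down[of "-1"], of "\<lambda>x. x * (s 2 * t)"] expand_up[of "D 2" 0 t]
  by (simp add: D_def W_def mult.assoc algebra_simps)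

lemma V_s2_t_mem:
  assumes "z k * x \<in> V (- 4) 4 (- 5) 3 (- 6) 2"
  shows "z k * (x * (s 2 * t)) \<in> U"
  using V_s2_t_in_U[OF assms] by (simp add: mult.assoc)

lemma L_X_in_U: "z (- 1) * (L * D 2) \<in> U"
proof -
  have "z (- 1) * (L * t) =
     - (K \<cdot> (b \<cdot> (z 3 * s (- 3)) + c \<cdot> (z 2 * (s 0 * (t * s (- 1)))) + d \<cdot> (z 1 * (D 2 * s (- 1)))))
     - e' \<cdot> (a \<cdot> (z 2 * (s (- 1) * (t * s (- 3)))) + b \<cdot> (z 1 * (s 0 * (t * s 1))) + c \<cdot> (z 0 * D 3))
     - a \<cdot> (z 1 * (s (- 1) * (D (- 4) * s (- 1)))) - (d * e' * e' * e') \<cdot> (z 2 * (s (- 1) * (D 2 * s (- 1))))"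
    by (simp add: L_def D_def algebra_simps)
  also have "\<dots> \<in> V (- 4) 4 (- 5) 3 (- 6) 2"
    by (intro bimodD(2-8)[OF bimod_V] D_in_V V.A V.B V_gens) auto
  finally show ?thesis
    using V_s2_t_mem[of "- 1" "L * t"] by (simp add: D_def mult.assoc)
qed

text \<open>The only term outside \<open>U\<close> in \<open>z\<^sup>-\<^sup>1 L s D\<^sub>2\<close>; it cancels in the proof that \<open>z\<^sup>5 t \<in> U\<close>.\<close>

lemma L_s_X_in_U': "z (- 1) * (L * (s 1 * D 2)) + (a * d * e' ^ 3) \<cdot> (z 4 * (s (- 2) * (D (- 4) * s (- 1)))) \<in> U"
proof -
  have DV: "z 2 * (s (- 1) * (D (- 3) * s 1)) \<in> V (- 4) 4 (- 5) 3 (- 6) 2" "z 2 * D 3 \<in> V (- 4) 4 (- 5) 3 (- 6) 2"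
      "z 1 * D 3 \<in> V (- 4) 4 (- 5) 3 (- 6) 2" "z 2 * (s (- 1) * (D (- 4) * s (- 1))) \<in> V (- 4) 4 (- 5) 3 (- 6) 2"
    by (intro bimodD(6-8)[OF bimod_V] D_in_V; simp)+
  have W1: "z 1 * (W * (s 1 * t)) \<in> U"
  proof -
    have "z 1 * (W * (s 1 * t)) = z 1 * (Wh * s 1 * t) + a \<cdot> ((z 2 * (s (- 1) * (D (- 3) * s 1))) * t) - (d *
        e') \<cdot> (z 1 * (D 3 * (s 2 * t)))"
      by (simp add: Wh_def algebra_simps)
    also have "\<dots> \<in> U"
      by (intro memU Wh_s_t_in_U V_t_in_U' V_s2_t_mem DV) auto
    finally show ?thesis .
  qed
  have W2: "z 2 * (W * (s 1 * t)) - a \<cdot> (z 4 * (s (- 1) * (D (- 4) * s (- 1)))) \<in> U"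
  proof -
    have "z 2 * (W * (s 1 * t)) - a \<cdot> (z 4 * (s (- 1) * (D (- 4) * s (- 1)))) =
       z 2 * (Wh * s 1 * t) - (d * e') \<cdot> (z 2 * (D 3 * (s 2 * t)))"
      by (simp add: Wh_def D_def algebra_simps)
    also have "\<dots> \<in> U"
      by (intro memU Wh_s_t_in_U V_s2_t_mem DV) auto
    finally show ?thesis .
  qed
  have Dm3: "z 0 * (D (- 3) * (s 2 * t) * (s 2 * t)) \<in> U"
  proof -
    \<comment> \<open>These are the terms of \<open>Dm3_s2_t\<close> that lie in the windowed
      submodule; its \<open>W\<close> term is split off and treated by
      \<open>W_s2_t_in_U\<close>.\<close>
    define y where "y = e' \<cdot> (z 2 * (s (- 1) * (D (- 3) * s (- 1))) - a \<cdot> (z 2 * (s (- 2) * (t * s (- 1))))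
       - b \<cdot> (z 1 * (s 2 * (t * s 0))) - c \<cdot> (z 0 * (s 1 * D 3))
       - d \<cdot> (a \<cdot> (z 1 * (s 0 * (D (- 3) * s (- 1)))) + b \<cdot> (z 1 * (s 0 * (t * s (- 2))))
           + c \<cdot> (z 0 * (s 1 * (t * s 2))) + d \<cdot> (z (- 1) * (s 1 * (D 3 * s 1)))))"
    have "y \<in> V (- 4) 4 (- 5) 3 (- 6) 2"
      unfolding y_def by (intro bimodD(2-4,6-8)[OF bimod_V] D_in_V V.B) auto
    then have "y * (s 2 * t) - d \<cdot> (s 1 * (z (- 1) * (W * (s 2 * t)))) \<in> U"
      by (intro bimodD(3,4,10)[OF bimod_U] W_s2_t_in_U V_s2_t_in_U) auto
    also have "y * (s 2 * t) - d \<cdot> (s 1 * (z (- 1) * (W * (s 2 * t)))) = z 0 * (D (- 3) * (s 2 * t) * (s 2 * t))"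
      by (simp add: Dm3_s2_t y_def mult.assoc algebra_simps)
    finally show ?thesis .
  qed
  have "z (- 1) * (L * (s 1 * D 2)) + (a * d * e' ^ 3) \<cdot> (z 4 * (s (- 2) * (D (- 4) * s (- 1)))) =
     - (K \<cdot> (b \<cdot> (z 3 * (s (- 4) * (D 1 * s 0))) + c \<cdot> (z 1 * (s 1 * (D 2 * (s 2 * t)))) + d \<cdot> (z 1 * (W * (s 1
         * t)))))
     - e' \<cdot> (a \<cdot> (z 2 * (s (- 1) * (D (- 4) * s (- 1))) * (s 2 * t)) + b \<cdot> (z 2 * (s (- 1) * (s 2 * t))) + c \<cdot>
         (z 0 * (D 4 * (s 2 * t))))
     - a \<cdot> (s (- 1) * (z 0 * (D (- 3) * (s 2 * t) * (s 2 * t))))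
     - (d * e' ^ 3) \<cdot> (s (- 1) * (z 2 * (W * (s 1 * t)) - a \<cdot> (z 4 * (s (- 1) * (D (- 4) * s (- 1))))))"
    by (simp add: L_def D_def W_def mult.assoc power3_eq_cube algebra_simps)
  also have "\<dots> \<in> U"
    by (intro bimodD(2-5,10)[OF bimod_U] W1 W2 Dm3 V_s2_t_in_U DV bimodD(6)[OF bimod_U] bimodD(8)[OF bimod_U]
        V_s2_t_mem D_in_V
         D_small_in[OF bimod_U] V_gens_in_U V_gens) auto
  finally show ?thesis .
qed

text \<open>With \<open>D 2\<close> as right factor, \<open>Wh_s_t\<close> collapses: the leading
  term of \<open>z 1 * (Wh * s 1 * D 2)\<close> is \<open>e' z^5 s^-1 t s^-3\<close>, so the quintic
  on \<open>Wh\<close> yields the missing element.\<close>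

lemma t_top: "z 5 * t \<in> U"
proof -
  \<comment> \<open>\<open>Wh * s 1 * D 2\<close> contains \<open>- a z^3 s^-1 D(-5) s^-1\<close>,
    and \<open>x\<close> is the part of it that comes from the \<open>D (- 4)\<close> term in the
    expansion of \<open>D (- 5)\<close>. Placing \<open>z 4 * D (- 4)\<close> in \<open>U\<close> by
    \<open>Dm4_in\<close> would already require \<open>z 5 * t\<close>; the same term occurs in
    \<open>L_s_X_in_U'\<close>, so subtracting \<open>x\<close> removes it on both sides.\<close>
  define x where "x = (a * d * e') \<cdot> (z 3 * (s (- 1) * (D (- 4) * s (- 1))))"
  have "K ^ 4 \<cdot> (z (- 7 + 8) * (s (- 4) * (Wh * s 1 * D 2 - x))) \<in> U"
  proof (rule quintic_times[OF subspace_U U_left])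
    fix k :: int assume k: "- 7 \<le> k" "k \<le> - 7 + 8"
    have "z k * (Wh * D 2) = z (k + 2) * (s 0 * (t * s 2)) - a \<cdot> (z (k + 2) * (s 0 * (t * s 1))) + (d * e') \<cdot> (z
        (k + 3) * (s (- 1) * (t * s (- 2))))"
      using arg_cong[OF Wh_t, of "\<lambda>x. z k * x * (s 2 * t)"] by (simp add: D_def mult.assoc algebra_simps)
    also have "\<dots> \<in> U"
      by (intro memU V_B_U) (use k in auto)
    finally show "z k * (Wh * D 2) \<in> U" .
  next
    have "z (- 7) * (L * (s (- 1) * t)) * (s 2 * t) \<in> U"
      by (rule V_s2_t_in_U[OF V_mono[OF L_sm1_t_in_V]]) auto
    then show "z (- 7) * (L * (s (- 1) * D 2)) \<in> U"
      by (simp add: D_def mult.assoc)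
  next
    have "K ^ 3 \<cdot> (s (- 3) * (z (- 1) * (L * (s 1 * D 2)) + (a * d * e' ^ 3) \<cdot> (z 4 * (s (- 2) * (D (- 4) * s (- 1))))
       - a \<cdot> (z (- 1) * (L * D 2)))) \<in> U"
      by (intro bimodD(3,4,10)[OF bimod_U] L_s_X_in_U' L_X_in_U)
    then show "K ^ 4 \<cdot> (z (- 7 + 8) * (s (- 4) * x)) + K ^ 3 \<cdot> (z (- 7 + 6) * (s (- 3) * ((L * s 1 - a \<cdot> L) * D
        2))) \<in> U"
      by (simp add: x_def algebra_simps power3_eq_cube power4_eq_xxxx)
  qed (auto intro: L_s_X_in_U)
  then have "z 1 * (Wh * s 1 * D 2 - x) \<in> U"
    using cancel_left[OF bimod_U] by (simp add: K_power)
  also have "z 1 * (Wh * s 1 * D 2 - x) = e' \<cdot> (z 5 * (s (- 1) * (t * s (- 3)))) - (a * e') \<cdot> (z 4 * (s 0 * (t *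
      s 1)))
     - (b * e') \<cdot> (z 3 * D 3) - (c * e') \<cdot> (z 2 * (D 3 * (s 2 * t)))
     - (a * e') \<cdot> (z 4 * (s (- 1) * ((D 0 - a \<cdot> D (- 1) - b \<cdot> D (- 2) - c \<cdot> D (- 3)) * s (- 1))))"
  proof -
    show ?thesis
      using arg_cong2[where f = "(-)", OF arg_cong[OF Wh_s_t, of "\<lambda>x. z 1 * x * (s 2 * t)"]
        arg_cong[OF D_down[of "-3"], of "\<lambda>x. a \<cdot> (z 4 * (s (- 1) * (x * s (- 1))))"]]
      by (simp add: x_def D_def mult.assoc algebra_simps)
  qed
  finally have *: "e' \<cdot> (z 5 * (s (- 1) * (t * s (- 3)))) - (a * e') \<cdot> (z 4 * (s 0 * (t * s 1)))
     - (b * e') \<cdot> (z 3 * D 3) - (c * e') \<cdot> (z 2 * (D 3 * (s 2 * t)))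
     - (a * e') \<cdot> (z 4 * (s (- 1) * ((D 0 - a \<cdot> D (- 1) - b \<cdot> D (- 2) - c \<cdot> D (- 3)) * s (- 1)))) \<in> U" .
  have "z 4 * (D 0 - a \<cdot> D (- 1) - b \<cdot> D (- 2) - c \<cdot> D (- 3)) \<in> U"
    unfolding right_diff_distrib scale_mult_right
    by (intro memU D_small_in[OF bimod_U] Dm3_in_U V_gens_in_U) auto
  then have "(e' \<cdot> (z 5 * (s (- 1) * (t * s (- 3)))) - (a * e') \<cdot> (z 4 * (s 0 * (t * s 1)))
     - (b * e') \<cdot> (z 3 * D 3) - (c * e') \<cdot> (z 2 * (D 3 * (s 2 * t)))
     - (a * e') \<cdot> (z 4 * (s (- 1) * ((D 0 - a \<cdot> D (- 1) - b \<cdot> D (- 2) - c \<cdot> D (- 3)) * s (- 1)))))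
     + (a * e') \<cdot> (z 4 * (s 0 * (t * s 1))) + (b * e') \<cdot> (z 3 * D 3) + (c * e') \<cdot> (z 2 * (D 3 * (s 2 * t)))
     + (a * e') \<cdot> (z 4 * (s (- 1) * ((D 0 - a \<cdot> D (- 1) - b \<cdot> D (- 2) - c \<cdot> D (- 3)) * s (- 1)))) \<in> U"
    by (intro memU * V_B_U D3_in_U V_s2_t_mem D_in_V) auto
  then have "e' ^ 1 \<cdot> (z 5 * (s (- 1) * (t * s (- 3)))) \<in> U"
    by simp
  then have "z 5 * (t * s (- 3)) \<in> U"
    by (rule cancel_left[OF bimod_U])
  from bimodD(11)[OF bimod_U this, of 3] show ?thesis
    by (simp add: mult.assoc)
qed

lemma t_in_U: "- 5 \<le> k \<Longrightarrow> k \<le> 5 \<Longrightarrow> z k * t \<in> U"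
  using t_top by (cases "k = 5") (auto intro!: V_gens_in_U)

lemma X_top: "z 4 * D 2 \<in> U"
proof -
  have "z 4 * D 2 = e \<cdot> (z 4 * D (- 3)) + a \<cdot> (z 4 * D 1) + b \<cdot> (z 4 * D 0) + c \<cdot> (z 4 * D (- 1)) + d \<cdot> (z 4 * D
      (- 2))"
    using D_up[of "-1"] by (simp add: algebra_simps)
  also have "\<dots> \<in> U"
    by (intro memU D_small_in[OF bimod_U] Dm3_in_U t_in_U V_gens_in_U) auto
  finally show ?thesis .
qed

lemma Dm3_top': "z 5 * D (- 3) \<in> U"
proof -
  have "z 4 * D (- 4) \<in> U"
    by (intro Dm4_in bimod_U Dm3_in_U V_gens_in_U t_in_U) auto
  then have "z 2 * (Wh * s 1 * t) + ((a * e') \<cdot> (z 5 * (s (- 1) * (t * s (- 3))))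
   + (b * e') \<cdot> (z 4 * (s 0 * (t * s 1))) + (c * e') \<cdot> (z 3 * D 3)) + a \<cdot> (z 4 * (s (- 1) * (D (- 4) * s (- 1)))) \<in> U"
    by (intro memU Wh_s_t_in_U V_B_U D3_in_U t_in_U) auto
  then have "e' ^ 1 \<cdot> (z 5 * (s (- 1) * (D (- 3) * s (- 2)))) \<in> U"
    by (simp add: Wh_s_t[unfolded mult.assoc] algebra_simps)
  then have "z 5 * (D (- 3) * s (- 2)) \<in> U"
    by (rule cancel_left[OF bimod_U])
  from bimodD(11)[OF bimod_U this, of 2] show ?thesis
    by (simp add: mult.assoc)
qed

lemma U_t_in_U:
  assumes "x \<in> U"
  shows "x * t \<in> U"
  using assms
proof induction
  case (V x)
  show ?case
    using V
  proof (rule V_mult[OF _ subspace_U U_left])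
    fix k :: int assume "- 4 \<le> k" "k \<le> 5"
    then show "z k * t \<in> U" by (intro t_in_U) auto
  next
    fix k j :: int assume k: "- 5 \<le> k" "k \<le> 4" and j: "- 2 \<le> j" "j \<le> 2"
    consider "j = - 2" | "j = - 1" | "j = 0" | "j = 1" | "j = 2" using j by linarith
    then have "z k * D j \<in> U"
    proof cases
      case 5
      then show ?thesis using k X_top by (cases "k = 4") (auto intro: V_gens_in_U)
    qed (use k in \<open>auto intro!: D_small_in[OF bimod_U] t_in_U V_gens_in_U(1,3)\<close>)
    then show "z k * (t * (s j * t)) \<in> U" by (simp add: D_def)
  next
    fix k j :: int assume k: "- 6 \<le> k" "k \<le> 3" and j: "- 2 \<le> j" "j \<le> 2"
    consider "j = - 2" | "j = - 1" | "j = 0" | "j = 1" | "j = 2" using j by linarith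
    then show "z k * (t * (s 2 * (t * (s j * t)))) \<in> U"
    proof cases
      case 1
      have "z k * W \<in> U"
        using k by (intro W_in_U D3_in_U Dm3_in_U) auto
      then show ?thesis by (simp add: W_def 1)
    next
      case 2
      then show ?thesis using bimodD(7)[OF bimod_U D3_in_U, of k 1] k by (simp add: D_def mult.assoc)
    next
      case 3
      then show ?thesis using bimodD(7)[OF bimod_U t_in_U, of "k + 1" 2] k by simp
    next
      case 4
      then show ?thesis using bimodD(8)[OF bimod_U t_in_U, of "k + 2" "- 1" "- 2"] k by simp
    next
      case 5
      have "z (k + 2) * D (- 3) \<in> U"
        using k Dm3_top' by (cases "k = 3") (auto intro: Dm3_in_U)
      then show ?thesis using bimodD(8)[OF bimod_U, of "k + 2" "D (- 3)" "- 1" "- 1"] by (simp add: X_s2_t 5)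
    qed
  qed
next
  case (W k i)
  have X: "z (k + 1) * (D 2 * s j) \<in> U" for j
    using W X_top by (cases "k = 3") (auto intro!: memU V_gens_in_U)
  have "z k * (Wh * t) = z (k + 1) * (D 2 * s (- 2)) - a \<cdot> (z (k + 2) * (s (- 1) * (t * s (- 3))))
    + (d * e') \<cdot> (z (k + 1) * (D 2 * s (- 1)))"
    by (simp add: Wh_t D_def algebra_simps)
  also have "\<dots> \<in> U"
    using W by (intro memU X t_in_U) auto
  finally show ?case
    using U_left[of "z k * (Wh * t)" i] by (simp add: mult.assoc)
qed (auto simp: distrib_right intro: U.intros)

section \<open>The span of the basis and multiplication by s2\<close>

abbreviation "basis \<equiv> gen scale a (d * e') s z t"

lemma basis_simps:
  "basis (0, k, i, j) = z k * s i" "basis (1, k, i, j) = z k * (s i * (t * s j))"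
  "basis (2, k, i, j) = z k * (s i * (t * (s 2 * (t * s j))))" "basis (3, k, i, j) = z k * (s i * Wh)"
  by (simp_all add: gen_def Wh_def W_def D_def)

lemma Idx_cases:
  assumes "p \<in> Idx"
  obtains (A) k i where "p = (0, k, i, 0)" "- 4 \<le> k" "k \<le> 5" "0 \<le> i" "i \<le> 4"
  | (B) k i j where "p = (1, k, i, j)" "- 5 \<le> k" "k \<le> 4" "0 \<le> i" "i \<le> 4" "- 2 \<le> j" "j \<le> 2"
  | (C) k i j where "p = (2, k, i, j)" "- 6 \<le> k" "k \<le> 3" "0 \<le> i" "i \<le> 4" "- 2 \<le> j" "j \<le> 2"
  | (W) k i where "p = (3, k, i, 0)" "- 6 \<le> k" "k \<le> 3" "0 \<le> i" "i \<le> 4"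
  using assms that by (auto simp: Idx_def)

lemma basis_in_U: "p \<in> Idx \<Longrightarrow> basis p \<in> U"
  by (erule Idx_cases) (auto simp del: s_add simp: basis_simps intro: V_A_U V_B_U V_C_U U.W)

lemma U_eq_span: "U = span (basis ` Idx)"
proof
  show "span (basis ` Idx) \<subseteq> U"
    by (rule span_minimal[OF _ subspace_U]) (auto intro: basis_in_U)
next
  let ?S = "span (basis ` Idx)"
  have I: "basis p \<in> ?S" if "p \<in> Idx" for p
    using that by (intro span_base) auto
  have IA: "z k * s i \<in> ?S" if "- 4 \<le> k" "k \<le> 5" "0 \<le> i" "i \<le> 4" for k i
    using that by (intro I[of "(0, k, i, 0)", unfolded basis_simps]) (simp add: Idx_def)
  have IB: "z k * (s i * (t * s j)) \<in> ?S" if "- 5 \<le> k" "k \<le> 4" "0 \<le> i" "i \<le> 4" "- 2 \<le> j" "j \<le> 2" for k i j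
    using that by (intro I[of "(1, k, i, j)", unfolded basis_simps]) (simp add: Idx_def)
  have IC: "z k * (s i * (t * (s 2 * t) * s j)) \<in> ?S" if "- 6 \<le> k" "k \<le> 3" "0 \<le> i" "i \<le> 4" "- 2 \<le> j" "j \<le> 2" for k i j
    unfolding mult.assoc using that by (intro I[of "(2, k, i, j)", unfolded basis_simps]) (simp add: Idx_def)
  have IW: "z k * (s i * Wh) \<in> ?S" if "- 6 \<le> k" "k \<le> 3" "0 \<le> i" "i \<le> 4" for k i
    using that by (intro I[of "(3, k, i, 0)", unfolded basis_simps]) (simp add: Idx_def)
  have left: "z k * (s i * u) \<in> ?S" if "\<And>i. 0 \<le> i \<Longrightarrow> i \<le> 4 \<Longrightarrow> z k * (s i * u) \<in> ?S" for k i u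
    by (rule subspace_s_powers[OF subspace_span, of 0]) (use that in auto)
  have right: "z k * (s i * (u * s j)) \<in> ?S"
    if "\<And>j. - 2 \<le> j \<Longrightarrow> j \<le> 2 \<Longrightarrow> z k * (s i * (u * s j)) \<in> ?S" for k i j u
    using subspace_s_powers[OF subspace_span, of "- 2" "z k * (s i * u)" 1 "basis ` Idx" j] that
    by (simp add: mult.assoc)
  have A: "z k * s i \<in> ?S" if "- 4 \<le> k" "k \<le> 5" for k i
    using left[of k 1 i] IA that by simp
  have B: "z k * (s i * (t * s j)) \<in> ?S" if "- 5 \<le> k" "k \<le> 4" for k i j
    by (rule right, rule left, rule IB) (use that in auto)
  have "z k * (s i * (t * (s 2 * t) * s j)) \<in> ?S" if "- 6 \<le> k" "k \<le> 3" for k i j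
    by (rule right, rule left, rule IC) (use that in auto)
  then have C: "z k * (s i * (t * (s 2 * (t * s j)))) \<in> ?S" if "- 6 \<le> k" "k \<le> 3" for k i j
    using that by (simp add: mult.assoc)
  have W: "z k * (s i * Wh) \<in> ?S" if "- 6 \<le> k" "k \<le> 3" for k i
    by (rule left, rule IW) (use that in auto)
  have V: "x \<in> ?S" if "x \<in> V0" for x
    using that by induction (auto intro: span_zero span_add span_scale A B C)
  have "x \<in> ?S" if "x \<in> U" for x
    using that by induction (auto intro: span_add span_scale V W)
  then show "U \<subseteq> ?S" by blast
qed

text \<open>The factor is the n-th power of s2 = z^-1 t s t. No stability under z^-1 is available,
  but s2 is also s^-1 t s^-1, which avoids it; hence the induction on n.\<close>

lemma U_s2_in_U:
  assumes "x \<in> U" and "0 \<le> n"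
  shows "x * (z (- 1) * (t * (s n * t))) \<in> U"
  using \<open>0 \<le> n\<close>
proof (induction n rule: int_ge_induct)
  case base
  show ?case using assms by simp
next
  case (step n)
  have "z (- 1) * (t * (s (n + 1) * t)) = z (- 1) * (t * (s n * t)) * (z (- 1) * (t * (s 1 * t)))"
    by (simp add: mult.assoc del: t_s1_t) 
  moreover have "x * (z (- 1) * (t * (s n * t))) * (s (- 1) * (t * s (- 1))) \<in> U"
    using bimodD(11)[OF bimod_U U_t_in_U[OF bimodD(11)[OF bimod_U step.IH, of "- 1"]], of "- 1"]
    by (simp add: mult.assoc)
  ultimately show ?case by (simp add: mult.assoc)
qed

text \<open>The inverse of s2 involves z^-1 as well. The quintic, conjugated by t, makes it a
  polynomial in s2.\<close>

lemma U_s2_inverse_in_U: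
  assumes "x \<in> U"
  shows "x * (z (- 1) * (s 1 * (t * s 1))) \<in> U"
proof -
  have "x * (z (- 1) * (s 1 * (t * s 1))) = x * (z (- 1) * (t * (s (- 1) * t)))"
    by simp
  also have "\<dots> = e' \<cdot> (x * (z (- 1) * (t * (s 4 * t))) - a \<cdot> (x * (z (- 1) * (t * (s 3 * t))))
     - b \<cdot> (x * (z (- 1) * (t * (s 2 * t)))) - c \<cdot> (x * (z (- 1) * (t * (s 1 * t)))) - d \<cdot> (x * (z (- 1) * (t *
         (s 0 * t)))))"
    using expand_down[of "x * (z (- 1) * t)" 1 t] by (simp add: mult.assoc del: t_sm1_t t_s1_t)
  also have "\<dots> \<in> U"
    by (intro bimodD(3,4)[OF bimod_U] U_s2_in_U[OF assms]) auto
  finally show ?thesis .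
qed

lemma one_in_U: "1 \<in> U"
  using V_gens_in_U(1)[of 0] by simp

end

subsection \<open>Actions of group algebras\<close>

definition pm_sum :: "('k \<Rightarrow> 'r \<Rightarrow> 'b) \<Rightarrow> ('k \<Rightarrow>\<^sub>0 'r::zero) \<Rightarrow> 'b::comm_monoid_add" where
  "pm_sum f x = (\<Sum>k\<in>Poly_Mapping.keys x. f k (Poly_Mapping.lookup x k))"

lemma pm_sum_single [simp]: "f k 0 = 0 \<Longrightarrow> pm_sum f (Poly_Mapping.single k r) = f k r"
  by (simp add: pm_sum_def)

lemma pm_sum_zero [simp]: "pm_sum f 0 = 0"
  by (simp add: pm_sum_def)

lemma pm_sum_add:
  assumes "\<And>k. f k 0 = 0" "\<And>k r r'. f k (r + r') = f k r + f k r'"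
  shows "pm_sum f (x + y) = pm_sum f x + pm_sum f y"
  unfolding pm_sum_def using assms by (rule setsum_keys_plus_distrib)

lemma poly_mapping_sum_singles:
  fixes x :: "'k \<Rightarrow>\<^sub>0 'r::comm_monoid_add"
  shows "x = (\<Sum>k\<in>Poly_Mapping.keys x. Poly_Mapping.single k (Poly_Mapping.lookup x k))"
proof (rule poly_mapping_eqI)
  fix k
  have "Poly_Mapping.lookup (\<Sum>k\<in>Poly_Mapping.keys x. Poly_Mapping.single k (Poly_Mapping.lookup x k)) k =
      (\<Sum>i\<in>Poly_Mapping.keys x. if i = k then Poly_Mapping.lookup x k else 0)"
    unfolding lookup_sum by (rule sum.cong) (auto simp: lookup_single)
  also have "\<dots> = Poly_Mapping.lookup x k"
    by (simp add: in_keys_iff)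
  finally show "Poly_Mapping.lookup x k = Poly_Mapping.lookup (\<Sum>k\<in>Poly_Mapping.keys x. Poly_Mapping.single k
      (Poly_Mapping.lookup x k)) k" ..
qed

lemma poly_mapping_additive_induct [case_names zero single add]:
  fixes x :: "'k \<Rightarrow>\<^sub>0 'r::comm_monoid_add"
  assumes "P 0" "\<And>k r. P (Poly_Mapping.single k r)" "\<And>x y. P x \<Longrightarrow> P y \<Longrightarrow> P (x + y)"
  shows "P x"
proof -
  have "P (\<Sum>k\<in>A. Poly_Mapping.single k (Poly_Mapping.lookup x k))" if "finite A" for A
    using that by induction (auto intro: assms)
  then show ?thesis
    by (subst poly_mapping_sum_singles) simp
qed

locale algebra_action = module scale
  for scale :: "'c::comm_ring_1 \<Rightarrow> 'm::ab_group_add \<Rightarrow> 'm" +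
  fixes hom :: "'r::comm_ring_1 \<Rightarrow> 'c" and \<rho> :: "'g::monoid_add \<Rightarrow> 'm \<Rightarrow> 'm"
  assumes hom_add: "hom (x + y) = hom x + hom y" and hom_mult: "hom (x * y) = hom x * hom y" and hom_1: "hom 1 = 1"
    and \<rho>_add: "\<rho> g (v + w) = \<rho> g v + \<rho> g w" and \<rho>_scale: "\<rho> g (scale r v) = scale r (\<rho> g v)"
    and \<rho>_0: "\<rho> 0 v = v" and \<rho>_plus: "\<rho> (g + h) v = \<rho> h (\<rho> g v)"
begin

lemma hom_0: "hom 0 = 0"
  using hom_add[of 0 0] by simp

definition act :: "'m \<Rightarrow> ('g \<Rightarrow>\<^sub>0 'r) \<Rightarrow> 'm" where
  "act v x = pm_sum (\<lambda>g r. scale (hom r) (\<rho> g v)) x"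

lemma act_single: "act v (Poly_Mapping.single g r) = scale (hom r) (\<rho> g v)"
  by (simp add: act_def hom_0)

lemma act_zero: "act v 0 = 0"
  by (simp add: act_def)

lemma act_add: "act v (x + y) = act v x + act v y"
  unfolding act_def by (rule pm_sum_add) (simp_all add: hom_0 hom_add scale_left_distrib)

lemma act_add_left: "act (v + w) x = act v x + act w x"
  by (simp add: act_def pm_sum_def \<rho>_add scale_right_distrib sum.distrib)

lemma act_scale_left: "act (scale c v) x = scale c (act v x)"
  by (simp add: act_def pm_sum_def \<rho>_scale scale_sum_right mult.commute)

lemma act_zero_left: "act 0 x = 0"
  using act_scale_left[of 0 0 x] by simp

lemma act_uminus: "act v (- x) = - act v x"
  using act_add[of v x "- x"] by (simp add: act_zero eq_neg_iff_add_eq_0 add.commute)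

lemma act_diff: "act v (x - y) = act v x - act v y"
  using act_add[of v x "- y"] by (simp add: act_uminus)

lemma act_sum: "act v (sum f A) = (\<Sum>i\<in>A. act v (f i))"
  by (induction A rule: infinite_finite_induct) (auto simp: act_zero act_add)

lemma act_mult: "act v (x * y) = act (act v x) y"
proof (induction x rule: poly_mapping_additive_induct)
  case (single g r)
  show ?case
  proof (induction y rule: poly_mapping_additive_induct)
    case (single h r')
    show ?case by (simp add: mult_single act_single hom_mult \<rho>_plus \<rho>_scale mult.commute)
  qed (auto simp: act_zero act_add distrib_left)
qed (auto simp: act_zero act_zero_left act_add act_add_left distrib_right)

lemma act_one: "act v 1 = v"
  using act_single[of v 0 1] by (simp add: hom_1 \<rho>_0)

text \<open>The action is from the right. A left factor of an ideal element merely changes the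
  vector, which is why the condition on \<open>R\<close> is for every \<open>v\<close>; a right
  factor is absorbed by the stability of \<open>N\<close>.\<close>

lemma act_ideal:
  assumes N: "subspace N" "\<And>g v. v \<in> N \<Longrightarrow> \<rho> g v \<in> N"
    and R: "\<And>v r. r \<in> R \<Longrightarrow> act v r \<in> N"
    and x: "x \<in> two_sided_ideal R"
  shows "act v x \<in> N"
proof -
  have stable: "act v y \<in> N" if "v \<in> N" for v y
    unfolding act_def pm_sum_def using that
    by (intro subspace_sum[OF N(1)] subspace_scale[OF N(1)] N(2))
  show ?thesis
    using x
  proof (induction arbitrary: v)
    case (base x) then show ?case by (rule R)
  next
    case zero show ?case using subspace_0[OF N(1)] by (simp add: act_zero)
  next
    case (add x y) then show ?case using subspace_add[OF N(1)] by (simp add: act_add)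
  next
    case (mult_left x r) then show ?case by (simp add: act_mult)
  next
    case (mult_right x r) then show ?case by (simp add: act_mult stable)
  qed
qed

end

subsection \<open>Actions of the braid group\<close>

locale braid_ops =
  fixes f f' g g' :: "'m \<Rightarrow> 'm"
  assumes f_inv: "f (f' v) = v" "f' (f v) = v" and g_inv: "g (g' v) = v" "g' (g v) = v"
    and braid_op: "f (g (f v)) = g (f (g v))"
begin

fun letter_op :: "braid_gen \<times> bool \<Rightarrow> 'm \<Rightarrow> 'm" where
  "letter_op (S1, False) = f" | "letter_op (S1, True) = f'"
| "letter_op (S2, False) = g" | "letter_op (S2, True) = g'"

lemma letter_op_cancel: "letter_op (x, \<not> b) (letter_op (x, b) v) = v"
  by (cases x; cases b) (simp_all add: f_inv g_inv)

lemma braid_eq_fold: "braid_eq v w \<Longrightarrow> fold letter_op v = fold letter_op w"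
  by (induction rule: braid_eq.induct) (auto simp: fun_eq_iff letter_op_cancel braid_op)

text \<open>\<open>fold\<close> applies the first letter first, which makes this a right
  action.\<close>

definition braid_act :: "braid3 \<Rightarrow> 'm \<Rightarrow> 'm" where
  "braid_act x = fold letter_op (rep_braid3 x)"

lemma braid_act_abs: "braid_act (abs_braid3 w) = fold letter_op w"
  unfolding braid_act_def
  by (rule braid_eq_fold) (rule Quotient3_rep_abs[OF Quotient3_braid3], rule braid_eq.refl)

lemma braid_act_plus: "braid_act (x + y) v = braid_act y (braid_act x v)"
proof -
  obtain u w where "x = abs_braid3 u" "y = abs_braid3 w"
    by (metis Quotient3_abs_rep[OF Quotient3_braid3])
  then show ?thesis by (simp add: plus_braid3.abs_eq braid_act_abs)
qed

lemma braid_act_zero: "braid_act 0 v = v"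
  by (simp add: zero_braid3.abs_eq braid_act_abs)

lemma braid_act_gens: "braid_act s1 = f" "braid_act s2 = g"
  by (simp_all add: s1.abs_eq s2.abs_eq braid_act_abs)

lemma braid_act_induct:
  assumes "\<And>v. P v \<Longrightarrow> P (f v)" "\<And>v. P v \<Longrightarrow> P (f' v)" "\<And>v. P v \<Longrightarrow> P (g v)" "\<And>v. P v \<Longrightarrow> P (g' v)" "P v"
  shows "P (braid_act x v)"
proof -
  have letter: "P (letter_op l v)" if "P v" for l v
    using that assms by (cases l rule: letter_op.cases) auto
  have "P (fold letter_op w v)" if "P v" for w v
    using that by (induction w arbitrary: v) (auto intro: letter)
  then show ?thesis using assms by (simp add: braid_act_def)
qed

end

subsection \<open>Free modules\<close>

definition pscale :: "'r::comm_ring_1 \<Rightarrow> ('k \<Rightarrow>\<^sub>0 'r) \<Rightarrow> ('k \<Rightarrow>\<^sub>0 'r)" (infixr "\<cdot>" 75) where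
  "r \<cdot> v = Poly_Mapping.map ((*) r) v"

lemma lookup_pscale [simp]: "Poly_Mapping.lookup (r \<cdot> v) k = r * Poly_Mapping.lookup v k"
  by (simp add: pscale_def Poly_Mapping.map.rep_eq when_def)

interpretation pscale: module pscale
  by unfold_locales (auto intro!: poly_mapping_eqI simp: lookup_add algebra_simps)

lemma pscale_single: "r \<cdot> Poly_Mapping.single k x = Poly_Mapping.single k (r * x)"
  by (rule poly_mapping_eqI) (simp add: lookup_single when_def)

abbreviation bas :: "'k \<Rightarrow> ('k \<Rightarrow>\<^sub>0 'r::comm_ring_1)" where
  "bas k \<equiv> Poly_Mapping.single k 1"

lemma free_induct [case_names bas scale add]:
  assumes "\<And>k. P (bas k)" "\<And>r v. P v \<Longrightarrow> P (r \<cdot> v)" "\<And>v w. P v \<Longrightarrow> P w \<Longrightarrow> P (v + w)"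
  shows "P v"
proof (induction v rule: poly_mapping_additive_induct)
  case zero
  show ?case using assms(2)[OF assms(1), of 0] by simp
next
  case (single k r)
  show ?case using assms(2)[OF assms(1), of r k] by (simp add: pscale_single)
qed (rule assms(3))

definition lin :: "('k \<Rightarrow> ('j \<Rightarrow>\<^sub>0 'r)) \<Rightarrow> ('k \<Rightarrow>\<^sub>0 'r::comm_ring_1) \<Rightarrow> ('j \<Rightarrow>\<^sub>0 'r)" where
  "lin M v = pm_sum (\<lambda>k r. r \<cdot> M k) v"

lemma lin_bas [simp]: "lin M (bas k) = M k"
  by (simp add: lin_def)

lemma lin_add: "lin M (v + w) = lin M v + lin M w"
  unfolding lin_def by (rule pm_sum_add) (simp_all add: pscale.scale_left_distrib)

lemma lin_zero [simp]: "lin M 0 = 0"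
  by (simp add: lin_def)

lemma lin_uminus: "lin M (- v) = - lin M v"
  using lin_add[of M v "- v"] by (simp add: eq_neg_iff_add_eq_0 add.commute)

lemma lin_diff: "lin M (v - w) = lin M v - lin M w"
  using lin_add[of M v "- w"] by (simp add: lin_uminus)

lemma lin_scale: "lin M (r \<cdot> v) = r \<cdot> lin M v"
proof (induction v rule: poly_mapping_additive_induct)
  case (single k x)
  show ?case by (simp add: pscale_single) (simp add: lin_def pm_sum_single)
qed (simp_all add: pscale.scale_right_distrib lin_add)

lemmas lin_simps = lin_add lin_diff lin_uminus lin_scale

lemma lin_lin: "lin M (lin M' v) = lin (\<lambda>k. lin M (M' k)) v"
  by (induction v rule: free_induct) (simp_all add: lin_simps)

lemma lin_id: "lin bas v = v"
  by (induction v rule: free_induct) (simp_all add: lin_simps)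

lemma subspace_range_lin: "pscale.subspace (range (lin M))"
  unfolding pscale.subspace_def by (auto simp flip: lin_add lin_scale intro: range_eqI[of 0 _ 0])

lemma lin_in_subspace: "pscale.subspace N \<Longrightarrow> (\<And>k. M k \<in> N) \<Longrightarrow> lin M v \<in> N"
  by (induction v rule: free_induct) (auto simp: lin_simps intro: pscale.subspace_add pscale.subspace_scale)

definition vmap :: "('r::zero \<Rightarrow> 'c::zero) \<Rightarrow> ('k \<Rightarrow>\<^sub>0 'r) \<Rightarrow> ('k \<Rightarrow>\<^sub>0 'c)" where
  "vmap = Poly_Mapping.map"

locale ring_hom =
  fixes h :: "'r::comm_ring_1 \<Rightarrow> 'c::comm_ring_1"
  assumes hom_add: "h (x + y) = h x + h y" and hom_mult: "h (x * y) = h x * h y" and hom_1: "h 1 = 1"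
begin

lemma hom_0: "h 0 = 0"
  using hom_add[of 0 0] by simp

lemma hom_uminus: "h (- x) = - h x"
  using hom_add[of x "- x"] by (simp add: hom_0 eq_neg_iff_add_eq_0 add.commute)

lemma hom_diff: "h (x - y) = h x - h y"
  using hom_add[of x "- y"] by (simp add: hom_uminus)

lemma hom_power: "h (x ^ n) = h x ^ n"
  by (induction n) (simp_all add: hom_1 hom_mult)

lemmas hom_simps = hom_add hom_diff hom_uminus hom_mult hom_0 hom_1 hom_power

lemma lookup_vmap: "Poly_Mapping.lookup (vmap h v) k = h (Poly_Mapping.lookup v k)"
  by (simp add: vmap_def Poly_Mapping.map.rep_eq when_def hom_0)

lemma vmap_simps: "vmap h (v + w) = vmap h v + vmap h w" "vmap h (v - w) = vmap h v - vmap h w"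
    "vmap h (- v) = - vmap h v" "vmap h (r \<cdot> v) = h r \<cdot> vmap h v" "vmap h (bas k) = bas k" "vmap h 0 = 0"
  by (rule poly_mapping_eqI; simp add: lookup_vmap lookup_add lookup_minus lookup_single hom_simps when_def)+

lemma vmap_lin: "vmap h (lin M v) = lin (\<lambda>k. vmap h (M k)) (vmap h v)"
  by (induction v rule: free_induct) (simp_all add: vmap_simps lin_simps)

end

lemma (in ring_hom) vmap_single: "vmap h (Poly_Mapping.single k r) = Poly_Mapping.single k (h r)"
  by (rule poly_mapping_eqI) (simp add: lookup_vmap lookup_single when_def hom_0)

lemma (in ring_hom) vmap_mult:
  fixes x y :: "'g::monoid_add \<Rightarrow>\<^sub>0 'r"
  shows "vmap h (x * y) = vmap h x * vmap h y"
proof (induction x rule: poly_mapping_additive_induct)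
  case (single g r)
  show ?case
  proof (induction y rule: poly_mapping_additive_induct)
    case (single h' r')
    show ?case by (simp add: mult_single vmap_single hom_mult)
  qed (simp_all add: distrib_left vmap_simps)
qed (simp_all add: distrib_right vmap_simps)

lemma (in ring_hom) ring_hom_vmap: "ring_hom (vmap h :: ('g::comm_monoid_add \<Rightarrow>\<^sub>0 'r) \<Rightarrow> _)"
  using vmap_single[of 0 1] by unfold_locales (simp_all add: vmap_simps vmap_mult hom_1)

lemma ring_hom_eval:
  fixes \<chi> :: "'g::comm_monoid_add \<Rightarrow> 'c::comm_ring_1"
  assumes "\<chi> 0 = 1" "\<And>g h. \<chi> (g + h) = \<chi> g * \<chi> h"
  shows "ring_hom (pm_sum (\<lambda>k r. of_int r * \<chi> k))"
proof
  let ?e = "pm_sum (\<lambda>k r. of_int r * \<chi> k)"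
  show add: "?e (x + y) = ?e x + ?e y" for x y
    by (rule pm_sum_add) (simp_all add: algebra_simps)
  show "?e (x * y) = ?e x * ?e y" for x y
  proof (induction x rule: poly_mapping_additive_induct)
    case (single g r)
    show ?case
    proof (induction y rule: poly_mapping_additive_induct)
      case (single h' r')
      show ?case by (simp add: mult_single assms ac_simps)
    qed (simp_all add: distrib_left add)
  qed (simp_all add: distrib_right add)
  show "?e 1 = 1"
    by (simp add: assms flip: single_one)
qed

lemma lookup_single_mult:
  fixes x :: "'g::ab_group_add \<Rightarrow>\<^sub>0 'r::comm_ring_1"
  shows "Poly_Mapping.lookup (Poly_Mapping.single j r * x) k = r * Poly_Mapping.lookup x (k - j)"
  by (induction x rule: poly_mapping_additive_induct)
    (auto simp: mult_single lookup_single lookup_add distrib_left when_def)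

definition ipow :: "'c::monoid_mult \<Rightarrow> 'c \<Rightarrow> int \<Rightarrow> 'c" where
  "ipow x x' k = (if 0 \<le> k then x ^ nat k else x' ^ nat (- k))"

lemma ipow_0 [simp]: "ipow x x' 0 = 1"
  by (simp add: ipow_def)

lemma ipow_Suc:
  assumes "x * x' = 1" "x' * x = 1"
  shows "ipow x x' (k + 1) = x * ipow x x' k"
proof (cases "0 \<le> k")
  case True
  then show ?thesis by (simp add: ipow_def nat_add_distrib)
next
  case False
  then obtain n where n: "k = - int (Suc n)" by (metis int_cases2 negD not_le)
  have "x' ^ n = x * x' ^ Suc n" by (simp add: assms flip: mult.assoc)
  then show ?thesis by (cases n) (simp_all add: ipow_def n nat_add_distrib)
qed

lemma ipow_add:
  assumes "x * x' = 1" "x' * x = 1"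
  shows "ipow x x' (j + k) = ipow x x' j * ipow x x' k"
proof (induction j rule: int_induct[where k = 0])
  case (step1 i)
  have "ipow x x' (i + 1 + k) = x * ipow x x' (i + k)"
    using ipow_Suc[OF assms, of "i + k"] by (simp add: ac_simps)
  then show ?case
    by (simp add: step1 ipow_Suc[OF assms] mult.assoc)
next
  case (step2 i)
  have "x * ipow x x' (i - 1 + k) = x * (ipow x x' (i - 1) * ipow x x' k)"
    using ipow_Suc[OF assms, of "i - 1 + k"] ipow_Suc[OF assms, of "i - 1"] step2 by (simp add: ac_simps flip:
        mult.assoc)
  then have "x' * x * ipow x x' (i - 1 + k) = x' * x * (ipow x x' (i - 1) * ipow x x' k)"
    by (simp only: mult.assoc)
  then show ?case by (simp add: assms)
qed simp

definition r5_eval :: "'c::comm_ring_1 \<Rightarrow> 'c \<Rightarrow> 'c \<Rightarrow> 'c \<Rightarrow> 'c \<Rightarrow> 'c \<Rightarrow> r5 \<Rightarrow> 'c" where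
  "r5_eval a b c d e f = pm_sum (\<lambda>k r. of_int r * (case k of (i, j, k, n, p) \<Rightarrow> a ^ i * b ^ j * c ^ k * d ^ n *
      ipow e f p))"

lemma ring_hom_r5_eval: "e * f = 1 \<Longrightarrow> ring_hom (r5_eval a b c d e f)"
  unfolding r5_eval_def
  by (rule ring_hom_eval) (auto simp: zero_prod_def power_add ipow_add mult.commute[of f e])

definition r5_e' :: r5 where "r5_e' = Poly_Mapping.single (0, 0, 0, 0, - 1) 1"

lemma r5_e_e': "r5_e * r5_e' = 1"
  by (simp add: r5_e_def r5_e'_def mult_single flip: single_one) (simp add: zero_prod_def)

lemma r5_eval_gens: "r5_eval a b c d e f r5_a = a" "r5_eval a b c d e f r5_b = b" "r5_eval a b c d e f r5_c = c"
    "r5_eval a b c d e f r5_d = d" "r5_eval a b c d e f r5_e = e" "r5_eval a b c d e f r5_e' = f"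
  by (simp_all add: r5_eval_def r5_a_def r5_b_def r5_c_def r5_d_def r5_e_def r5_e'_def ipow_def)

subsection \<open>The braid module of rank twelve\<close>

text \<open>
  The basis vectors stand for \<open>1\<close>, \<open>t s\<^sup>j\<close>, \<open>t s\<^sup>2 t s\<^sup>j\<close> for \<open>j = -2, \<dots>, 2\<close> and the corrected \<open>t s\<^sup>2 t s\<^sup>-\<^sup>2 t\<close>. The
  vectors \<open>D3\<close>, \<open>Dm3\<close>, \<open>T3\<close>, \<dots> below stand for \<open>t s\<^sup>3 t\<close>, \<open>t s\<^sup>-\<^sup>3 t\<close>, \<open>t s\<^sup>3\<close>, \<dots>, with suffix \<open>s\<close> or \<open>si\<close> for a further factor \<open>s\<close>
  or \<open>s\<^sup>-\<^sup>1\<close>. The names of the inverse pairs \<open>e, f\<close>, \<open>l, m\<close> and \<open>y, z\<close> are neighbours in the term order, so that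
  AC-rewriting brings a unit next to its inverse.
\<close>

datatype ix = One | Tm2 | Tm1 | T0 | T1 | T2 | Xm2 | Xm1 | X0 | X1 | X2 | Wh

locale model12 =
  fixes a b c d e f l m y z :: "'c::comm_ring_1"
  assumes ef: "e * f = 1" and lm: "l * m = 1" and yz: "y * z = 1"
    and l_quintic: "l ^ 5 = a * l ^ 4 + b * l ^ 3 + c * l ^ 2 + d * l + e"
begin

lemma ef': "e * (f * x) = x" and lm': "l * (m * x) = x" and yz': "y * (z * x) = x"
  by (simp_all add: ef lm yz flip: mult.assoc)

lemmas unit_simps = ef lm yz ef' lm' yz'

definition "Dm3 = f \<cdot> (bas X0 - (a*z*m) \<cdot> bas Tm1 - (b*z) \<cdot> bas One - (c*l) \<cdot> bas T1 - (d*y*l) \<cdot> bas X1)"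
definition "Dm3s = f \<cdot> (bas X1 - (a*z*m) \<cdot> bas T0 - (b*z*l) \<cdot> bas One - (c*l) \<cdot> bas T2 - (d*y*l) \<cdot> bas X2)"
definition "Dm3si = f \<cdot> (bas Xm1 - (a*z*m) \<cdot> bas Tm2 - (b*z*m) \<cdot> bas One - (c*l) \<cdot> bas T0 - (d*y*l) \<cdot> bas X0)"
definition "D3s = a \<cdot> bas X1 + (b*z*m) \<cdot> bas T0 + (c*z*l) \<cdot> bas One + (d*l) \<cdot> bas T2 + (e*y*l) \<cdot> bas X2"
definition "D3 = a \<cdot> bas X0 + (b*z*m) \<cdot> bas Tm1 + (c*z) \<cdot> bas One + (d*l) \<cdot> bas T1 + (e*y*l) \<cdot> bas X1"
definition "T3 = a \<cdot> bas T2 + b \<cdot> bas T1 + c \<cdot> bas T0 + d \<cdot> bas Tm1 + e \<cdot> bas Tm2"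
definition "X3 = a \<cdot> bas X2 + b \<cdot> bas X1 + c \<cdot> bas X0 + d \<cdot> bas Xm1 + e \<cdot> bas Xm2"
definition "Tm3 = f \<cdot> (bas T2 - a \<cdot> bas T1 - b \<cdot> bas T0 - c \<cdot> bas Tm1 - d \<cdot> bas Tm2)"
definition "Xm3 = f \<cdot> (bas X2 - a \<cdot> bas X1 - b \<cdot> bas X0 - c \<cdot> bas Xm1 - d \<cdot> bas Xm2)"
definition "Lh = - (f*f) \<cdot> ((b*z*z*z*m*m*m) \<cdot> bas T0 + (c*z*z*l) \<cdot> bas T1 + (d*z) \<cdot> D3s)
   - f \<cdot> ((a*z*z*m) \<cdot> Dm3 + (b*z*z*m) \<cdot> bas Tm1 + (c*z) \<cdot> T3) - (a*z*m) \<cdot> Dm3s - (d*f*f*f*z*z*m) \<cdot> D3s"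
definition "W = bas Wh + (a*z*m) \<cdot> Dm3 - (d*f) \<cdot> D3s"

text \<open>The rows copy the products with s found in the spanning part. Left multiplication
  commutes with right multiplication, so a power of s standing on the left is replaced by the same
  power of the scalar \<open>l\<close>, and s^-1 by \<open>m\<close>. The last row is
  \<open>Wh_s\<close>.\<close>

fun S_row :: "ix \<Rightarrow> ix \<Rightarrow>\<^sub>0 'c" where
  "S_row One = l \<cdot> bas One"
| "S_row Tm2 = bas Tm1" | "S_row Tm1 = bas T0" | "S_row T0 = bas T1" | "S_row T1 = bas T2" | "S_row T2 = T3"
| "S_row Xm2 = bas Xm1" | "S_row Xm1 = bas X0" | "S_row X0 = bas X1" | "S_row X1 = bas X2" | "S_row X2 = X3"
| "S_row Wh = (f*f*z*z*m) \<cdot> bas Wh + Lh"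

fun Si_row0 :: "ix \<Rightarrow> ix \<Rightarrow>\<^sub>0 'c" where
  "Si_row0 One = m \<cdot> bas One"
| "Si_row0 Tm2 = Tm3" | "Si_row0 Tm1 = bas Tm2" | "Si_row0 T0 = bas Tm1" | "Si_row0 T1 = bas T0" | "Si_row0 T2 =
    bas T1"
| "Si_row0 Xm2 = Xm3" | "Si_row0 Xm1 = bas Xm2" | "Si_row0 X0 = bas Xm1" | "Si_row0 X1 = bas X0" | "Si_row0 X2 =
    bas X1"
| "Si_row0 Wh = 0"

text \<open>The inverse of \<open>S\<close> is found in two stages: \<open>Lh\<close> has no
  \<open>Wh\<close> coordinate, so its preimage needs only the rows of the other eleven vectors, and
  the row of \<open>Wh\<close> is then solved from \<open>S_row Wh\<close>.\<close>

definition "Lhi = lin Si_row0 Lh"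

definition "Si_row k = (if k = Wh then (e*e*y*y*l) \<cdot> (bas Wh - Lhi) else Si_row0 k)"

fun T_row :: "ix \<Rightarrow> ix \<Rightarrow>\<^sub>0 'c" where
  "T_row One = bas T0" | "T_row T0 = z \<cdot> bas One"
| "T_row T1 = (z*m) \<cdot> bas Tm1" | "T_row Tm1 = l \<cdot> bas T1" | "T_row T2 = bas X0" | "T_row X0 = z \<cdot> bas T2"
| "T_row Tm2 = (y*l) \<cdot> bas X1" | "T_row X1 = (z*z*m) \<cdot> bas Tm2"
| "T_row Xm1 = D3s" | "T_row X2 = (z*z*m) \<cdot> Dm3si"
| "T_row Xm2 = W" | "T_row Wh = z \<cdot> (bas Xm2 - (a*z*m) \<cdot> Tm3 + (d*f) \<cdot> bas Xm1)"

abbreviation "S \<equiv> lin S_row"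
abbreviation "Si \<equiv> lin Si_row"
abbreviation "T \<equiv> lin T_row"

lemma Si_row_simps [simp]: "Si_row One = m \<cdot> bas One"
 "Si_row Tm2 = Tm3" "Si_row Tm1 = bas Tm2" "Si_row T0 = bas Tm1" "Si_row T1 = bas T0" "Si_row T2 = bas T1"
 "Si_row Xm2 = Xm3" "Si_row Xm1 = bas Xm2" "Si_row X0 = bas Xm1" "Si_row X1 = bas X0" "Si_row X2 = bas X1"
 "Si_row Wh = (e*e*y*y*l) \<cdot> (bas Wh - Lhi)"
  by (simp_all add: Si_row_def)

section \<open>Inverses and the braid relation\<close>

lemmas vec_simps = lin_simps pscale.scale_right_distrib pscale.scale_right_diff_distrib pscale.scale_minus_right

lemma ix_eqI:
  assumes "Poly_Mapping.lookup v One = Poly_Mapping.lookup w One"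
    "Poly_Mapping.lookup v Tm2 = Poly_Mapping.lookup w Tm2" "Poly_Mapping.lookup v Tm1 = Poly_Mapping.lookup w Tm1"
    "Poly_Mapping.lookup v T0 = Poly_Mapping.lookup w T0" "Poly_Mapping.lookup v T1 = Poly_Mapping.lookup w T1"
    "Poly_Mapping.lookup v T2 = Poly_Mapping.lookup w T2"
    "Poly_Mapping.lookup v Xm2 = Poly_Mapping.lookup w Xm2" "Poly_Mapping.lookup v Xm1 = Poly_Mapping.lookup w Xm1"
    "Poly_Mapping.lookup v X0 = Poly_Mapping.lookup w X0" "Poly_Mapping.lookup v X1 = Poly_Mapping.lookup w X1"
    "Poly_Mapping.lookup v X2 = Poly_Mapping.lookup w X2" "Poly_Mapping.lookup v Wh = Poly_Mapping.lookup w Wh"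
  shows "v = w"
proof (rule poly_mapping_eqI)
  show "Poly_Mapping.lookup v k = Poly_Mapping.lookup w k" for k
    by (cases k) (simp_all add: assms)
qed

lemmas coord_simps = lookup_add lookup_minus lookup_uminus lookup_pscale lookup_single

lemma S_Tm3: "S Tm3 = bas Tm2" and Si_T3: "Si T3 = bas T2" and S_Xm3: "S Xm3 = bas Xm2" and Si_X3: "Si X3 = bas X2"
  by (rule ix_eqI; simp add: Tm3_def T3_def Xm3_def X3_def vec_simps coord_simps algebra_simps unit_simps)+

lemma Lh_Wh: "Poly_Mapping.lookup Lh Wh = 0"
  by (simp add: Lh_def D3s_def Dm3_def Dm3s_def T3_def coord_simps)

lemma S_Si_row0: "k \<noteq> Wh \<Longrightarrow> S (Si_row0 k) = bas k" "k \<noteq> Wh \<Longrightarrow> Si (S_row k) = bas k"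
  by (cases k; simp add: lin_scale S_Tm3 Si_T3 S_Xm3 Si_X3 lm mult.commute[of m l])+

lemma S_Lhi: "S Lhi = Lh" and Si_Lh: "Si Lh = Lhi"
proof -
  let ?c = "\<lambda>v. Poly_Mapping.lookup v Wh"
  have 1: "S (lin Si_row0 v) = v - ?c v \<cdot> bas Wh" for v
    by (induction v rule: free_induct)
      (auto simp: vec_simps pscale.scale_left_distrib coord_simps S_Si_row0 when_def)
  have 2: "Si v = lin Si_row0 v + ?c v \<cdot> Si_row Wh" for v
  proof (induction v rule: free_induct)
    case (bas k)
    show ?case by (cases k) (simp_all add: coord_simps)
  qed (simp_all add: lin_simps pscale.scale_right_distrib pscale.scale_left_distrib lookup_add del: Si_row_simps)
  show "S Lhi = Lh" "Si Lh = Lhi" by (simp_all add: Lhi_def 1 2 Lh_Wh)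
qed

lemma S_Si: "S (Si v) = v"
proof (induction v rule: free_induct)
  case (bas k)
  show ?case
    by (cases k) (simp_all add: vec_simps S_Tm3 S_Xm3 S_Lhi unit_simps algebra_simps)
qed (simp_all add: vec_simps)

lemma Si_S: "Si (S v) = v"
proof (induction v rule: free_induct)
  case (bas k)
  show ?case
    by (cases k) (simp_all add: vec_simps Si_T3 Si_X3 Si_Lh unit_simps algebra_simps)
qed (simp_all add: vec_simps)

lemma T_Tm3: "T Tm3 = Dm3"
  by (rule ix_eqI; simp add: Tm3_def Dm3_def vec_simps coord_simps algebra_simps unit_simps)

lemma T_Dm3: "T Dm3 = z \<cdot> Tm3"
  by (rule ix_eqI; simp add: Tm3_def Dm3_def vec_simps coord_simps algebra_simps unit_simps)

lemma T_D3s: "T D3s = z \<cdot> bas Xm1"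
  by (rule ix_eqI; simp add: D3s_def Dm3si_def vec_simps coord_simps algebra_simps unit_simps)

lemma T_D3: "T D3 = z \<cdot> T3" and Si_D3s: "Si D3s = D3"
  by (rule ix_eqI; simp add: D3_def D3s_def T3_def vec_simps coord_simps algebra_simps unit_simps)+

lemma T_Dm3si: "T Dm3si = (y*l) \<cdot> bas X2"
  by (rule ix_eqI; simp add: D3s_def Dm3si_def vec_simps coord_simps algebra_simps unit_simps)

lemma T_T: "T (T v) = z \<cdot> v"
proof (induction v rule: free_induct)
  case (bas k)
  show ?case
    by (cases k) (simp_all add: vec_simps W_def T_Tm3 T_Dm3 T_D3s unit_simps algebra_simps T_Dm3si)
qed (simp_all add: vec_simps mult.commute)

lemma T_cancel: "T v = T w \<Longrightarrow> v = w"
proof -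
  assume "T v = T w"
  then have "y \<cdot> T (T v) = y \<cdot> T (T w)" by simp
  then show ?thesis by (simp add: T_T yz)
qed

lemma S_cancel: "S v = S w \<Longrightarrow> v = w"
  by (metis Si_S)

lemma T_T3: "T T3 = D3" and S_D3: "S D3 = D3s"
  using T_D3s by (metis T_D3 T_T T_cancel lin_scale, metis S_Si Si_D3s)

definition "Y v = Si (T v)"

lemma Y_simps: "Y (v + w) = Y v + Y w" "Y (r \<cdot> v) = r \<cdot> Y v" "Y (v - w) = Y v - Y w"
  by (simp_all add: Y_def lin_simps)

text \<open>\<open>Y\<close> is right multiplication by \<open>t s^-1\<close>, whose cube in the
  braid group is t^2. This is the presentation of B3 by a square and a cube that agree.\<close>

lemma braid_iff: "T (Si (T v)) = S (T (S v)) \<longleftrightarrow> Y (Y (Y v)) = z \<cdot> v"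
proof
  assume "T (Si (T v)) = S (T (S v))"
  then show "Y (Y (Y v)) = z \<cdot> v"
    by (simp add: Y_def Si_S T_T lin_scale)
next
  assume "Y (Y (Y v)) = z \<cdot> v"
  then have "S (Y (Y (Y v))) = T (T (S v))"
    by (simp add: T_T lin_scale)
  then have "Y (Y v) = T (S v)"
    using T_cancel by (simp add: Y_def S_Si)
  then show "T (Si (T v)) = S (T (S v))"
    by (metis Y_def S_Si)
qed

lemma braid_X2: "T (Si (T (bas X2))) = S (T (S (bas X2)))"
  apply (simp add: vec_simps Dm3si_def X3_def W_def Lh_def Lhi_def)
  apply (rule ix_eqI; simp add: D3s_def T3_def Dm3s_def Dm3_def Tm3_def vec_simps coord_simps algebra_simps
      unit_simps)
  done

text \<open>
  The vectors on which the braid relation holds form a subspace stable under \<open>Y\<close>, so four vectors have to be checked.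
\<close>

lemma braid: "T (Si (T v)) = S (T (S v))"
proof -
  define E where "E = {v. Y (Y (Y v)) = z \<cdot> v}"
  have E: "pscale.subspace E"
    by (auto simp: pscale.subspace_def E_def Y_simps pscale.scale_right_distrib mult.commute Y_def[of 0])
  note [intro] = pscale.subspace_add[OF E] pscale.subspace_diff[OF E] pscale.subspace_scale[OF E]
  have Y: "Y v \<in> E" if "v \<in> E" for v
    using that by (simp add: E_def Y_simps)
  have unit: "v \<in> E" if "r \<cdot> v \<in> E" "r' * r = 1" for r r' v
    using pscale.subspace_scale[OF E that(1), of r'] that(2) by simp
  have orbit: "v \<in> E \<Longrightarrow> r \<cdot> w = Y v \<Longrightarrow> r' * r = 1 \<Longrightarrow> w \<in> E" for v w r r'
    using Y[of v] by (metis unit)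
  have One: "bas One \<in> E" and T1: "bas T1 \<in> E" and T2: "bas T2 \<in> E"
    by (simp_all add: E_def Y_def lin_scale unit_simps algebra_simps Si_D3s T_D3 Si_T3)
  have X2: "bas X2 \<in> E"
    using braid_X2 unfolding E_def by (simp only: braid_iff mem_Collect_eq)
  have Tm1: "bas Tm1 \<in> E"
    using Y[OF One] by (simp add: Y_def)
  have T0: "bas T0 \<in> E"
    by (rule orbit[OF Tm1, of l _ m]) (simp_all add: Y_def lin_scale lm mult.commute[of m l])
  have Tm2: "bas Tm2 \<in> E"
    by (rule orbit[OF T1, of "z*m" _ "y*l"]) (simp_all add: Y_def lin_scale unit_simps algebra_simps)
  have X0: "bas X0 \<in> E"
    by (rule orbit[OF Tm2, of "y*l" _ "z*m"]) (simp_all add: Y_def lin_scale unit_simps algebra_simps)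
  have Xm1: "bas Xm1 \<in> E"
    using Y[OF T2] by (simp add: Y_def)
  have "D3 \<in> E"
    using Y[OF Xm1] by (simp add: Y_def Si_D3s)
  moreover have "(e*y*l) \<cdot> bas X1 = D3 - (a \<cdot> bas X0 + (b*z*m) \<cdot> bas Tm1 + (c*z) \<cdot> bas One + (d*l) \<cdot> bas T1)"
    by (simp add: D3_def)
  ultimately have "(e*y*l) \<cdot> bas X1 \<in> E"
    using X0 Tm1 One T1
    by (simp only:) (intro pscale.subspace_diff[OF E] pscale.subspace_add[OF E] pscale.subspace_scale[OF E])
  then have X1: "bas X1 \<in> E"
    by (rule unit[of _ _ "f*z*m"]) (simp add: unit_simps algebra_simps)
  have "Tm3 \<in> E"
    using Tm2 Tm1 T0 T1 T2 unfolding Tm3_def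
    by (intro pscale.subspace_diff[OF E] pscale.subspace_scale[OF E])
  \<comment> \<open>The scalar inverts the coefficient of \<open>bas Xm2\<close> in
    \<open>Y (bas X2)\<close>, so that all other terms are already in \<open>E\<close>.\<close>
  have "(y*y*l*e) \<cdot> Y (bas X2) \<in> E"
    using Y[OF X2] by auto
  moreover have "(y*y*l*e) \<cdot> Y (bas X2) = bas Xm2 - ((a*z*m) \<cdot> Tm3 + (b*z*m*m) \<cdot> bas One + (c*l) \<cdot> bas Tm1 +
      (d*y*l) \<cdot> bas Xm1)"
    by (rule ix_eqI; simp add: Y_def Tm3_def Dm3si_def vec_simps coord_simps algebra_simps unit_simps)
  ultimately have "bas Xm2 - ((a*z*m) \<cdot> Tm3 + (b*z*m*m) \<cdot> bas One + (c*l) \<cdot> bas Tm1 + (d*y*l) \<cdot> bas Xm1) +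
      ((a*z*m) \<cdot> Tm3 + (b*z*m*m) \<cdot> bas One + (c*l) \<cdot> bas Tm1 + (d*y*l) \<cdot> bas Xm1) \<in> E"
    using \<open>Tm3 \<in> E\<close> One Tm1 Xm1 by (intro pscale.subspace_add[OF E] pscale.subspace_scale[OF E]) auto
  then have Xm2: "bas Xm2 \<in> E"
    by simp
  have Wh0: "v - Poly_Mapping.lookup v Wh \<cdot> bas Wh \<in> E" for v
  proof (induction v rule: free_induct)
    case (bas k)
    show ?case
      using One Tm2 Tm1 T0 T1 T2 Xm2 Xm1 X0 X1 X2 pscale.subspace_0[OF E] by (cases k) (simp_all add: coord_simps)
  next
    case (scale r v)
    from pscale.subspace_scale[OF E this, of r] show ?case by (simp add: vec_simps)
  next
    case (add v w)
    then have "(v - Poly_Mapping.lookup v Wh \<cdot> bas Wh) + (w - Poly_Mapping.lookup w Wh \<cdot> bas Wh) \<in> E" by blast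
    then show ?case by (simp add: lookup_add pscale.scale_left_distrib algebra_simps)
  qed
  \<comment> \<open>\<open>bas Wh\<close> occurs in \<open>Y (bas Xm2)\<close> with a unit as
    coefficient; with the remaining coordinates settled by \<open>Wh0\<close>, it can be
    isolated.\<close>
  have "Poly_Mapping.lookup (Y (bas Xm2)) Wh = e*e*y*y*l"
    by (simp add: Y_def W_def Dm3_def D3s_def Lhi_def Lh_def Dm3s_def T3_def Tm3_def Xm3_def X3_def vec_simps
        coord_simps)
  then have "(e*e*y*y*l) \<cdot> bas Wh \<in> E"
    using pscale.subspace_diff[OF E Y[OF Xm2] Wh0[of "Y (bas Xm2)"]] by simp
  then have Wh: "bas Wh \<in> E"
    by (rule unit[of _ _ "f*f*z*z*m"]) (simp add: unit_simps algebra_simps)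
  have "(v - Poly_Mapping.lookup v Wh \<cdot> bas Wh) + Poly_Mapping.lookup v Wh \<cdot> bas Wh \<in> E"
    using Wh0 Wh by blast
  then show ?thesis
    by (simp add: E_def braid_iff)
qed

lemma T_S_T: "T (S (T v)) = z \<cdot> Si (T (Si v))"
proof -
  have "S (T (S (T (S (T v))))) = z \<cdot> z \<cdot> v"
    using braid[of "T (S (T v))"] by (simp add: T_T lin_scale Si_S)
  then have "T (S (T (S (T v)))) = z \<cdot> z \<cdot> Si v"
    by (metis Si_S lin_scale)
  then have "y \<cdot> T (T (S (T (S (T v))))) = y \<cdot> T (z \<cdot> z \<cdot> Si v)"
    by simp
  then have "S (T (S (T v))) = z \<cdot> T (Si v)"
    by (simp add: T_T lin_scale yz')
      (simp add: yz)
  then show ?thesis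
    by (metis Si_S lin_scale)
qed

section \<open>The defect of the quintic relation and the submodule generated by
  \<open>q\<close>\<close>

definition "P v = S (S (S v)) - (a \<cdot> S (S v) + b \<cdot> S v + c \<cdot> v + d \<cdot> Si v + e \<cdot> Si (Si v))"

definition "q = P (bas Wh)"
abbreviation (input) "\<mu> \<equiv> f*f*z*z*m"
abbreviation (input) "\<nu> \<equiv> e*e*y*y*l"

lemma P_simps: "P (v + w) = P v + P w" "P (r \<cdot> v) = r \<cdot> P v" "P (S v) = S (P v)"
  by (simp_all add: P_def vec_simps algebra_simps S_Si Si_S)

text \<open>\<open>P\<close> commutes with \<open>S\<close>, so one vector in each chain of
  \<open>S\<close> decides. On \<open>One\<close> the relation is the equation for l; on
  \<open>T0\<close> and \<open>X0\<close> it holds by the choice of \<open>T3\<close> and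
  \<open>X3\<close>.\<close>

lemma P_bas: "k \<noteq> Wh \<Longrightarrow> P (bas k) = 0"
proof -
  have "l*l*l = (l*l*l*l*l)*m*m"
    by (simp add: unit_simps mult.assoc)
  also have "l*l*l*l*l = a*(l*l*l*l) + b*(l*l*l) + c*(l*l) + d*l + e"
    using l_quintic by (simp add: eval_nat_numeral mult.assoc)
  finally have "l*l*l = a*l*l + b*l + c + d*m + e*m*m"
    by (simp add: algebra_simps unit_simps)
  then have One: "P (bas One) = 0"
    by (intro poly_mapping_eqI) (simp add: P_def vec_simps coord_simps when_def algebra_simps)
  have T: "P (bas T0) = 0" "P (bas X0) = 0"
    by (simp_all add: P_def T3_def X3_def vec_simps)
  have Si: "P v = 0" if "P (S v) = 0" for v
    using that by (metis P_simps(3) S_cancel lin_zero)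
  have S: "P (S v) = 0" if "P v = 0" for v
    using that by (simp add: P_simps)
  show "k \<noteq> Wh \<Longrightarrow> P (bas k) = 0"
    using One T S[OF T(1)] S[OF S[OF T(1)]] S[OF T(2)] S[OF S[OF T(2)]] Si[of "bas Tm1"] Si[of "bas Xm1"] Si[of
        "bas Tm2"] Si[of "bas Xm2"]
    by (cases k) simp_all
qed

lemma P_eq: "P v = Poly_Mapping.lookup v Wh \<cdot> q"
proof (induction v rule: free_induct)
  case (bas k)
  show ?case by (cases "k = Wh") (simp_all add: q_def P_bas lookup_single)
qed (simp_all add: P_simps lookup_add pscale.scale_left_distrib)

text \<open>\<open>P\<close> sees only the \<open>Wh\<close> coordinate, and \<mu> is that
  coordinate of \<open>S (bas Wh)\<close>.\<close>

lemma S_q: "S q = \<mu> \<cdot> q"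
proof -
  have "S q = P (S (bas Wh))" by (simp only: q_def P_simps)
  then show ?thesis by (simp add: P_simps P_eq Lh_Wh lookup_add lookup_single)
qed

lemma Si_q: "Si q = \<nu> \<cdot> q"
proof -
  have "S (\<nu> \<cdot> q) = q"
    by (simp add: lin_scale S_q unit_simps algebra_simps)
  then show ?thesis by (metis Si_S)
qed

lemma S3: "S (S (S v)) = a \<cdot> S (S v) + b \<cdot> S v + c \<cdot> v + d \<cdot> Si v + e \<cdot> Si (Si v) + Poly_Mapping.lookup v Wh \<cdot> q"
  by (simp flip: P_eq add: P_def)

lemma Si3: "Si (Si (Si v)) = f \<cdot> (S (S v) - a \<cdot> S v - b \<cdot> v - c \<cdot> Si v - d \<cdot> Si (Si v) - Poly_Mapping.lookup (Si
    v) Wh \<cdot> q)"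
  using S3[of "Si v"] by (simp add: S_Si algebra_simps ef pscale.scale_right_diff_distrib pscale.scale_right_distrib)

lemma S_eq: "S v = a \<cdot> v + b \<cdot> Si v + c \<cdot> Si (Si v) + d \<cdot> Si (Si (Si v)) + e \<cdot> Si (Si (Si (Si v))) +
    Poly_Mapping.lookup v Wh \<cdot> Si (Si q)"
  using arg_cong[OF S3[of v], of "\<lambda>v. Si (Si v)"] by (simp add: Si_S lin_simps)

text \<open>The vector \<open>nrow k\<close> is \<open>q\<close> multiplied by the word for which the basis vector \<open>k\<close> stands.\<close>

fun nrow :: "ix \<Rightarrow> ix \<Rightarrow>\<^sub>0 'c" where
  "nrow One = q"
| "nrow Tm2 = Si (Si (T q))" | "nrow Tm1 = Si (T q)" | "nrow T0 = T q" | "nrow T1 = S (T q)" | "nrow T2 = S (S (T q))"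
| "nrow Xm2 = Si (Si (T (S (S (T q)))))" | "nrow Xm1 = Si (T (S (S (T q))))" | "nrow X0 = T (S (S (T q)))"
| "nrow X1 = S (T (S (S (T q))))" | "nrow X2 = S (S (T (S (S (T q)))))" | "nrow Wh = T (Si (Si (T (S (S (T q))))))"

text \<open>Stability of \<open>N\<close> is shown in two stages because \<open>N1\<close> is closed
  under \<open>S\<close> and \<open>Si\<close>, while \<open>T\<close> leads to the remaining row,
  from \<open>nrow Xm2\<close>.\<close>

definition "N1 = pscale.span (nrow ` (- {Wh}))"
definition "N = range (lin nrow)"

lemma subspace_N: "pscale.subspace N"
  by (simp add: N_def subspace_range_lin)

lemma nrow_N: "nrow k \<in> N"
  by (simp add: N_def) (metis lin_bas rangeI)

lemma N1_N: "v \<in> N1 \<Longrightarrow> v \<in> N"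
  unfolding N1_def using pscale.span_minimal[OF _ subspace_N] nrow_N by blast

lemma N1_base: "k \<noteq> Wh \<Longrightarrow> nrow k \<in> N1"
  by (auto simp: N1_def intro: pscale.span_base)

lemma N1_combs:
  "v \<in> N1 \<Longrightarrow> w \<in> N1 \<Longrightarrow> v + w \<in> N1" "v \<in> N1 \<Longrightarrow> w \<in> N1 \<Longrightarrow> v - w \<in> N1" "v \<in> N1 \<Longrightarrow> r \<cdot> v \<in> N1"
  by (simp_all add: N1_def pscale.span_add pscale.span_diff pscale.span_scale)

lemma N1_gens: "q \<in> N1"
  "Si (Si (T q)) \<in> N1" "Si (T q) \<in> N1" "T q \<in> N1" "S (T q) \<in> N1" "S (S (T q)) \<in> N1"
  "Si (Si (T (S (S (T q))))) \<in> N1" "Si (T (S (S (T q)))) \<in> N1" "T (S (S (T q))) \<in> N1"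
  "S (T (S (S (T q)))) \<in> N1" "S (S (T (S (S (T q))))) \<in> N1"
  using N1_base[of One] N1_base[of Tm2] N1_base[of Tm1] N1_base[of T0] N1_base[of T1] N1_base[of T2]
    N1_base[of Xm2] N1_base[of Xm1] N1_base[of X0] N1_base[of X1] N1_base[of X2] by simp_all

lemmas N1_intros = N1_combs N1_gens

lemma lin_N1:
  assumes "v \<in> N1" "pscale.subspace A" "\<And>k. k \<noteq> Wh \<Longrightarrow> lin M (nrow k) \<in> A"
  shows "lin M v \<in> A"
proof -
  have "pscale.subspace {v. lin M v \<in> A}"
    using assms(2) by (auto simp: pscale.subspace_def lin_simps)
  moreover have "nrow ` (- {Wh}) \<subseteq> {v. lin M v \<in> A}"
    by (rule image_subsetI) (simp add: assms(3))
  ultimately have "N1 \<subseteq> {v. lin M v \<in> A}"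
    unfolding N1_def by (rule pscale.span_minimal[rotated])
  with assms(1) show ?thesis by (rule subsetD[THEN CollectD, rotated])
qed

lemma subspace_N1: "pscale.subspace N1"
  by (simp add: N1_def)

text \<open>At the end of a chain the quintic \<open>S3\<close> leads back into it; its defect is a
  multiple of \<open>q\<close>, hence in \<open>N1\<close>.\<close>

lemma S_N1: "v \<in> N1 \<Longrightarrow> S v \<in> N1"
  by (erule lin_N1[OF _ subspace_N1], rename_tac k, case_tac k)
    (auto simp: S_q S_Si S3 intro!: N1_intros)

lemma Si_N1: "v \<in> N1 \<Longrightarrow> Si v \<in> N1"
  by (erule lin_N1[OF _ subspace_N1], rename_tac k, case_tac k)
    (auto simp: Si_q Si_S Si3 intro!: N1_intros)

lemma T_Si2_T: "T (Si (Si (T v))) = y \<cdot> S (T (S (S (T (S v)))))"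
proof -
  have "z \<cdot> T (Si (Si (T v))) = S (T (S (S (T (S v)))))"
    using braid[of "T (Si (T v))"] by (simp only: T_T lin_scale) (simp only: braid)
  then have "y \<cdot> z \<cdot> T (Si (Si (T v))) = y \<cdot> S (T (S (S (T (S v)))))"
    by simp
  then show ?thesis by (simp add: yz)
qed

lemma T_t_N1:
  "T (Si (Si (T q))) \<in> N1" "T (Si (T q)) \<in> N1" "T (T q) \<in> N1" "T (S (T q)) \<in> N1" "T (S (S (T q))) \<in> N1"
  by (auto simp: T_Si2_T braid T_T T_S_T S_q Si_q lin_simps intro!: N1_intros)

lemma T_S3_N1: "T (S (S (S (T q)))) \<in> N1" "T (Si (Si (Si (T q)))) \<in> N1"
  by (auto simp: S3 Si3 lin_simps intro!: N1_combs N1_gens T_t_N1)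

lemma T_Sx: "T (Si (T (S (S (T q))))) = S (T (S (S (S (T q)))))"
  "T (S (T (S (S (T q))))) = (z*z*\<nu>) \<cdot> Si (Si (T q))"
  "T (S (S (T (S (S (T q)))))) = (z*z*\<nu>) \<cdot> Si (T (Si (Si (Si (T q)))))"
proof -
  show "T (Si (T (S (S (T q))))) = S (T (S (S (S (T q)))))"
    by (rule braid)
  show "T (S (T (S (S (T q))))) = (z*z*\<nu>) \<cdot> Si (Si (T q))"
    by (simp add: T_S_T Si_S Si_q lin_scale mult.assoc)
  have "T (S (S (T (S (S (T q)))))) = T (S (T (Si (T (S (T q))))))"
    by (simp only: braid)
  also have "\<dots> = (z*z*\<nu>) \<cdot> Si (T (Si (Si (Si (T q)))))"
    by (simp add: T_S_T Si_q lin_scale ac_simps)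
  finally show "T (S (S (T (S (S (T q)))))) = (z*z*\<nu>) \<cdot> Si (T (Si (Si (Si (T q)))))" .
qed

lemma T_N1: "v \<in> N1 \<Longrightarrow> T v \<in> N"
proof (erule lin_N1[OF _ subspace_N])
  fix k :: ix
  assume "k \<noteq> Wh"
  moreover have "T (nrow k) \<in> N1" if "k \<noteq> Wh" "k \<noteq> Xm2"
    using that T_t_N1 S_N1[OF T_S3_N1(1)] Si_N1[OF T_S3_N1(2)] 
    by (cases k) (auto simp: T_Sx T_T intro!: N1_combs N1_gens)
  ultimately show "T (nrow k) \<in> N"
    using nrow_N[of Wh] by (cases "k = Xm2") (auto intro: N1_N)
qed

lemma lin_N: "v \<in> N \<Longrightarrow> (\<And>k. lin M (nrow k) \<in> N) \<Longrightarrow> lin M v \<in> N"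
proof -
  assume "v \<in> N" and M: "\<And>k. lin M (nrow k) \<in> N"
  then obtain w where "v = lin nrow w" by (auto simp: N_def)
  moreover have "lin (\<lambda>k. lin M (nrow k)) w \<in> N"
    by (rule lin_in_subspace[OF subspace_N M])
  ultimately show ?thesis by (simp add: lin_lin)
qed

lemma T_N:
  assumes "v \<in> N" shows "T v \<in> N"
proof (rule lin_N[OF assms])
  show "T (nrow k) \<in> N" for k
  proof (cases "k = Wh")
    case True
    then show ?thesis
      using N1_N[OF N1_gens(7)] pscale.subspace_scale[OF subspace_N] by (simp add: T_T)
  qed (simp add: N1_base T_N1)
qed

lemma Si_T_Si2_T: "Si (T (Si (Si (T v)))) = y \<cdot> T (S (T (Si (T v))))"
  by (simp add: T_S_T lin_scale yz)

lemma Si_N: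
  assumes "v \<in> N" shows "Si v \<in> N"
proof (rule lin_N[OF assms])
  \<comment> \<open>\<open>Si (nrow Wh)\<close> has the shape \<open>Si T Si^2 T\<close>, which
    \<open>Si_T_Si2_T\<close> turns into \<open>T S\<close> applied to this vector of
    \<open>N1\<close>.\<close>
  have "T (Si (T (S (S (T q))))) \<in> N1"
    by (auto simp: T_Sx intro: S_N1 T_S3_N1)
  then have "Si (nrow Wh) \<in> N"
    using pscale.subspace_scale[OF subspace_N] T_N1[OF S_N1] by (simp add: Si_T_Si2_T)
  then show "Si (nrow k) \<in> N" for k
    by (cases "k = Wh") (simp_all add: N1_N Si_N1 N1_base del: nrow.simps)
qed

text \<open>\<open>S_eq\<close> expresses \<open>S\<close> through powers of \<open>Si\<close> and a
  multiple of \<open>Si (Si q)\<close>, so stability under \<open>Si\<close> is enough.\<close>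

lemma S_N: "v \<in> N \<Longrightarrow> S v \<in> N"
  by (subst S_eq) (intro pscale.subspace_add[OF subspace_N] pscale.subspace_scale[OF subspace_N] Si_N N1_N[OF
      N1_gens(1)])

lemma braid_ops: "braid_ops S Si (\<lambda>v. Si (T (Si v))) (\<lambda>v. y \<cdot> S (T (S v)))"
proof
  show "S (Si v) = v" "Si (S v) = v" for v
    by (rule S_Si, rule Si_S)
  show "Si (T (Si (y \<cdot> S (T (S v))))) = v" "y \<cdot> S (T (S (Si (T (Si v))))) = v" for v
    by (simp_all add: lin_scale S_Si Si_S T_T yz)
  show "S (Si (T (Si (S v)))) = Si (T (Si (S (Si (T (Si v))))))" for v
    by (simp add: S_Si Si_S braid)
qed

section \<open>Change of parameters and the case a = b = c = d = 0\<close>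

lemma model12_hom:
  fixes h :: "'c \<Rightarrow> 'd::comm_ring_1"
  assumes "ring_hom h"
  shows "model12 (h a) (h b) (h c) (h d) (h e) (h f) (h l) (h m) (h y) (h z)"
proof -
  interpret ring_hom h by fact
  show ?thesis
  proof
    show "h e * h f = 1" "h l * h m = 1" "h y * h z = 1"
      by (simp_all add: ef lm yz hom_1 flip: hom_mult)
    show "h l ^ 5 = h a * h l ^ 4 + h b * h l ^ 3 + h c * h l ^ 2 + h d * h l + h e"
      by (simp add: l_quintic flip: hom_mult hom_power hom_add)
  qed
qed

end

locale model12_hom = model12 a b c d e f l m y z + ring_hom h
  for a b c d e f l m y z :: "'c::comm_ring_1" and h :: "'c \<Rightarrow> 'd::comm_ring_1"
begin

sublocale im: model12 "h a" "h b" "h c" "h d" "h e" "h f" "h l" "h m" "h y" "h z"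
  by (intro model12_hom ring_hom_axioms)

lemmas vmap_defs = Dm3_def Dm3s_def Dm3si_def D3s_def T3_def X3_def Tm3_def Xm3_def Lh_def W_def
  im.Dm3_def im.Dm3s_def im.Dm3si_def im.D3s_def im.T3_def im.X3_def im.Tm3_def im.Xm3_def im.Lh_def im.W_def

lemma vmap_rows: "vmap h (S_row k) = im.S_row k" "vmap h (Si_row0 k) = im.Si_row0 k" "vmap h (T_row k) = im.T_row k"
  by (cases k; simp add: vmap_defs vmap_simps hom_simps)+

lemma vmap_ops: "vmap h (S v) = im.S (vmap h v)" "vmap h (T v) = im.T (vmap h v)"
  by (simp_all add: vmap_lin vmap_rows)

lemma vmap_Si: "vmap h (Si v) = im.Si (vmap h v)"
  by (metis S_Si im.Si_S vmap_ops(1))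

lemma vmap_nrow: "vmap h (nrow k) = im.nrow k"
proof -
  have "vmap h (P v) = im.P (vmap h v)" for v
    by (simp add: P_def im.P_def vmap_simps vmap_ops vmap_Si)
  then have "vmap h q = im.q"
    by (simp add: q_def im.q_def vmap_simps)
  then show ?thesis
    by (cases k) (simp_all add: vmap_ops vmap_Si)
qed

end

text \<open>The involution that exchanges opposite vertices of the icosahedron: multiplying the word
  of a basis vector by that of \<open>Wh\<close> moves it to the opposite one.\<close>

fun perm :: "ix \<Rightarrow> ix" where
  "perm One = Wh" | "perm Tm2 = X1" | "perm Tm1 = X2" | "perm T0 = Xm2" | "perm T1 = Xm1" | "perm T2 = X0"
| "perm Xm2 = T0" | "perm Xm1 = T1" | "perm X0 = T2" | "perm X1 = Tm2" | "perm X2 = Tm1" | "perm Wh = One"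

locale model12_0 = model12 0 0 0 0 e f l m y z for e f l m y z :: "'c::comm_ring_1"
begin

lemma e_l: "e = l ^ 5" and f_m: "f = m ^ 5"
proof -
  show e: "e = l ^ 5" using l_quintic by simp
  have "m ^ 5 * (e * f) = f * (l * m) ^ 5"
    unfolding e by (simp add: power_mult_distrib)
  then show "f = m ^ 5" by (simp add: ef lm)
qed

text \<open>Here \<open>bas Wh\<close> is an eigenvector of \<open>S\<close> with eigenvalue
  \<open>m^11 z^2\<close>, so \<open>P\<close> multiplies it by \<open>m^33 z^6 - l^27 y^4\<close>.
  The exponent 60 is 33 + 27, and ten is 6 + 4.\<close>

lemma q_0: "q = (m ^ 33 * y ^ 4 * (z ^ 10 - l ^ 60)) \<cdot> bas Wh"
proof -
  have "Lh = 0" "Lhi = 0" by (simp_all add: Lh_def Lhi_def)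
  then have "q = (f*f*z*z*m * (f*f*z*z*m) * (f*f*z*z*m) - e * ((e*e*y*y*l) * (e*e*y*y*l))) \<cdot> bas Wh"
    by (simp add: q_def P_def vec_simps pscale.scale_left_diff_distrib mult.assoc)
  also have "f*f*z*z*m * (f*f*z*z*m) * (f*f*z*z*m) - e * ((e*e*y*y*l) * (e*e*y*y*l)) = m ^ 33 * y ^ 4 * (z ^ 10
      - l ^ 60)"
  proof -
    have "m ^ 33 * y ^ 4 * (z ^ 10 - l ^ 60) = m ^ 33 * (y * z) ^ 4 * z ^ 6 - (l * m) ^ 33 * l ^ 27 * y ^ 4"
      by (simp add: algebra_simps power_mult_distrib flip: power_add)
    also have "\<dots> = m ^ 33 * z ^ 6 - l ^ 27 * y ^ 4"
      by (simp add: yz lm)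
    also have "\<dots> = f*f*z*z*m * (f*f*z*z*m) * (f*f*z*z*m) - e * ((e*e*y*y*l) * (e*e*y*y*l))"
      by (simp add: e_l f_m algebra_simps eval_nat_numeral)
    finally show ?thesis by simp
  qed
  finally show ?thesis .
qed

lemma nrow_0: "\<exists>u u'. u * u' = 1 \<and> nrow k = ((z ^ 10 - l ^ 60) * u) \<cdot> bas (perm k)"
proof -
  define \<theta> where "\<theta> = z ^ 10 - l ^ 60"
  define u where "u = m ^ 33 * y ^ 4"
  have u: "u * (l ^ 33 * z ^ 4) = 1"
  proof -
    have "u * (l ^ 33 * z ^ 4) = (l * m) ^ 33 * (y * z) ^ 4"
      unfolding u_def power_mult_distrib by (simp only: ac_simps)
    then show ?thesis by (simp add: lm yz)
  qed
  have q: "q = (\<theta> * u) \<cdot> bas Wh"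
    by (simp add: q_0 \<theta>_def u_def mult.commute)
  have unit: "\<exists>u'. u * (v * u') = 1" if "v * v' = 1" for v v'
    using u that by (metis mult.assoc mult.left_commute mult_1_right)
  \<comment> \<open>The unit collected from the rows along the word of each vector, paired with its
    inverse.\<close>
  define coef where "coef = (\<lambda>k. case k of One \<Rightarrow> (1, 1) | Tm2 \<Rightarrow> (f*z, e*y) | Tm1 \<Rightarrow> (f*z, e*y) | T0 \<Rightarrow> (z, y) | T1
      \<Rightarrow> (z, y) | T2 \<Rightarrow> (z, y)
    | Xm2 \<Rightarrow> (z*z, y*y) | Xm1 \<Rightarrow> (z*z, y*y) | X0 \<Rightarrow> (z*z, y*y) | X1 \<Rightarrow> (e*z*z, f*y*y) | X2 \<Rightarrow> (e*z*z, f*y*y) | Wh \<Rightarrow>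
        (z*z*z, y*y*y))"
  have "nrow k = (\<theta> * (u * fst (coef k))) \<cdot> bas (perm k)" "fst (coef k) * snd (coef k) = 1"
    by (cases k; simp add: coef_def q vec_simps T3_def Xm3_def W_def unit_simps algebra_simps)+
  then show ?thesis
    using unit unfolding \<theta>_def by (metis mult.assoc)
qed

end

subsection \<open>Linear independence\<close>

definition gpow :: "'g::group_add \<Rightarrow> int \<Rightarrow> 'g" where
  "gpow g i = (if 0 \<le> i then ((+) g ^^ nat i) 0 else ((+) (- g) ^^ nat (- i)) 0)"

lemma gpow_0 [simp]: "gpow g 0 = 0"
  by (simp add: gpow_def)

lemma gpow_Suc: "gpow g (i + 1) = g + gpow g i"
proof (cases "0 \<le> i")
  case True
  then show ?thesis by (simp add: gpow_def nat_add_distrib)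
next
  case False
  then obtain n where n: "i = - int (Suc n)" by (metis int_cases2 negD not_le)
  then show ?thesis by (cases n) (simp_all add: gpow_def nat_add_distrib del: add_uminus_conv_diff)
qed

lemma gpow_add: "gpow g (i + j) = gpow g i + gpow g j"
proof (induction i rule: int_induct[where k = 0])
  case (step1 i)
  have "gpow g (i + 1 + j) = g + gpow g (i + j)"
    using gpow_Suc[of g "i + j"] by (simp only: add.commute add.left_commute)
  then show ?case
    by (simp only: step1 gpow_Suc add.assoc)
next
  case (step2 i)
  have "g + gpow g (i - 1 + j) = gpow g (i + j)"
    using gpow_Suc[of g "i - 1 + j"] by (simp add: algebra_simps)
  also have "\<dots> = g + (gpow g (i - 1) + gpow g j)"
    using gpow_Suc[of g "i - 1"] by (simp add: step2 add.assoc)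
  finally show ?case by simp
qed simp

lemma gpow_1 [simp]: "gpow g 1 = g"
  using gpow_Suc[of g 0] by simp

lemma gpow_minus_1 [simp]: "gpow g (- 1) = - g"
  using gpow_Suc[of g "- 1"] by (simp add: minus_unique)

definition "garside = s1 + s2 + s1"

definition basis_lift :: "'r::comm_ring_1 \<Rightarrow> 'r \<Rightarrow> idx \<Rightarrow> (braid3 \<Rightarrow>\<^sub>0 'r)" where
  "basis_lift a f = gen (\<lambda>r x. scalar r * x) a f (\<lambda>i. group_elem (gpow s1 i)) (\<lambda>k. group_elem (gpow (garside +
      garside) k)) (group_elem garside)"

definition relator :: "'r::comm_ring_1 \<Rightarrow> 'r \<Rightarrow> 'r \<Rightarrow> 'r \<Rightarrow> 'r \<Rightarrow> braid3 \<Rightarrow> (braid3 \<Rightarrow>\<^sub>0 'r)" where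
  "relator a b c d e s = group_elem s ^ 5 - (scalar a * group_elem s ^ 4 + scalar b * group_elem s ^ 3 +
      scalar c * group_elem s ^ 2 + scalar d * group_elem s + scalar e)"

fun ix_of :: "int \<Rightarrow> int \<Rightarrow> ix" where
  "ix_of n j = (if n = 0 then One else if n = 3 then Wh
     else if n = 1 then (if j = -2 then Tm2 else if j = -1 then Tm1 else if j = 0 then T0 else if j = 1 then T1
         else T2)
     else (if j = -2 then Xm2 else if j = -1 then Xm1 else if j = 0 then X0 else if j = 1 then X1 else X2))"

fun ix_tag :: "ix \<Rightarrow> int \<times> int" where
  "ix_tag One = (0, 0)" | "ix_tag Tm2 = (1, -2)" | "ix_tag Tm1 = (1, -1)" | "ix_tag T0 = (1, 0)" | "ix_tag T1 =
      (1, 1)" | "ix_tag T2 = (1, 2)"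
| "ix_tag Xm2 = (2, -2)" | "ix_tag Xm1 = (2, -1)" | "ix_tag X0 = (2, 0)" | "ix_tag X1 = (2, 1)" | "ix_tag X2 =
    (2, 2)" | "ix_tag Wh = (3, 0)"

lemma Idx_range:
  assumes "(n, k, i, j) \<in> Idx"
  shows "i \<in> {0..4}" "n = 0 \<and> j = 0 \<or> n = 3 \<and> j = 0 \<or> (n = 1 \<or> n = 2) \<and> j \<in> {-2, -1, 0, 1, 2}"
proof -
  have "{-2..2} = {-2, -1, 0, 1, 2::int}" by auto
  then show "n = 0 \<and> j = 0 \<or> n = 3 \<and> j = 0 \<or> (n = 1 \<or> n = 2) \<and> j \<in> {-2, -1, 0, 1, 2}"
    using assms unfolding Idx_def by simp blast
  show "i \<in> {0..4}" using assms unfolding Idx_def by auto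
qed

lemma ix_tag: "(n, k, i, j) \<in> Idx \<Longrightarrow> ix_tag (ix_of n j) = (n, j)"
  by (drule Idx_range(2)) (elim disjE conjE insertE; simp)

locale model12_action = model12 a b c d e f l m y z + ring_hom h
  for a b c d e f l m y z :: "'c::comm_ring_1" and h :: "'r::comm_ring_1 \<Rightarrow> 'c" +
  fixes a' b' c' d' e' f' :: 'r
  assumes h_params: "h a' = a" "h b' = b" "h c' = c" "h d' = d" "h e' = e" "h f' = f"
begin

sublocale braid_ops S Si "\<lambda>v. Si (T (Si v))" "\<lambda>v. y \<cdot> S (T (S v))"
  by (rule braid_ops)

lemma braid_act_linear: "braid_act g (v + w) = braid_act g v + braid_act g w" "braid_act g (r \<cdot> v) = r \<cdot>
    braid_act g v"
proof -
  have letter: "letter_op x (v + w) = letter_op x v + letter_op x w" "letter_op x (r \<cdot> v) = r \<cdot> letter_op x v"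
      for x v w
    by (cases x rule: letter_op.cases; simp add: vec_simps mult.commute)+
  have "fold letter_op u (v + w) = fold letter_op u v + fold letter_op u w" "fold letter_op u (r \<cdot> v) = r \<cdot> fold
      letter_op u v" for u
    by (induction u arbitrary: v w; simp add: letter)+
  then show "braid_act g (v + w) = braid_act g v + braid_act g w" "braid_act g (r \<cdot> v) = r \<cdot> braid_act g v"
    by (simp_all add: braid_act_def)
qed

sublocale act: algebra_action pscale h braid_act
  by unfold_locales (simp_all add: hom_simps braid_act_linear braid_act_zero braid_act_plus)

abbreviation "act \<equiv> act.act"

lemma braid_act_garside: "braid_act garside v = T v"
  by (simp add: garside_def braid_act_plus braid_act_gens S_Si Si_S)

lemma act_group: "act v (group_elem g) = braid_act g v"
  by (simp add: act.act_single hom_1)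

lemma act_scalar: "act v (scalar r) = h r \<cdot> v"
  by (simp add: act.act_single braid_act_zero)

lemma braid_act_s1_minus: "braid_act (- s1) v = Si v"
proof (rule S_cancel)
  show "S (braid_act (- s1) v) = S (Si v)"
    using braid_act_plus[of "- s1" s1 v] by (simp add: braid_act_gens braid_act_zero S_Si)
qed

lemma act_s_power:
  "braid_act (gpow s1 0) v = v" "braid_act (gpow s1 1) v = S v" "braid_act (gpow s1 2) v = S (S v)" "braid_act
      (gpow s1 3) v = S (S (S v))"
  "braid_act (gpow s1 4) v = S (S (S (S v)))"
  "braid_act (gpow s1 (- 1)) v = Si v" "braid_act (gpow s1 (- 2)) v = Si (Si v)" "braid_act (gpow s1 (- 3)) v =
      Si (Si (Si v))"
  using gpow_add[of s1 1 1] gpow_add[of s1 1 2] gpow_add[of s1 2 2] gpow_add[of s1 "- 1" "- 1"] gpow_add[of s1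
      "- 1" "- 2"]
  by (simp_all add: braid_act_zero braid_act_plus braid_act_gens braid_act_s1_minus del: add_uminus_conv_diff)

lemma act_s_power_One: "0 \<le> i \<Longrightarrow> braid_act (gpow s1 i) (bas One) = l ^ nat i \<cdot> bas One"
proof (induction i rule: int_ge_induct)
  case (step i)
  then have "gpow s1 (i + 1) = gpow s1 i + s1" by (simp add: gpow_add)
  then show ?case using step by (simp add: braid_act_plus braid_act_gens lin_scale nat_add_distrib mult.commute)
qed (simp add: braid_act_zero)

lemma act_z_power: "braid_act (gpow (garside + garside) k) v = ipow z y k \<cdot> v"
proof (induction k rule: int_induct[where k = 0])
  case base
  show ?case by (simp add: braid_act_zero)
next
  case (step1 i)
  then show ?case
    by (simp add: gpow_add braid_act_plus braid_act_garside T_T lin_scale ipow_Suc[of z y] yz mult.commute[of z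
        y] mult.commute[of "ipow z y i" z])
next
  case (step2 i)
  have "gpow (garside + garside) i = gpow (garside + garside) (i - 1) + (garside + garside)"
    using gpow_add[of "garside + garside" "i - 1" 1] by simp
  with step2 have "z \<cdot> braid_act (gpow (garside + garside) (i - 1)) v = ipow z y i \<cdot> v"
    by (simp add: braid_act_plus braid_act_garside T_T)
  also have "ipow z y i = z * ipow z y (i - 1)"
    using ipow_Suc[of z y "i - 1"] by (simp add: yz mult.commute[of z y])
  finally have "(y * z) \<cdot> braid_act (gpow (garside + garside) (i - 1)) v = (y * z) \<cdot> ipow z y (i - 1) \<cdot> v"
    by (simp only: mult.assoc flip: pscale.scale_scale)
  then show ?case by (simp add: yz)
qed

text \<open>In a right action the left factors \<open>z k\<close> and \<open>s i\<close> act first.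
  They meet \<open>bas One\<close>, an eigenvector of both, so they contribute only scalars, and the
  rest of the word leads to a single basis vector.\<close>

lemma act_basis_lift:
  assumes "(n, k, i, j) \<in> Idx"
  shows "act (bas One) (basis_lift a' (d' * f') (n, k, i, j)) = (ipow z y k * l ^ nat i) \<cdot> bas (ix_of n j)"
proof -
  have range: "0 \<le> i" using Idx_range(1)[OF assms] by simp
  note act_simps = basis_lift_def gen_def act.act_mult act.act_add act.act_diff act_group act_scalar braid_act_linear
    act_s_power act_z_power braid_act_garside act_s_power_One[OF range] lin_scale h_params hom_mult
  show ?thesis
    using Idx_range(2)[OF assms] by (elim disjE conjE insertE; simp add: act_simps act.act_one braid_act_gens
        braid_act_s1_minus braid_act_plus W_def vec_simps T_T T_T3 S_D3 T_Tm3 ac_simps)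
qed

lemma act_relator_s1: "act v (relator a' b' c' d' e' s1) = P (S (S v))"
  by (simp add: relator_def P_def act.act_mult act.act_add act.act_diff act_group act_scalar braid_act_gens h_params
      eval_nat_numeral act.act_one Si_S lin_scale)

lemma s2_conj: "Si (T (Si v)) = y \<cdot> T (S (T v))"
  by (simp add: T_S_T yz)

text \<open>s2 is the conjugate z^-1 t s1 t of s1, so its relator acts by the conjugate of the
  defect \<open>P\<close>.\<close>

lemma act_relator_s2: "act v (relator a' b' c' d' e' s2) = y \<cdot> T (P (S (S (T v))))"
proof -
  have s2: "braid_act s2 v = y \<cdot> T (S (T v))" for v
    by (simp only: braid_act_gens) (rule s2_conj)
  have T_yT: "T (y \<cdot> T v) = v" for v
    by (simp add: lin_scale T_T yz)
  show ?thesis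
    by (simp add: relator_def P_def act.act_mult act.act_add act.act_diff act_group act_scalar h_params s2
      eval_nat_numeral act.act_one Si_S T_yT T_T yz)
     (simp add: vec_simps ac_simps T_T unit_simps)
qed

lemma act_ideal_N:
  assumes "x \<in> two_sided_ideal {relator a' b' c' d' e' s1, relator a' b' c' d' e' s2}"
  shows "act v x \<in> N"
proof (rule act.act_ideal[OF subspace_N _ _ assms])
  show "braid_act g v \<in> N" if "v \<in> N" for g v
    by (rule braid_act_induct[where P = "\<lambda>v. v \<in> N"]) (auto intro: S_N Si_N T_N pscale.subspace_scale[OF
        subspace_N] that)
  show "act v r \<in> N" if "r \<in> {relator a' b' c' d' e' s1, relator a' b' c' d' e' s2}" for v r
    using that N1_N[OF N1_gens(1)]
    by (auto simp: act_relator_s1 act_relator_s2 P_eq intro!: pscale.subspace_scale[OF subspace_N] T_N)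
qed

end

section \<open>A graded coefficient ring with a root of the quintic\<close>

notation fps_nth (infixl "$" 75)

lemma single_5_mult: "Poly_Mapping.single (i, j, k, n, p) r * Poly_Mapping.single (i', j', k', n', p') r' =
    (Poly_Mapping.single (i + i', j + j', k + k', n + n', p + p') (r * r') :: r5)"
  by (simp add: mult_single)

lemma r5_powers:
  "r5_a ^ i = Poly_Mapping.single (i, 0, 0, 0, 0) 1" "r5_b ^ i = Poly_Mapping.single (0, i, 0, 0, 0) 1"
  "r5_c ^ i = Poly_Mapping.single (0, 0, i, 0, 0) 1" "r5_d ^ i = Poly_Mapping.single (0, 0, 0, i, 0) 1"
  "r5_e ^ i = Poly_Mapping.single (0, 0, 0, 0, int i) 1" "r5_e' ^ i = Poly_Mapping.single (0, 0, 0, 0, - int i) 1"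
  by (induction i; simp add: r5_a_def r5_b_def r5_c_def r5_d_def r5_e_def r5_e'_def single_5_mult;
      simp add: zero_prod_def flip: single_one)+

text \<open>
  The grading variable \<open>fps_X\<close> records the degree in \<open>a, b, c, d\<close>; over power series in it, the element \<open>e\<close> determined by the
  root \<open>l\<close> is invertible.
\<close>

definition "fl = fps_const r5_e"
definition "fm = fps_const r5_e'"
definition "fa = fps_X * fps_const r5_a"
definition "fb = fps_X * fps_const r5_b"
definition "fc = fps_X * fps_const r5_c"
definition "fd = fps_X * fps_const r5_d"
definition "fe = fl ^ 5 - (fa * fl ^ 4 + fb * fl ^ 3 + fc * fl ^ 2 + fd * fl)"
text \<open>The inverse of \<open>fe\<close> as a geometric series, since \<open>fe\<close> is l^5
  times 1 minus a multiple of \<open>fps_X\<close>.\<close>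

definition "ff = fm ^ 5 * Abs_fps (\<lambda>n. ((r5_a * r5_e ^ 4 + r5_b * r5_e ^ 3 + r5_c * r5_e ^ 2 + r5_d * r5_e) *
    r5_e' ^ 5) ^ n)"

lemma fl_fm: "fl * fm = 1"
  by (simp add: fl_def fm_def r5_e_e')

lemma fe_ff: "fe * ff = 1"
proof -
  define w where "w = (r5_a * r5_e ^ 4 + r5_b * r5_e ^ 3 + r5_c * r5_e ^ 2 + r5_d * r5_e) * r5_e' ^ 5"
  define G where "G = Abs_fps (\<lambda>n. w ^ n)"
  have G: "(1 - fps_X * fps_const w) * G = 1"
  proof (rule fps_ext)
    fix n
    show "((1 - fps_X * fps_const w) * G) $ n = 1 $ n"
      by (cases n) (simp_all add: algebra_simps G_def mult.assoc)
  qed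
  have "fe * fm ^ 5 = (fl * fm) ^ 5 - fps_X * fps_const w"
    by (simp add: fe_def fa_def fb_def fc_def fd_def fl_def fm_def w_def algebra_simps power_mult_distrib flip:
        fps_const_mult fps_const_add fps_const_power)
  then have "fe * ff = (1 - fps_X * fps_const w) * G"
    by (simp add: ff_def G_def w_def fl_fm flip: mult.assoc)
  with G show ?thesis by simp
qed

text \<open>No root is adjoined formally: in the target copy of \<open>r5\<close> the Laurent
  variable \<open>r5_e\<close> plays the part of l, and the source variable e is sent to the value
  \<open>fe\<close> that the quintic forces.\<close>

definition \<psi> :: "r5 \<Rightarrow> r5 fps" where "\<psi> = r5_eval fa fb fc fd fe ff"

interpretation \<psi>: ring_hom \<psi>
  unfolding \<psi>_def by (rule ring_hom_r5_eval[OF fe_ff])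

interpretation h0: ring_hom "\<lambda>x. fps_nth x 0 :: 'a::comm_ring_1"
  by unfold_locales simp_all

definition deg5 :: "nat \<times> nat \<times> nat \<times> nat \<times> int \<Rightarrow> nat" where
  "deg5 = (\<lambda>(i, j, k, n, p). i + j + k + n)"
definition lead5 :: "nat \<times> nat \<times> nat \<times> nat \<times> int \<Rightarrow> nat \<times> nat \<times> nat \<times> nat \<times> int" where
  "lead5 = (\<lambda>(i, j, k, n, p). (i, j, k, n, 5 * p))"

lemma ipow_fe_0: "ipow fe ff p $ 0 = Poly_Mapping.single (0, 0, 0, 0, 5 * p) 1"
proof -
  have "ipow fe ff p $ 0 = ipow (r5_e ^ 5) (r5_e' ^ 5) p"
    by (simp add: ipow_def h0.hom_power fe_def ff_def fl_def fm_def fa_def fb_def fc_def fd_def)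
  also have "\<dots> = Poly_Mapping.single (0, 0, 0, 0, 5 * p) 1"
    by (simp add: ipow_def flip: power_mult) (simp add: r5_powers)
  finally show ?thesis .
qed

text \<open>Monomials of degree above g do not reach the coefficient of index g. In those of degree
  g, e contributes only its constant term l^5, whence the factor 5 in \<open>lead5\<close>.\<close>

lemma \<psi>_nth:
  assumes "\<And>k. k \<in> Poly_Mapping.keys x \<Longrightarrow> g \<le> deg5 k"
  shows "\<psi> x $ g = (\<Sum>k\<in>Poly_Mapping.keys x. if deg5 k = g then Poly_Mapping.single (lead5 k)
      (Poly_Mapping.lookup x k) else 0)"
  unfolding \<psi>_def r5_eval_def pm_sum_def fps_sum_nth
proof (rule sum.cong[OF HOL.refl])
  fix q assume q: "q \<in> Poly_Mapping.keys x"
  obtain i j k n p where [simp]: "q = (i, j, k, n, p)" by (cases q) auto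
  let ?r = "Poly_Mapping.lookup x q"
  have "of_int ?r * (fa ^ i * fb ^ j * fc ^ k * fd ^ n * ipow fe ff p) =
      fps_X ^ deg5 q * (fps_const (of_int ?r * r5_a ^ i * r5_b ^ j * r5_c ^ k * r5_d ^ n) * ipow fe ff p)"
    by (simp add: fa_def fb_def fc_def fd_def deg5_def power_mult_distrib power_add ac_simps fps_of_int flip:
        fps_const_mult fps_const_power)
  moreover have "of_int ?r * r5_a ^ i * r5_b ^ j * r5_c ^ k * r5_d ^ n * Poly_Mapping.single (0, 0, 0, 0, 5 * p) 1
      = Poly_Mapping.single (lead5 q) ?r"
    by (simp add: r5_powers lead5_def single_5_mult flip: single_of_int) (simp add: zero_prod_def single_5_mult)
  ultimately show "(of_int ?r * (case q of (i, j, k, n, p) \<Rightarrow> fa ^ i * fb ^ j * fc ^ k * fd ^ n * ipow fe ff p)) $ g =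
      (if deg5 q = g then Poly_Mapping.single (lead5 q) ?r else 0)"
    using assms[OF q] by (auto simp: fps_X_power_mult_nth ipow_fe_0)
qed

text \<open>In lowest degree the exponent of l is 5p + i with i between 0 and 4. Its residue modulo
  5 recovers i, so distinct terms have distinct monomials and cannot cancel.\<close>

lemma \<psi>_powers_independent:
  assumes sum: "(\<Sum>i\<in>{0..4::int}. \<psi> (x i) * fl ^ nat i) = 0" and i0: "i0 \<in> {0..4}"
  shows "x i0 = 0"
proof (rule ccontr)
  define D where "D = (\<Union>i\<in>{0..4}. deg5 ` Poly_Mapping.keys (x i))"
  assume "x i0 \<noteq> 0"
  then have "D \<noteq> {}" using i0 by (auto simp: D_def)
  define g where "g = (LEAST g. g \<in> D)"
  have "g \<in> D" using \<open>D \<noteq> {}\<close> unfolding g_def by (metis LeastI ex_in_conv)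
  then obtain i1 q1 where i1: "i1 \<in> {0..4}" "q1 \<in> Poly_Mapping.keys (x i1)" "deg5 q1 = g"
    by (auto simp: D_def)
  have le: "g \<le> deg5 k" if "i \<in> {0..4}" "k \<in> Poly_Mapping.keys (x i)" for i k
    unfolding g_def by (rule Least_le) (use that in \<open>auto simp: D_def\<close>)
  define sh where "sh = (\<lambda>k (i::int). case lead5 k of (a, b, c, d, p) \<Rightarrow> (a, b, c, d, p + i))"
  have inj: "sh k i = sh q1 i1 \<longleftrightarrow> i = i1 \<and> k = q1" if "i \<in> {0..4}" for k i
  proof -
    have "5 * p + i = 5 * p1 + i1 \<longleftrightarrow> i = i1 \<and> p = p1" for p p1 :: int
      using that i1(1) by simp presburger
    then show ?thesis by (cases k; cases q1) (auto simp: sh_def lead5_def)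
  qed
  have "0 = (\<Sum>i\<in>{0..4::int}. \<psi> (x i) * fl ^ nat i) $ g"
    by (simp add: sum)
  also have "\<dots> = (\<Sum>i\<in>{0..4}. \<psi> (x i) $ g * Poly_Mapping.single (0, 0, 0, 0, i) 1)"
    unfolding fps_sum_nth by (rule sum.cong) (auto simp: fl_def r5_powers)
  also have "\<dots> = (\<Sum>i\<in>{0..4}. \<Sum>k\<in>Poly_Mapping.keys (x i). if deg5 k = g then Poly_Mapping.single (sh k i)
      (Poly_Mapping.lookup (x i) k) else 0)"
  proof (rule sum.cong[OF HOL.refl], subst \<psi>_nth)
    show "(\<Sum>k\<in>Poly_Mapping.keys (x i). if deg5 k = g then Poly_Mapping.single (lead5 k) (Poly_Mapping.lookup (x
        i) k) else 0) * Poly_Mapping.single (0, 0, 0, 0, i) 1 =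
        (\<Sum>k\<in>Poly_Mapping.keys (x i). if deg5 k = g then Poly_Mapping.single (sh k i) (Poly_Mapping.lookup (x i)
            k) else 0)" for i
      unfolding sum_distrib_right
      by (rule sum.cong[OF HOL.refl]) (auto simp: sh_def lead5_def single_5_mult split: prod.splits)
  qed (use le in auto)
  finally have "0 = Poly_Mapping.lookup (\<Sum>i\<in>{0..4}. \<Sum>k\<in>Poly_Mapping.keys (x i). if deg5 k = g then
      Poly_Mapping.single (sh k i) (Poly_Mapping.lookup (x i) k) else 0) (sh q1 i1)"
    by simp
  also have "\<dots> = (\<Sum>i\<in>{0..4}. \<Sum>k\<in>Poly_Mapping.keys (x i). if i = i1 then (if k = q1 then Poly_Mapping.lookup (x
      i) k else 0) else 0)"
    unfolding lookup_sum
    by (intro sum.cong[OF HOL.refl]) (auto simp: lookup_single inj i1(3) when_def)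
  also have "\<dots> = (\<Sum>i\<in>{0..4}. if i = i1 then (\<Sum>k\<in>Poly_Mapping.keys (x i). if k = q1 then Poly_Mapping.lookup (x
      i) k else 0) else 0)"
    by (intro sum.cong) auto
  also have "\<dots> = Poly_Mapping.lookup (x i1) q1"
    using i1 by (simp add: sum.delta)
  finally show False using i1(2) by (simp add: in_keys_iff)
qed

abbreviation (input) "C0 \<equiv> Poly_Mapping.single (0::int)"

text \<open>The Laurent variable z is the outer layer, so that windows of z-exponents are read off
  by \<open>lookup\<close>, while the grading stays inside the coefficients.\<close>

interpretation model: model12_action "C0 fa" "C0 fb" "C0 fc" "C0 fd" "C0 fe" "C0 ff" "C0 fl" "C0 fm"
  "Poly_Mapping.single (- 1) 1" "Poly_Mapping.single 1 1" "\<lambda>r. C0 (\<psi> r)" r5_a r5_b r5_c r5_d r5_e r5_e'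
proof unfold_locales
  have power: "C0 x ^ n = C0 (x ^ n)" for x :: "r5 fps" and n
    by (induction n) (simp_all add: mult_single)
  show "C0 fl ^ 5 = C0 fa * C0 fl ^ 4 + C0 fb * C0 fl ^ 3 + C0 fc * (C0 fl)\<^sup>2 + C0 fd * C0 fl + C0 fe"
    by (simp add: power mult_single fe_def flip: single_add)
qed (simp_all add: mult_single fe_ff fl_fm single_add \<psi>.hom_simps, simp_all add: \<psi>_def r5_eval_gens)

abbreviation (input) "H \<equiv> vmap (\<lambda>x::r5 fps. x $ 0)"

interpretation low: model12_hom "C0 fa" "C0 fb" "C0 fc" "C0 fd" "C0 fe" "C0 ff" "C0 fl" "C0 fm"
  "Poly_Mapping.single (- 1) 1" "Poly_Mapping.single 1 1" H
  by (intro model12_hom.intro model.model12_axioms h0.ring_hom_vmap)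

lemma H_params: "H (C0 fa) = 0" "H (C0 fb) = 0" "H (C0 fc) = 0" "H (C0 fd) = 0" "H (C0 fl) = C0 r5_e"
    "H (Poly_Mapping.single 1 1) = Poly_Mapping.single 1 1"
  by (simp_all add: h0.vmap_single fa_def fb_def fc_def fd_def fl_def)

interpretation low0: model12_0 "H (C0 fe)" "H (C0 ff)" "H (C0 fl)" "H (C0 fm)" "H (Poly_Mapping.single (- 1) 1)"
    "H (Poly_Mapping.single 1 1)"
  using low.im.model12_axioms unfolding model12_0_def H_params(1-4) .

lemma H_nrow: "\<exists>u u'. u * u' = 1 \<and>
    vmap H (model.nrow k) = ((Poly_Mapping.single 10 1 - C0 (r5_e ^ 60)) * u) \<cdot> bas (perm k)"
proof -
  have power: "C0 x ^ n = C0 (x ^ n)" "Poly_Mapping.single (1::int) x ^ n = Poly_Mapping.single (int n) (x ^ n)"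
      for x :: r5 and n
    by (induction n) (simp_all add: mult_single)
  show ?thesis
    using low0.nrow_0[of k] unfolding low.vmap_nrow H_params power by simp
qed

text \<open>The lowest exponent of x and its highest exponent plus ten both survive in the product,
  and they differ by at least ten.\<close>

lemma window_zero:
  fixes x :: "int \<Rightarrow>\<^sub>0 'r::comm_ring_1"
  assumes window: "\<And>k. k \<notin> {w..w + 9} \<Longrightarrow> Poly_Mapping.lookup ((Poly_Mapping.single 10 1 - C0 u) * x) k = 0"
    and u: "u * u' = 1"
  shows "x = 0"
proof (rule ccontr)
  let ?K = "Poly_Mapping.keys x"
  assume "x \<noteq> 0"
  then have K: "finite ?K" "?K \<noteq> {}" by auto
  have lookup: "Poly_Mapping.lookup ((Poly_Mapping.single 10 1 - C0 u) * x) k =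
      Poly_Mapping.lookup x (k - 10) - u * Poly_Mapping.lookup x k" for k
    by (simp add: left_diff_distrib lookup_minus lookup_single_mult)
  have "Max ?K + 10 \<notin> ?K" "Min ?K - 10 \<notin> ?K"
    using Max_ge[OF K(1), of "Max ?K + 10"] Min_le[OF K(1), of "Min ?K - 10"] by linarith+
  moreover have max: "Poly_Mapping.lookup x (Max ?K) \<noteq> 0" and min: "Poly_Mapping.lookup x (Min ?K) \<noteq> 0"
    using Max_in[OF K] Min_in[OF K] by (simp_all add: in_keys_iff)
  moreover have "u * Poly_Mapping.lookup x (Min ?K) \<noteq> 0"
  proof
    assume "u * Poly_Mapping.lookup x (Min ?K) = 0"
    then have "u * u' * Poly_Mapping.lookup x (Min ?K) = 0"
      by (metis mult.assoc mult.commute mult_zero_right)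
    with min u show False by simp
  qed
  ultimately have "Max ?K + 10 \<in> {w..w + 9}" "Min ?K \<in> {w..w + 9}"
    using window[of "Max ?K + 10"] window[of "Min ?K"] by (auto simp: lookup in_keys_iff)
  moreover have "Min ?K \<le> Max ?K" using K by simp
  ultimately show False by simp
qed

lemma lookup_lin_perm:
  assumes "inj \<pi>"
  shows "Poly_Mapping.lookup (lin (\<lambda>k. c k \<cdot> bas (\<pi> k)) v) (\<pi> b) = c b * Poly_Mapping.lookup v b"
  using assms by (induction v rule: free_induct)
    (auto simp: lin_simps lookup_add lookup_single when_def inj_eq algebra_simps)

lemma inj_perm: "inj perm"
proof (rule injI)
  show "perm x = perm y \<Longrightarrow> x = y" for x y
    by (cases x; cases y; simp)
qed

text \<open>The constant term in the grading variable is the case a = b = c = d = 0, where the rows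
  are unit multiples of \<open>z^10 - l^60\<close> times permuted basis vectors. The permutation
  only assigns the windows to other coordinates.\<close>

lemma window_base:
  assumes window: "\<And>b k. k \<notin> {w b..w b + 9} \<Longrightarrow> Poly_Mapping.lookup (Poly_Mapping.lookup (lin model.nrow x) b) k = 0"
  shows "Poly_Mapping.lookup (Poly_Mapping.lookup x b) k $ 0 = 0"
proof -
  obtain u u' where u: "u k * u' k = 1"
    "vmap H (model.nrow k) = ((Poly_Mapping.single 10 1 - C0 (r5_e ^ 60)) * u k) \<cdot> bas (perm k)" for k
    using H_nrow by metis
  have "u b * Poly_Mapping.lookup (vmap H x) b = 0"
  proof (rule window_zero[of "w (perm b)" "r5_e ^ 60" _ "r5_e' ^ 60"])
    have "vmap H (lin model.nrow x) = lin (\<lambda>k. ((Poly_Mapping.single 10 1 - C0 (r5_e ^ 60)) * u k) \<cdot> bas (perm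
        k)) (vmap H x)"
      by (simp add: low.vmap_lin u)
    then have "(Poly_Mapping.single 10 1 - C0 (r5_e ^ 60)) * (u b * Poly_Mapping.lookup (vmap H x) b) =
        Poly_Mapping.lookup (vmap H (lin model.nrow x)) (perm b)"
      by (simp add: lookup_lin_perm[OF inj_perm] mult.assoc)
    then show "Poly_Mapping.lookup ((Poly_Mapping.single 10 1 - C0 (r5_e ^ 60)) * (u b * Poly_Mapping.lookup
        (vmap H x) b)) k = 0"
      if "k \<notin> {w (perm b)..w (perm b) + 9}" for k
      by (simp add: low.lookup_vmap h0.lookup_vmap window[OF that])
    show "r5_e ^ 60 * r5_e' ^ 60 = 1"
      by (simp add: r5_e_e' flip: power_mult_distrib)
  qed
  then have "u' b * (u b * Poly_Mapping.lookup (vmap H x) b) = 0" by simp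
  then have "Poly_Mapping.lookup (vmap H x) b = 0"
    by (simp add: u(1) mult.commute[of "u' b"] flip: mult.assoc)
  then have "Poly_Mapping.lookup (Poly_Mapping.lookup (vmap H x) b) k = 0" by simp
  then show ?thesis by (simp add: low.lookup_vmap h0.lookup_vmap)
qed

text \<open>Once the constant terms vanish, x is divisible by the grading variable. Dividing by it
  leaves the windows intact, so the base case applies again to the quotient.\<close>

lemma window_descent:
  assumes "\<And>b k. k \<notin> {w b..w b + 9} \<Longrightarrow> Poly_Mapping.lookup (Poly_Mapping.lookup (lin model.nrow x) b) k = 0"
  shows "Poly_Mapping.lookup (Poly_Mapping.lookup x b) k $ n = 0"
  using assms
proof (induction n arbitrary: x b k)
  case 0
  then show ?case by (rule window_base)
next
  case (Suc n)
  define x' where "x' = Poly_Mapping.map (Poly_Mapping.map (fps_shift (Suc 0))) x"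
  have lookup: "Poly_Mapping.lookup (Poly_Mapping.lookup x' b) k = fps_shift (Suc 0) (Poly_Mapping.lookup
      (Poly_Mapping.lookup x b) k)" for b k
    by (simp add: x'_def Poly_Mapping.map.rep_eq when_def)
  have x: "C0 fps_X \<cdot> x' = x"
  proof (rule poly_mapping_eqI, rule poly_mapping_eqI, rule fps_ext)
    show "Poly_Mapping.lookup (Poly_Mapping.lookup (C0 fps_X \<cdot> x') b) k $ n = Poly_Mapping.lookup
        (Poly_Mapping.lookup x b) k $ n" for b k n
      using window_base[OF Suc.prems] by (simp add: lookup_single_mult lookup)
  qed
  have X: "lin model.nrow x = C0 fps_X \<cdot> lin model.nrow x'"
    by (simp add: lin_scale flip: x)
  have "Poly_Mapping.lookup (Poly_Mapping.lookup x' b) k $ n = 0"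
  proof (rule Suc.IH)
    fix b k assume "k \<notin> {w b..w b + 9}"
    from Suc.prems[OF this] have "fps_X * Poly_Mapping.lookup (Poly_Mapping.lookup (lin model.nrow x') b) k = 0"
      by (simp add: X lookup_single_mult)
    then have "(fps_X * Poly_Mapping.lookup (Poly_Mapping.lookup (lin model.nrow x') b) k) $ Suc i = 0" for i
      by simp
    then show "Poly_Mapping.lookup (Poly_Mapping.lookup (lin model.nrow x') b) k = 0"
      by (intro fps_ext) simp
  qed
  then show ?case by (simp add: lookup)
qed

lemma Idx_window: "(n, k, i, j) \<in> Idx \<Longrightarrow>
    k \<in> (if ix_of n j = One then {-4..5} else if ix_of n j \<in> {Tm2, Tm1, T0, T1, T2} then {-5..4} else {-6..3})"
  by (auto simp: Idx_def)

theorem basis_lift_independent: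
  assumes ideal: "(\<Sum>p\<in>Idx. scalar (r p) * basis_lift r5_a (r5_d * r5_e') p) \<in>
      two_sided_ideal {relator r5_a r5_b r5_c r5_d r5_e s1, relator r5_a r5_b r5_c r5_d r5_e s2}"
    and "p \<in> Idx"
  shows "r p = 0"
proof -
  define summand where "summand = (\<lambda>p. case p of (n, k, i, j) \<Rightarrow> Poly_Mapping.single k (\<psi> (r p) * fl ^ nat i))"
  define pos where "pos = (\<lambda>p::idx. case p of (n, k, i, j) \<Rightarrow> ix_of n j)"
  define v where "v = (\<Sum>p\<in>Idx. summand p \<cdot> bas (pos p))"
  define w :: "ix \<Rightarrow> int" where "w = (\<lambda>b. if b = One then - 4 else if b \<in> {Tm2, Tm1, T0, T1, T2} then - 5 else - 6)"
  have power: "C0 x ^ n = C0 (x ^ n)" "Poly_Mapping.single (1::int) x ^ n = Poly_Mapping.single (int n) (x ^ n)"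
     "Poly_Mapping.single (-1::int) x ^ n = Poly_Mapping.single (- int n) (x ^ n)" for x :: "r5 fps" and n
    by (induction n) (simp_all add: mult_single)
  have ipow: "ipow (Poly_Mapping.single 1 1) (Poly_Mapping.single (- 1) 1) k = Poly_Mapping.single k (1 :: r5
      fps)" for k :: int
    by (simp add: ipow_def power)
  have "v = model.act (bas One) (\<Sum>p\<in>Idx. scalar (r p) * basis_lift r5_a (r5_d * r5_e') p)"
    unfolding model.act.act_sum v_def
  proof (rule sum.cong[OF HOL.refl])
    fix p assume "p \<in> Idx"
    moreover obtain n k i j where [simp]: "p = (n, k, i, j)" by (cases p) auto
    ultimately show "summand p \<cdot> bas (pos p) = model.act (bas One) (scalar (r p) * basis_lift r5_a (r5_d * r5_e') p)"
      by (simp add: model.act.act_mult model.act_scalar model.act.act_scale_left model.act_basis_lift ipow power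
          mult_single
          summand_def pos_def del: ix_of.simps)
  qed
  then have "v \<in> model.N"
    using model.act_ideal_N[OF ideal] by simp
  then obtain x where x: "v = lin model.nrow x"
    unfolding model.N_def by auto
  have lookup_v: "Poly_Mapping.lookup (Poly_Mapping.lookup v b) k =
      (\<Sum>p\<in>Idx. if pos p = b then Poly_Mapping.lookup (summand p) k else 0)" for b k
    by (simp add: v_def lookup_sum lookup_single when_def if_distrib cong: if_cong)
     (rule sum.cong[OF HOL.refl], simp)
  have "Poly_Mapping.lookup (Poly_Mapping.lookup (lin model.nrow x) b) k = 0" if "k \<notin> {w b..w b + 9}" for b k
    unfolding x[symmetric] lookup_v
  proof (intro sum.neutral ballI)
    fix p assume "p \<in> Idx"
    moreover obtain n k' i j where "p = (n, k', i, j)" by (cases p) auto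
    ultimately show "(if pos p = b then Poly_Mapping.lookup (summand p) k else 0) = 0"
      using that Idx_window[of n k' i j]
      by (auto simp: w_def pos_def summand_def lookup_single when_def simp del: ix_of.simps split: if_splits)
  qed
  then have "Poly_Mapping.lookup (Poly_Mapping.lookup x b) k $ n = 0" for b k n
    by (rule window_descent)
  then have "x = 0"
    by (intro poly_mapping_eqI fps_ext) simp
  then have v: "v = 0" by (simp add: x)
  obtain n k i j where p: "p = (n, k, i, j)" by (cases p) auto
  \<comment> \<open>For a fixed vector and a fixed power of z exactly the five powers of l remain,
    and \<open>\<psi>_powers_independent\<close> separates them.\<close>
  have inj: "pos q = pos p \<and> fst (snd q) = k \<longleftrightarrow> q \<in> (\<lambda>i. (n, k, i, j)) ` {0..4}" if "q \<in> Idx" for q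
  proof -
    obtain n' k' i' j' where q: "q = (n', k', i', j')" by (cases q) auto
    have "(n, j) = (n', j')" if "pos q = pos p"
      using that ix_tag[of n k i j] ix_tag[of n' k' i' j'] \<open>q \<in> Idx\<close> \<open>p \<in> Idx\<close>
      by (simp add: p q pos_def del: ix_of.simps)
    then show ?thesis
      using Idx_range[of n' k' i' j'] \<open>q \<in> Idx\<close> by (auto simp: p q pos_def simp del: ix_of.simps)
  qed
  have "0 = (\<Sum>q\<in>Idx. if pos q = pos p then Poly_Mapping.lookup (summand q) k else 0)"
    using lookup_v[of "pos p" k] by (simp add: v)
  also have "\<dots> = (\<Sum>q\<in>(\<lambda>i. (n, k, i, j)) ` {0..4}. Poly_Mapping.lookup (summand q) k)"
  proof (rule sum.mono_neutral_cong_right)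
    show "(\<lambda>i. (n, k, i, j)) ` {0..4} \<subseteq> Idx"
      using \<open>p \<in> Idx\<close> by (auto simp: p Idx_def)
    then show "(if pos q = pos p then Poly_Mapping.lookup (summand q) k else 0) = Poly_Mapping.lookup (summand q) k"
      if "q \<in> (\<lambda>i. (n, k, i, j)) ` {0..4}" for q
      using that inj[of q] by auto
    show "\<forall>q\<in>Idx - (\<lambda>i. (n, k, i, j)) ` {0..4}. (if pos q = pos p then Poly_Mapping.lookup (summand q) k else 0) = 0"
    proof
      fix q assume "q \<in> Idx - (\<lambda>i. (n, k, i, j)) ` {0..4}"
      then have "\<not> (pos q = pos p \<and> fst (snd q) = k)" using inj by blast
      then show "(if pos q = pos p then Poly_Mapping.lookup (summand q) k else 0) = 0"
        by (cases q) (auto simp: summand_def lookup_single)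
    qed
  qed simp
  also have "\<dots> = (\<Sum>i\<in>{0..4}. \<psi> (r (n, k, i, j)) * fl ^ nat i)"
    by (subst sum.reindex) (auto simp: inj_on_def summand_def)
  finally have "(\<Sum>i\<in>{0..4}. \<psi> (r (n, k, i, j)) * fl ^ nat i) = 0" ..
  from \<psi>_powers_independent[OF this, of i] Idx_range[of n k i j] \<open>p \<in> Idx\<close> show "r p = 0"
    by (simp add: p)
qed

subsection \<open>Quotients of the group algebra of the braid group\<close>

lemma gpow_commute:
  assumes "x + y = y + x"
  shows "gpow x i + gpow y j = gpow y j + gpow x i"
proof -
  have 1: "gpow u k + v = v + gpow u k" if "u + v = v + u" for u v :: 'a and k
  proof (induction k rule: int_induct[where k = 0])
    case (step1 k)
    have "u + gpow u k + v = u + v + gpow u k" by (simp only: add.assoc step1)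
    also have "\<dots> = v + (u + gpow u k)" by (simp only: that add.assoc)
    finally show ?case by (simp only: gpow_Suc)
  next
    case (step2 k)
    have "u + (gpow u (k - 1) + v) = gpow u k + v"
      using gpow_Suc[of u "k - 1"] by (simp flip: add.assoc)
    also have "\<dots> = v + (u + gpow u (k - 1))"
      using gpow_Suc[of u "k - 1"] step2 by simp
    also have "\<dots> = u + (v + gpow u (k - 1))"
      by (simp only: that flip: add.assoc)
    finally show ?case by simp
  qed simp
  show ?thesis using 1[OF 1[OF assms, symmetric], symmetric] by simp
qed

lemma braid_relation_assoc: "s2 + (s1 + s2) = s1 + (s2 + s1)" "s2 + (s1 + (s2 + x)) = s1 + (s2 + (s1 + x))"
proof -
  show 1: "s2 + (s1 + s2) = s1 + (s2 + s1)"
    using braid_relation by (simp add: add.assoc)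
  have "s2 + (s1 + s2) + x = s1 + (s2 + s1) + x"
    by (simp only: 1)
  then show "s2 + (s1 + (s2 + x)) = s1 + (s2 + (s1 + x))"
    by (simp only: add.assoc)
qed

lemma s1_garside: "s1 + garside = garside + s2" and s2_garside: "s2 + garside = garside + s1"
  by (simp_all add: garside_def add.assoc braid_relation_assoc)

lemma s1_garside2: "s1 + (garside + garside) = (garside + garside) + s1"
  by (metis add.assoc s1_garside s2_garside)

lemma garside_s1: "garside + (- s1 + garside) = s1 + (garside + s1)"
  by (simp add: garside_def add.assoc braid_relation_assoc del: add_uminus_conv_diff)

lemma s2_eq: "s2 = gpow (garside + garside) (- 1) + (garside + (s1 + garside))"
proof -
  have "garside + (s1 + garside) = (garside + garside) + s2"
    by (simp add: s1_garside add.assoc)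
  then show ?thesis by (simp only: gpow_minus_1 minus_add_cancel)
qed

lemma s2_inverse_eq: "- s2 = gpow (garside + garside) (- 1) + (s1 + (garside + s1))"
proof -
  let ?y = "s1 + (garside + s1)"
  have "?y + s2 = s1 + s2 + (garside + s2)"
    by (simp only: s2_garside[symmetric] add.assoc)
  also have "\<dots> = garside + garside"
    by (simp only: s1_garside[symmetric]) (simp only: garside_def add.assoc)
  finally have "- (garside + garside) + ?y = - s2 + (- ?y + ?y)"
    by (metis add.assoc minus_add)
  then show ?thesis by simp
qed

lemma braid3_induct [case_names zero s1 s1_inverse s2 s2_inverse]:
  assumes "Q 0" "\<And>x. Q x \<Longrightarrow> Q (x + s1)" "\<And>x. Q x \<Longrightarrow> Q (x + - s1)" "\<And>x. Q x \<Longrightarrow> Q (x + s2)" "\<And>x. Q x \<Longrightarrow> Q (x + - s2)"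
  shows "Q x"
proof -
  have "Q (abs_braid3 w)" for w
  proof (induction w rule: rev_induct)
    case Nil
    show ?case using assms(1) by (simp add: zero_braid3.abs_eq)
  next
    case (snoc l w)
    have "abs_braid3 (w @ [l]) = abs_braid3 w + abs_braid3 [l]"
      by (simp add: plus_braid3.abs_eq)
    moreover have "abs_braid3 [l] \<in> {s1, - s1, s2, - s2}"
    proof -
      obtain g b where "l = (g, b)" by (cases l)
      then show ?thesis
        by (cases g; cases b) (simp_all add: s1.abs_eq s2.abs_eq uminus_braid3.abs_eq inverse_word_def)
    qed
    ultimately show ?case
      using assms(2-5)[OF snoc] by (elim insertE emptyE; simp)
  qed
  then show ?thesis by (induction x rule: braid3.abs_induct)
qed

locale hecke_quotient = module scale
  for scale :: "'r::comm_ring_1 \<Rightarrow> 'h::{ring,monoid_mult} \<Rightarrow> 'h" +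
  fixes \<pi> :: "(braid3 \<Rightarrow>\<^sub>0 'r) \<Rightarrow> 'h" and a b c d e e' :: 'r
  assumes \<pi>_add: "\<pi> (x + y) = \<pi> x + \<pi> y" and \<pi>_mult: "\<pi> (x * y) = \<pi> x * \<pi> y" and \<pi>_1: "\<pi> 1 = 1"
    and \<pi>_surj: "range \<pi> = UNIV" and scale_eq: "scale r u = \<pi> (scalar r) * u"
    and unit: "e * e' = 1" and \<pi>_relator: "\<pi> (relator a b c d e s1) = 0"
begin

lemma \<pi>_0: "\<pi> 0 = 0"
  using \<pi>_add[of 0 0] by simp

lemma \<pi>_uminus: "\<pi> (- x) = - \<pi> x"
  using \<pi>_add[of x "- x"] by (simp add: \<pi>_0 eq_neg_iff_add_eq_0 add.commute)

lemma \<pi>_diff: "\<pi> (x - y) = \<pi> x - \<pi> y"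
  using \<pi>_add[of x "- y"] by (simp add: \<pi>_uminus)

lemma \<pi>_sum: "\<pi> (\<Sum>i\<in>A. g i) = (\<Sum>i\<in>A. \<pi> (g i))"
  by (induction A rule: infinite_finite_induct) (simp_all add: \<pi>_0 \<pi>_add)

lemma \<pi>_scalar: "\<pi> (scalar r * x) = scale r (\<pi> x)"
  by (simp add: \<pi>_mult scale_eq)

lemma scalar_central: "x * scalar r = scalar r * (x :: braid3 \<Rightarrow>\<^sub>0 'r)"
  by (induction x rule: poly_mapping_additive_induct)
    (simp_all add: mult_single distrib_left distrib_right mult.commute)

abbreviation "ge g \<equiv> \<pi> (group_elem g)"

lemma ge_add: "ge (g + h) = ge g * ge h"
  by (simp add: mult_single flip: \<pi>_mult)

sublocale hecke5 scale a b c d e e' "\<lambda>i. ge (gpow s1 i)" "\<lambda>k. ge (gpow (garside + garside) k)" "ge garside"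
proof unfold_locales
  show "scale r u * v = scale r (u * v)" for r u v
    by (simp add: scale_eq mult.assoc)
  show "u * scale r v = scale r (u * v)" for r u v
  proof -
    obtain u' v' where "u = \<pi> u'" "v = \<pi> v'" using \<pi>_surj by (metis rangeE UNIV_I)
    then show ?thesis
      by (simp add: scalar_central flip: \<pi>_scalar \<pi>_mult mult.assoc)
  qed
  have power: "group_elem s1 ^ n = (group_elem (gpow s1 (int n)) :: braid3 \<Rightarrow>\<^sub>0 'r)" for n
    by (induction n) (simp_all add: mult_single gpow_Suc add.commute[of 1])
  \<comment> \<open>The factor s1^-2 brings the relator into the symmetric form of
    \<open>quintic\<close>.\<close>
  have "\<pi> (relator a b c d e s1 * group_elem (gpow s1 (- 2))) = 0"
    by (simp add: \<pi>_mult \<pi>_relator)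
  then show "ge (gpow s1 3) = scale a (ge (gpow s1 2)) + scale b (ge (gpow s1 1)) + scale c (ge (gpow s1 0)) +
      scale d (ge (gpow s1 (- 1))) + scale e (ge (gpow s1 (- 2)))"
    using gpow_add[of s1 1 "- 2"]
    by (simp add: relator_def power left_diff_distrib distrib_right mult.assoc \<pi>_diff \<pi>_add mult_single scale_eq
        flip: gpow_add \<pi>_mult)
qed (simp_all add: unit \<pi>_1 gpow_add garside_s1 s1_garside2 gpow_commute add.assoc
  gpow_commute[of garside "garside + garside" 1, simplified gpow_1] flip: ge_add del: add_uminus_conv_diff)

lemma basis_eq: "basis = (\<lambda>p. \<pi> (basis_lift a (d * e') p))"
  by (auto simp: basis_lift_def gen_def \<pi>_add \<pi>_diff \<pi>_mult fun_eq_iff scale_eq \<pi>_1)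

theorem span_basis: "span (basis ` Idx) = UNIV"
proof -
  have group: "u * ge g \<in> U" if "u \<in> U" for u g
  proof (induction g rule: braid3_induct)
    case zero
    show ?case using that by (simp add: \<pi>_1)
  next
    case (s1 g)
    then show ?case using bimod_U[unfolded bimod_def] by (auto simp: ge_add simp flip: mult.assoc dest!: spec[of _ 1])
  next
    case (s1_inverse g)
    then show ?case using bimod_U[unfolded bimod_def] by (auto simp: ge_add simp flip: mult.assoc simp del:
        add_uminus_conv_diff dest!: spec[of _ "- 1"])
  next
    case (s2 g)
    then show ?case
      using U_s2_in_U[of "u * ge g" 1] by (subst s2_eq) (simp add: ge_add mult.assoc del: t_s_t_simps)
  next
    case (s2_inverse g)
    then show ?case
      using U_s2_inverse_in_U[of "u * ge g"] by (subst s2_inverse_eq) (simp add: ge_add mult.assoc)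
  qed
  have "\<pi> x \<in> U" for x
  proof (induction x rule: poly_mapping_additive_induct)
    case (single g r)
    have "Poly_Mapping.single g r = scalar r * group_elem g"
      by (simp add: mult_single)
    then show ?case
      using group[OF one_in_U, of g] by (simp add: \<pi>_scalar subspace_scale[OF subspace_U])
  qed (simp_all add: \<pi>_0 \<pi>_add subspace_0[OF subspace_U] subspace_add[OF subspace_U])
  then have "U = UNIV"
    using \<pi>_surj by (metis rangeE UNIV_I UNIV_eq_I)
  then show ?thesis
    by (simp add: U_eq_span)
qed

end

lemma free_of_rank_600:
  fixes scale :: "'r::comm_ring_1 \<Rightarrow> 'h::ab_group_add \<Rightarrow> 'h" and b :: "idx \<Rightarrow> 'h"
  assumes "module scale" and span: "module.span scale (b ` Idx) = UNIV"
    and indep: "\<And>r p. (\<Sum>p\<in>Idx. scale (r p) (b p)) = 0 \<Longrightarrow> p \<in> Idx \<Longrightarrow> r p = 0"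
  shows "free_of_rank scale 600"
proof -
  interpret module scale by fact
  have inj: "inj_on b Idx"
  proof (rule inj_onI, rule ccontr)
    fix p q assume pq: "p \<in> Idx" "q \<in> Idx" "b p = b q" "p \<noteq> q"
    define r :: "idx \<Rightarrow> 'r" where "r = (\<lambda>x. if x = p then 1 else if x = q then - 1 else 0)"
    have "(\<Sum>x\<in>Idx. scale (r x) (b x)) = (\<Sum>x\<in>{p, q}. scale (r x) (b x))"
      using pq by (intro sum.mono_neutral_right) (auto simp: r_def)
    also have "\<dots> = 0" using pq by (simp add: r_def)
    finally have "r p = 0" using indep[of r p] pq(1) by blast
    then show False by (simp add: r_def)
  qed
  have "\<not> dependent (b ` Idx)"
  proof
    assume "dependent (b ` Idx)"
    then obtain u where u: "\<exists>v\<in>b ` Idx. u v \<noteq> 0" "(\<Sum>v\<in>b ` Idx. scale (u v) v) = 0"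
      by (auto simp: dependent_finite)
    from u(2) have "(\<Sum>p\<in>Idx. scale (u (b p)) (b p)) = 0"
      by (simp add: sum.reindex[OF inj])
    from indep[OF this] u(1) show False by auto
  qed
  moreover have "card (b ` Idx) = 600"
    by (simp add: card_image[OF inj] card_Idx)
  ultimately show ?thesis
    unfolding free_of_rank_def using span module_axioms finite_Idx by blast
qed

interpretation h5: hecke_quotient scale_h5 abs_h5 r5_a r5_b r5_c r5_d r5_e r5_e'
proof unfold_locales
  show "range abs_h5 = UNIV"
    by (metis Quotient3_abs_rep[OF Quotient3_h5] surjI)
  show "abs_h5 (relator r5_a r5_b r5_c r5_d r5_e s1) = 0"
    unfolding zero_h5_def h5.abs_eq_iff
    by (simp add: two_sided_ideal.base relator_def h5_relator_def)
qed (simp_all add: plus_h5.abs_eq times_h5.abs_eq one_h5_def scale_h5_def r5_e_e')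

lemma h5_independent:
  assumes "(\<Sum>p\<in>Idx. scale_h5 (r p) (h5.basis p)) = 0" "p \<in> Idx"
  shows "r p = 0"
proof (rule basis_lift_independent[OF _ assms(2)])
  have "abs_h5 (\<Sum>p\<in>Idx. scalar (r p) * basis_lift r5_a (r5_d * r5_e') p) = 0"
    using assms(1) by (simp add: h5.basis_eq h5.\<pi>_sum h5.\<pi>_scalar)
  then show "(\<Sum>p\<in>Idx. scalar (r p) * basis_lift r5_a (r5_d * r5_e') p) \<in>
      two_sided_ideal {relator r5_a r5_b r5_c r5_d r5_e s1, relator r5_a r5_b r5_c r5_d r5_e s2}"
    unfolding zero_h5_def h5.abs_eq_iff by (simp add: relator_def h5_relator_def)
qed

theorem free_h5: "free_of_rank scale_h5 600"
  using h5.module_axioms h5.span_basis by (rule free_of_rank_600) (rule h5_independent)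

subsection \<open>Change of the coefficient ring\<close>

locale base_change = ring_hom h for h :: "r5 \<Rightarrow> 'c::comm_ring_1"
begin

definition expand :: "(idx \<Rightarrow>\<^sub>0 r5) \<Rightarrow> h5" where
  "expand v = (\<Sum>p\<in>Idx. scale_h5 (Poly_Mapping.lookup v p) (h5.basis p))"

lemma expand_simps: "expand (v + w) = expand v + expand w" "expand (r \<cdot> v) = scale_h5 r (expand v)" "expand 0 = 0"
  by (simp_all add: expand_def lookup_add h5.scale_left_distrib sum.distrib h5.scale_sum_right)

lemma expand_bas: "p \<in> Idx \<Longrightarrow> expand (bas p) = h5.basis p"
  by (simp add: expand_def lookup_single when_def if_distrib[of "\<lambda>r. scale_h5 r _"] cong: if_cong)

definition vecs :: "(idx \<Rightarrow>\<^sub>0 r5) set" where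
  "vecs = {v. \<forall>p. p \<notin> Idx \<longrightarrow> Poly_Mapping.lookup v p = 0}"

lemma vecs_closed: "p \<in> Idx \<Longrightarrow> bas p \<in> vecs" "0 \<in> vecs" "v \<in> vecs \<Longrightarrow> r \<cdot> v \<in> vecs"
    "v \<in> vecs \<Longrightarrow> w \<in> vecs \<Longrightarrow> v + w \<in> vecs"
  by (auto simp: vecs_def lookup_add lookup_single when_def)

lemma expand_inj: "v \<in> vecs \<Longrightarrow> w \<in> vecs \<Longrightarrow> expand v = expand w \<Longrightarrow> v = w"
proof (rule poly_mapping_eqI)
  fix p assume v: "v \<in> vecs" "w \<in> vecs" "expand v = expand w"
  have "(\<Sum>p\<in>Idx. scale_h5 (Poly_Mapping.lookup v p - Poly_Mapping.lookup w p) (h5.basis p)) = 0"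
    using v(3) by (simp add: expand_def h5.scale_left_diff_distrib sum_subtractf)
  then show "Poly_Mapping.lookup v p = Poly_Mapping.lookup w p"
    using h5_independent[of "\<lambda>p. Poly_Mapping.lookup v p - Poly_Mapping.lookup w p" p] v(1,2)
    by (cases "p \<in> Idx") (simp_all add: vecs_def del: split_paired_All)
qed

lemma expand_surj: "\<exists>v\<in>vecs. expand v = x"
proof -
  have "x \<in> h5.span (h5.basis ` Idx)" by (simp add: h5.span_basis)
  moreover have "h5.subspace (expand ` vecs)"
  proof (rule h5.subspaceI)
    show "0 \<in> expand ` vecs"
      using vecs_closed(2) by (force simp: expand_simps)
    show "x + y \<in> expand ` vecs" if "x \<in> expand ` vecs" "y \<in> expand ` vecs" for x y
      using that by (auto intro: vecs_closed simp flip: expand_simps)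
    show "scale_h5 r x \<in> expand ` vecs" if "x \<in> expand ` vecs" for r x
      using that by (auto intro: vecs_closed simp flip: expand_simps)
  qed
  moreover have "h5.basis ` Idx \<subseteq> expand ` vecs"
    by (auto intro: vecs_closed simp flip: expand_bas)
  ultimately have "x \<in> expand ` vecs"
    using h5.span_minimal by blast
  then show ?thesis by auto
qed

text \<open>Matrices of right multiplication on H5. Outside \<open>Idx\<close> the value
  \<open>bas p\<close> is a default that keeps \<open>row_add\<close> and \<open>row_zero\<close>
  true for all indices.\<close>

definition row :: "braid3 \<Rightarrow> idx \<Rightarrow> (idx \<Rightarrow>\<^sub>0 r5)" where
  "row g p = (if p \<in> Idx then SOME v. v \<in> vecs \<and> expand v = h5.basis p * h5.ge g else bas p)"

lemma row:
  assumes "p \<in> Idx"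
  shows "row g p \<in> vecs" "expand (row g p) = h5.basis p * h5.ge g"
proof -
  have "row g p \<in> vecs \<and> expand (row g p) = h5.basis p * h5.ge g"
    unfolding row_def using assms expand_surj[of "h5.basis p * h5.ge g"]
    by (simp only: if_True) (rule someI_ex, blast)
  then show "row g p \<in> vecs" "expand (row g p) = h5.basis p * h5.ge g" by auto
qed

lemma vecs_induct [consumes 1, case_names bas scale add]:
  assumes "v \<in> vecs" "\<And>p. p \<in> Idx \<Longrightarrow> Q (bas p)" "\<And>r v. v \<in> vecs \<Longrightarrow> Q v \<Longrightarrow> Q (r \<cdot> v)"
    "\<And>v w. v \<in> vecs \<Longrightarrow> w \<in> vecs \<Longrightarrow> Q v \<Longrightarrow> Q w \<Longrightarrow> Q (v + w)"
  shows "Q v"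
proof -
  define pr where "pr = (lin (\<lambda>p. if p \<in> Idx then bas p else 0) :: _ \<Rightarrow> idx \<Rightarrow>\<^sub>0 r5)"
  have "Q 0"
    using assms(3)[OF vecs_closed(1) assms(2), of "(0, 0, 0, 0)" 0] by (simp add: Idx_def)
  then have "pr v \<in> vecs \<and> Q (pr v)"
    by (induction v rule: free_induct) (auto simp: pr_def lin_simps intro: assms vecs_closed)
  moreover have "Poly_Mapping.lookup (pr v) p = (if p \<in> Idx then Poly_Mapping.lookup v p else 0)" for p
    by (induction v rule: free_induct) (auto simp: pr_def lin_simps lookup_add lookup_single when_def)
  then have "pr v = v"
    using assms(1) by (intro poly_mapping_eqI) (simp add: vecs_def del: split_paired_All)
  ultimately show ?thesis by simp
qed

lemma lin_row: "v \<in> vecs \<Longrightarrow> lin (row g) v \<in> vecs" "v \<in> vecs \<Longrightarrow> expand (lin (row g) v) = expand v * h5.ge g"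
proof -
  assume "v \<in> vecs"
  then have "lin (row g) v \<in> vecs \<and> expand (lin (row g) v) = expand v * h5.ge g"
    by (induction rule: vecs_induct)
      (auto simp: row lin_simps expand_simps expand_bas distrib_right intro: vecs_closed)
  then show "lin (row g) v \<in> vecs" "expand (lin (row g) v) = expand v * h5.ge g" by auto
qed

lemma row_add: "lin (row g') (row g p) = row (g + g') p"
proof (cases "p \<in> Idx")
  case True
  then show ?thesis
    by (intro expand_inj) (simp_all add: lin_row row h5.ge_add mult.assoc)
qed (simp add: row_def)

lemma row_zero: "row 0 p = bas p"
proof (cases "p \<in> Idx")
  case True
  then show ?thesis
    by (intro expand_inj) (simp_all add: row expand_bas vecs_closed h5.\<pi>_1)
qed (simp add: row_def)

definition \<rho> :: "braid3 \<Rightarrow> (idx \<Rightarrow>\<^sub>0 'c) \<Rightarrow> (idx \<Rightarrow>\<^sub>0 'c)" where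
  "\<rho> g = lin (\<lambda>p. vmap h (row g p))"

lemma vmap_\<rho>: "vmap h (lin (row g) v) = \<rho> g (vmap h v)"
  by (simp add: \<rho>_def vmap_lin)

sublocale act: algebra_action pscale "\<lambda>r. r" \<rho>
  by unfold_locales (simp_all add: \<rho>_def lin_add lin_scale lin_lin lin_id row_zero vmap_simps
      vmap_lin[symmetric] row_add)

sublocale act5: algebra_action pscale "\<lambda>r. r" "\<lambda>g. lin (row g)"
  by unfold_locales (simp_all add: lin_add lin_scale lin_lin lin_id row_zero[abs_def] row_add)

lemma vmap_act: "vmap h (act5.act v x) = act.act (vmap h v) (vmap h x)"
proof (induction x rule: poly_mapping_additive_induct)
  case (single g r)
  show ?case by (simp add: vmap_single act5.act_single act.act_single vmap_simps vmap_\<rho>)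
qed (simp_all add: act5.act_zero act.act_zero act5.act_add act.act_add vmap_simps)

lemma act5: "v \<in> vecs \<Longrightarrow> act5.act v x \<in> vecs" "v \<in> vecs \<Longrightarrow> expand (act5.act v x) = expand v * abs_h5 x"
proof -
  assume v: "v \<in> vecs"
  have "act5.act v x \<in> vecs \<and> expand (act5.act v x) = expand v * abs_h5 x"
  proof (induction x rule: poly_mapping_additive_induct)
    case (single g r)
    have "abs_h5 (Poly_Mapping.single g r) = scale_h5 r (h5.ge g)"
      by (simp add: mult_single flip: h5.\<pi>_scalar)
    then show ?case
      using v by (simp add: act5.act_single lin_row expand_simps vecs_closed)
  qed (simp_all add: act5.act_zero act5.act_add expand_simps vecs_closed h5.\<pi>_0 h5.\<pi>_add distrib_left)
  then show "act5.act v x \<in> vecs" "expand (act5.act v x) = expand v * abs_h5 x" by auto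
qed

lemma vmap_power: "vmap h (x ^ n) = vmap h (x :: 'g::monoid_add \<Rightarrow>\<^sub>0 r5) ^ n"
  using vmap_single[of "0 :: 'g" 1] by (induction n) (simp_all add: vmap_mult hom_1)

lemma vmap_relator: "vmap h (relator a b c d e s) = relator (h a) (h b) (h c) (h d) (h e) s"
  by (simp add: relator_def vmap_simps vmap_mult vmap_power vmap_single hom_1)

lemma vmap_basis_lift: "vmap h (basis_lift a f p) = basis_lift (h a) (h f) p"
  using vmap_single[of "0 :: braid3" 1] by (cases p) (simp add: basis_lift_def gen_def vmap_simps vmap_mult
      vmap_single hom_1)

abbreviation "ideal \<equiv> two_sided_ideal
  {relator (h r5_a) (h r5_b) (h r5_c) (h r5_d) (h r5_e) s1, relator (h r5_a) (h r5_b) (h r5_c) (h r5_d) (h r5_e) s2}"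

text \<open>Coordinates outside \<open>Idx\<close> are junk.\<close>

definition N :: "(idx \<Rightarrow>\<^sub>0 'c) set" where
  "N = {v. \<forall>p\<in>Idx. Poly_Mapping.lookup v p = 0}"

lemma subspace_N: "pscale.subspace N"
  by (auto simp: N_def pscale.subspace_def lookup_add)

lemma \<rho>_N: "v \<in> N \<Longrightarrow> \<rho> g v \<in> N"
proof -
  assume v: "v \<in> N"
  define pr where "pr = (lin (\<lambda>p. if p \<in> Idx then 0 else bas p) :: _ \<Rightarrow> idx \<Rightarrow>\<^sub>0 'c)"
  have "Poly_Mapping.lookup (pr v) p = (if p \<in> Idx then 0 else Poly_Mapping.lookup v p)" for p
    by (induction v rule: free_induct) (auto simp: pr_def lin_simps lookup_add lookup_single when_def)
  then have "pr v = v"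
    using v by (intro poly_mapping_eqI) (simp add: N_def del: split_paired_All)
  moreover have "\<rho> g (pr v) = pr v"
    by (induction v rule: free_induct) (auto simp: \<rho>_def pr_def lin_simps row_def vmap_simps)
  ultimately show "\<rho> g v \<in> N"
    using v by simp
qed

lemma act_relator: "act.act v (relator (h r5_a) (h r5_b) (h r5_c) (h r5_d) (h r5_e) s) \<in> N" if "s \<in> {s1, s2}"
proof (induction v rule: free_induct)
  case (bas p)
  show ?case
  proof (cases "p \<in> Idx")
    case True
    have "abs_h5 (relator r5_a r5_b r5_c r5_d r5_e s) = 0"
      using that by (auto simp: zero_h5_def h5.abs_eq_iff relator_def h5_relator_def intro: two_sided_ideal.base)
    with True have "act5.act (bas p) (relator r5_a r5_b r5_c r5_d r5_e s) = 0"
      by (intro expand_inj) (simp_all add: act5 expand_simps vecs_closed)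
    then have "act.act (bas p) (relator (h r5_a) (h r5_b) (h r5_c) (h r5_d) (h r5_e) s) = 0"
      by (metis vmap_act vmap_relator vmap_simps(5,6))
    then show ?thesis using pscale.subspace_0[OF subspace_N] by simp
  next
    case False
    then have "bas p \<in> N" by (auto simp: N_def lookup_single when_def)
    then show ?thesis
      unfolding act.act_def pm_sum_def
      by (intro pscale.subspace_sum[OF subspace_N] pscale.subspace_scale[OF subspace_N] \<rho>_N)
  qed
qed (simp_all add: act.act_scale_left act.act_add_left pscale.subspace_scale[OF subspace_N]
    pscale.subspace_add[OF subspace_N])

text \<open>The transported matrices still send the coordinate vector of 1 to \<open>bas p\<close>
  under the lift of the p-th basis element, whereas ideal elements send it into \<open>N\<close>. So
  the coordinates of a combination in the ideal vanish on \<open>Idx\<close>.\<close>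

theorem independent:
  assumes "(\<Sum>p\<in>Idx. scalar (r p) * basis_lift (h r5_a) (h (r5_d * r5_e')) p) \<in> ideal" and "p \<in> Idx"
  shows "r p = 0"
proof -
  let ?o = "(0, 0, 0, 0) :: idx"
  have o: "?o \<in> Idx" "h5.basis ?o = 1"
    by (simp_all add: Idx_def gen_def h5.\<pi>_1)
  have act: "act.act (bas ?o) (basis_lift (h r5_a) (h (r5_d * r5_e')) p) = bas p" if "p \<in> Idx" for p
  proof -
    have "expand (act5.act (bas ?o) (basis_lift r5_a (r5_d * r5_e') p)) = expand (bas p)"
      using that o by (simp add: act5 vecs_closed expand_bas) (simp add: h5.basis_eq)
    then have "act5.act (bas ?o) (basis_lift r5_a (r5_d * r5_e') p) = bas p"
      using that o by (intro expand_inj) (simp_all add: act5 vecs_closed)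
    then show ?thesis by (metis vmap_act vmap_basis_lift vmap_simps(5))
  qed
  have "act.act (bas ?o) (\<Sum>p\<in>Idx. scalar (r p) * basis_lift (h r5_a) (h (r5_d * r5_e')) p) = (\<Sum>p\<in>Idx. r p \<cdot> bas p)"
    by (simp add: act.act_sum act.act_mult act.act_single act.act_scale_left act act.\<rho>_0)
  moreover have "act.act (bas ?o) (\<Sum>p\<in>Idx. scalar (r p) * basis_lift (h r5_a) (h (r5_d * r5_e')) p) \<in> N"
    by (rule act.act_ideal[OF subspace_N \<rho>_N _ assms(1)]) (auto intro: act_relator)
  ultimately have "Poly_Mapping.lookup (\<Sum>p\<in>Idx. r p \<cdot> bas p) p = 0"
    using assms(2) by (simp add: N_def)
  then show ?thesis
    using assms(2) by (simp add: lookup_sum lookup_single when_def if_distrib cong: if_cong)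
qed

end

subsection \<open>The Hecke algebra and the group of type \<open>G\<^sub>1\<^sub>6\<close>\<close>

definition u_inv :: laurent5 where "u_inv = Poly_Mapping.single (- 1, - 1, - 1, - 1, - 1) 1"

lemma u_inv: "u1 * u2 * u3 * u4 * u5 * u_inv = 1"
  by (simp add: u1_def u2_def u3_def u4_def u5_def u_inv_def mult_single flip: single_one) (simp add: zero_prod_def)

text \<open>The coefficients are the elementary symmetric polynomials with the signs obtained by
  solving the product of the factors X - u_j for X^5.\<close>

definition specialize :: "r5 \<Rightarrow> laurent5" where
  "specialize = r5_eval (u1 + u2 + u3 + u4 + u5)
     (- (u1*u2 + u1*u3 + u1*u4 + u1*u5 + u2*u3 + u2*u4 + u2*u5 + u3*u4 + u3*u5 + u4*u5))
     (u1*u2*u3 + u1*u2*u4 + u1*u2*u5 + u1*u3*u4 + u1*u3*u5 + u1*u4*u5 + u2*u3*u4 + u2*u3*u5 + u2*u4*u5 + u3*u4*u5)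
     (- (u1*u2*u3*u4 + u1*u2*u3*u5 + u1*u2*u4*u5 + u1*u3*u4*u5 + u2*u3*u4*u5))
     (u1*u2*u3*u4*u5) u_inv"

interpretation specialize: base_change specialize
  unfolding specialize_def base_change_def by (rule ring_hom_r5_eval[OF u_inv])

lemma hecke_g16_relator_eq:
  "hecke_g16_relator s = relator (specialize r5_a) (specialize r5_b) (specialize r5_c) (specialize r5_d)
      (specialize r5_e) s"
proof -
  let ?g = "group_elem s :: braid3 \<Rightarrow>\<^sub>0 laurent5"
  have comm: "?g * scalar u = scalar u * ?g" "?g * (scalar u * x) = scalar u * (?g * x)" for u x
    by (simp_all add: mult_single flip: mult.assoc)
  have scalar: "scalar (u * v) = scalar u * (scalar v :: braid3 \<Rightarrow>\<^sub>0 laurent5)" "scalar (- u) = - (scalar u ::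
      braid3 \<Rightarrow>\<^sub>0 laurent5)"
    "scalar (u - v) = scalar u - (scalar v :: braid3 \<Rightarrow>\<^sub>0 laurent5)" for u v
    by (simp_all add: mult_single single_uminus single_diff)
  have scalar_comm: "scalar u * scalar v = scalar v * (scalar u :: braid3 \<Rightarrow>\<^sub>0 laurent5)"
    "scalar u * (scalar v * x) = scalar v * (scalar u * x)" for u v x
    by (simp_all add: mult_single mult.commute flip: mult.assoc)
  show ?thesis
    unfolding hecke_g16_relator_def relator_def specialize_def r5_eval_gens
    by (simp add: scalar single_add eval_nat_numeral algebra_simps comm scalar_comm del: mult_single)
qed

interpretation hecke_g16: hecke_quotient scale_hecke_g16 abs_hecke_g16
  "specialize r5_a" "specialize r5_b" "specialize r5_c" "specialize r5_d" "specialize r5_e" "specialize r5_e'"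
proof unfold_locales
  show "range abs_hecke_g16 = UNIV"
    by (metis Quotient3_abs_rep[OF Quotient3_hecke_g16] surjI)
  show "abs_hecke_g16 (relator (specialize r5_a) (specialize r5_b) (specialize r5_c) (specialize r5_d)
      (specialize r5_e) s1) = 0"
    unfolding zero_hecke_g16_def hecke_g16.abs_eq_iff hecke_g16_relator_eq
    by (simp add: two_sided_ideal.base)
  show "specialize r5_e * specialize r5_e' = 1"
    by (simp add: r5_e_e' specialize.hom_1 flip: specialize.hom_mult)
qed (simp_all add: plus_hecke_g16.abs_eq times_hecke_g16.abs_eq one_hecke_g16_def scale_hecke_g16_def)

theorem free_hecke_g16: "free_of_rank scale_hecke_g16 600"
  using hecke_g16.module_axioms hecke_g16.span_basis
proof (rule free_of_rank_600)
  fix r p assume sum: "(\<Sum>p\<in>Idx. scale_hecke_g16 (r p) (hecke_g16.basis p)) = 0" and "p \<in> Idx"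
  from sum have "abs_hecke_g16 (\<Sum>p\<in>Idx. scalar (r p) * basis_lift (specialize r5_a) (specialize (r5_d * r5_e'))
      p) = 0"
    by (simp add: hecke_g16.basis_eq hecke_g16.\<pi>_sum hecke_g16.\<pi>_scalar specialize.hom_mult)
  then have "(\<Sum>p\<in>Idx. scalar (r p) * basis_lift (specialize r5_a) (specialize (r5_d * r5_e')) p) \<in> specialize.ideal"
    unfolding zero_hecke_g16_def hecke_g16.abs_eq_iff hecke_g16_relator_eq by simp
  from specialize.independent[OF this \<open>p \<in> Idx\<close>] show "r p = 0" .
qed

section \<open>The integral group ring and the order of the group\<close>

definition degenerate :: "r5 \<Rightarrow> int" where
  "degenerate = r5_eval 0 0 0 0 1 1"

interpretation degenerate: base_change degenerate
  unfolding degenerate_def base_change_def by (rule ring_hom_r5_eval) simp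

lemma degenerate_gens: "degenerate r5_a = 0" "degenerate r5_b = 0" "degenerate r5_c = 0" "degenerate r5_d = 0"
    "degenerate r5_e = 1" "degenerate r5_e' = 1"
  by (simp_all add: degenerate_def r5_eval_gens)

definition word :: "idx \<Rightarrow> braid3" where
  "word = (\<lambda>(n, k, i, j). gpow (garside + garside) k + (gpow s1 i +
     (if n = 0 then 0 else if n = 1 then garside + gpow s1 j
      else if n = 2 then garside + (gpow s1 2 + (garside + gpow s1 j))
      else garside + (gpow s1 2 + (garside + (gpow s1 (- 2) + garside))))))"

text \<open>The corrections of the last word carry the factors a and d/e, which vanish here.\<close>

lemma basis_lift_word: "basis_lift 0 0 p = (group_elem (word p) :: braid3 \<Rightarrow>\<^sub>0 int)"
  by (cases p) (simp add: basis_lift_def gen_def word_def mult_single)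

lemma normal_closure_ideal:
  assumes "x \<in> normal_closure g16_relators"
  shows "group_elem x - 1 \<in> degenerate.ideal"
  using assms
proof induction
  case (base x)
  have "group_elem (s + s + s + s + s) - 1 = relator 0 0 0 0 (1::int) s" for s
    by (simp add: relator_def eval_nat_numeral mult_single add.assoc)
  with base show ?case
    by (auto simp: g16_relators_def degenerate_gens intro: two_sided_ideal.base)
next
  case zero
  show ?case by (simp add: two_sided_ideal.zero)
next
  case (add x y)
  have "group_elem (x + y) - 1 = group_elem x * (group_elem y - 1) + (group_elem x - (1 :: braid3 \<Rightarrow>\<^sub>0 int))"
    by (simp add: mult_single algebra_simps)
  then show ?case using add.IH by (simp only:) (intro two_sided_ideal.add two_sided_ideal.mult_left)
next
  case (uminus x)
  have "group_elem (- x) - 1 = - group_elem (- x) * (group_elem x - (1 :: braid3 \<Rightarrow>\<^sub>0 int))"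
    by (simp add: mult_single algebra_simps)
  then show ?case using uminus.IH by (simp only:) (rule two_sided_ideal.mult_left)
next
  case (conj x g)
  have "group_elem (g + x + - g) - 1 = group_elem g * (group_elem x - (1 :: braid3 \<Rightarrow>\<^sub>0 int)) * group_elem (- g)"
    by (simp add: mult_single algebra_simps)
  then show ?case using conj.IH by (simp only:) (intro two_sided_ideal.mult_left two_sided_ideal.mult_right)
qed

text \<open>Two words equal in the group would differ by an element of the ideal, a relation with
  coefficients 1 and -1. This gives at least 600 elements.\<close>

lemma inj_on_word: "inj_on (\<lambda>p. abs_g16 (word p)) Idx"
proof (rule inj_onI, rule ccontr)
  fix p q assume pq: "p \<in> Idx" "q \<in> Idx" "abs_g16 (word p) = abs_g16 (word q)" "p \<noteq> q"
  have "(group_elem (word p - word q) - 1) * group_elem (word q) \<in> degenerate.ideal"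
    using pq(3) by (intro two_sided_ideal.mult_right normal_closure_ideal) (simp add: g16.abs_eq_iff)
  also have "(group_elem (word p - word q) - 1) * group_elem (word q) = group_elem (word p) - (group_elem (word
      q) :: braid3 \<Rightarrow>\<^sub>0 int)"
    by (simp add: mult_single algebra_simps)
  finally have ideal: "group_elem (word p) - group_elem (word q) \<in> degenerate.ideal" .
  define r :: "idx \<Rightarrow> int" where "r = (\<lambda>x. if x = p then 1 else if x = q then - 1 else 0)"
  have "(\<Sum>x\<in>Idx. scalar (r x) * basis_lift 0 0 x) = (\<Sum>x\<in>{p, q}. scalar (r x) * basis_lift 0 0 x)"
    using pq by (intro sum.mono_neutral_right) (auto simp: r_def)
  also have "\<dots> = group_elem (word p) - group_elem (word q)"
    using pq(4) by (simp add: r_def basis_lift_word mult_single single_uminus)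
  finally have "(\<Sum>x\<in>Idx. scalar (r x) * basis_lift 0 0 x) \<in> degenerate.ideal"
    using ideal by simp
  then have "r p = 0"
    using degenerate.independent[of r p] pq(1) by (simp add: degenerate_gens degenerate.hom_mult)
  then show False by (simp add: r_def)
qed

definition group_map :: "(braid3 \<Rightarrow>\<^sub>0 int) \<Rightarrow> (g16 \<Rightarrow>\<^sub>0 int)" where
  "group_map = pm_sum (\<lambda>g r. Poly_Mapping.single (abs_g16 g) r)"

lemma group_map_single: "group_map (Poly_Mapping.single g r) = Poly_Mapping.single (abs_g16 g) r"
  by (simp add: group_map_def)

lemma group_map_add: "group_map (x + y) = group_map x + group_map y"
  unfolding group_map_def by (rule pm_sum_add) (simp_all add: single_add)

lemma group_map_zero: "group_map 0 = 0"
  by (simp add: group_map_def)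

interpretation group_map: hecke_quotient "\<lambda>r x. scalar r * x" group_map 0 0 0 0 1 1
proof unfold_locales
  show "group_map (x * y) = group_map x * group_map y" for x y
  proof (induction x rule: poly_mapping_additive_induct)
    case (single g r)
    show ?case
    proof (induction y rule: poly_mapping_additive_induct)
      case (single g' r')
      show ?case by (simp add: mult_single group_map_single plus_g16.abs_eq)
    qed (simp_all add: group_map_zero group_map_add distrib_left)
  qed (simp_all add: group_map_zero group_map_add distrib_right)
  have "x \<in> range group_map" for x
  proof (induction x rule: poly_mapping_additive_induct)
    case zero
    show ?case by (rule range_eqI[of _ _ 0]) (simp add: group_map_zero)
  next
    case (single g r)
    show ?case by (induction g rule: g16.abs_induct) (metis group_map_single rangeI)
  next
    case (add x y)
    then show ?case by (auto simp flip: group_map_add)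
  qed
  then show "range group_map = UNIV" by auto
  show "group_map 1 = 1"
    using group_map_single[of 0 1] by (simp add: zero_g16.abs_eq[symmetric])
  show "group_map (relator 0 0 0 0 1 s1) = 0"
  proof -
    have "relator 0 0 0 0 (1::int) s1 = group_elem (s1 + s1 + s1 + s1 + s1) + - group_elem 0"
      by (simp add: relator_def eval_nat_numeral mult_single add.assoc)
    moreover have "abs_g16 (s1 + s1 + s1 + s1 + s1) = abs_g16 0"
      by (simp add: g16.abs_eq_iff g16_relators_def normal_closure.base del: add_0_right) 
    ultimately show ?thesis
      by (simp only: group_map_add group_map_single single_uminus[symmetric]) (simp flip: single_add)
  qed
qed (simp_all add: group_map_single group_map_add zero_g16.abs_eq[symmetric] single_add distrib_left
    distrib_right mult_single mult.assoc, simp_all add: mult_single flip: mult.assoc)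

text \<open>The basis of the group ring consists of group elements, so every element of its span is
  supported on the images of the words; for \<open>group_elem g\<close> this says that g is one of
  them.\<close>

lemma surj_word: "(\<lambda>p. abs_g16 (word p)) ` Idx = UNIV"
proof (intro equalityI UNIV_I subsetI)
  fix g :: g16
  let ?A = "{x :: g16 \<Rightarrow>\<^sub>0 int. Poly_Mapping.keys x \<subseteq> (\<lambda>p. abs_g16 (word p)) ` Idx}"
  have "group_map.basis p = group_elem (abs_g16 (word p))" for p
    by (subst group_map.basis_eq) (simp add: basis_lift_word group_map_single)
  then have "group_map.basis ` Idx \<subseteq> ?A"
    by auto
  moreover have "group_map.subspace ?A"
  proof (rule group_map.subspaceI)
    show "x + y \<in> ?A" if "x \<in> ?A" "y \<in> ?A" for x y
      using that Poly_Mapping.keys_add[of x y] by blast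
    show "scalar r * x \<in> ?A" if "x \<in> ?A" for r x
    proof -
      have "Poly_Mapping.lookup (scalar r * x) g = r * Poly_Mapping.lookup x g" for g
        by (induction x rule: poly_mapping_additive_induct)
          (auto simp: mult_single lookup_single lookup_add distrib_left when_def)
      then show ?thesis using that by (auto simp: in_keys_iff)
    qed
  qed simp
  ultimately have "group_elem g \<in> ?A"
    using group_map.span_minimal group_map.span_basis by blast
  then show "g \<in> (\<lambda>p. abs_g16 (word p)) ` Idx" by simp
qed

lemma card_g16: "card (UNIV :: g16 set) = 600"
  using card_image[OF inj_on_word] by (simp add: surj_word card_Idx)

theorem corollary2p2p15:
  shows "free_of_rank scale_h5 600 \<and>
    card (UNIV :: g16 set) = 600 \<and>
    free_of_rank scale_hecke_g16 (card (UNIV :: g16 set))"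
  by (simp add: free_h5 card_g16 free_hecke_g16)

end
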